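(* Let $\mathbb M$ be an $\mathcal R$-module. Then $\mathbb M$ is a left-exact SML $\mathcal R$-module if and only if $\mathbb M$ is a direct limit of submodule schemes $\mathcal N_i^*\subseteq\mathbb M$ such that the dual morphism $\mathbb M^*\to\mathcal N_i$ is an epimorphism for every $i$. In particular, $\mathbb M$ is a left-exact SML $\mathcal R$-module if and only if it is a left-exact ML $\mathcal R$-module and for every submodule scheme $\mathcal N^*\subseteq\mathbb M$ the dual morphism $\mathbb M^*\to\mathcal N$ is an epimorphism.
   Context: $R$ is an associative ring with unit; "$R$-module" means left $R$-module. An $\mathcal R$-module (resp. right $\mathcal R$-module) is a covariant additive functor from the category of left (resp. right) $R$-modules to the category of abelian groups; morphisms are natural transformations, and $\mathrm{Hom}_{\mathcal R}$ denotes morphisms. Monomorphisms, epimorphisms, submodules and direct limits are taken objectwise. For a right $R$-module $M$, the quasi-coherent $\mathcal R$-module $\mathcal M$ is $\mathcal M(N)=M\otimes_R N$; for a left $R$-module $M$, $\mathcal M$ is the right $\mathcal R$-module $\mathcal M(N)=N\otimes_R M$. The dual of an $\mathcal R$-module $\mathbb M$ is the right $\mathcal R$-module $\mathbb M^*(N):=\mathrm{Hom}_{\mathcal R}(\mathbb M,\mathcal N)$ for right $R$-modules $N$ (and symmetrically for right $\mathcal R$-modules); $\mathbb M^*(R)$ is a left $R$-module by functoriality in right multiplication-compatible endomorphisms of $R$ (an endomorphism of $R$ as a right module is left multiplication by an element of $R$). The $\mathcal R$-modules $\mathbb M$ considered are such that each $\mathbb M^*(N)$ is a set. For a left $R$-module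 $N$, $\mathcal N^*=\mathrm{Hom}_R(N,-)$ is the module scheme associated with $N$, and $\mathcal N^{**}=\mathcal N$ via the canonical morphism; a morphism $\mathcal N^*\to\mathbb M$ thus has a dual morphism $\mathbb M^*\to\mathcal N^{**}=\mathcal N$. A submodule scheme of $\mathbb M$ is an $\mathcal R$-submodule isomorphic to a module scheme; "$\mathbb M$ is a direct limit of submodule schemes" means $\mathbb M$ is the union of a family (indexed by a set) of submodule schemes, upward directed by inclusion. $\mathbb M$ is left-exact if it is a left-exact functor. $\mathbb M$ is an ML $\mathcal R$-module if $\mathbb M(\prod_{i\in I}N_i)\to\prod_{i\in I}\mathbb M(N_i)$ is injective for every set $\{N_i\}_{i\in I}$ of $R$-modules. $\mathbb M$ is an SML $\mathcal R$-module if for every $R$-module $N$ the natural morphism $\mathbb M(N)\to\mathrm{Hom}_R(\mathbb M^*(R),N)$, $m\mapsto\tilde m$, $\tilde m(w)=w_N(m)$ (where $w_N\colon\mathbb M(N)\to R\otimes_RN=N$), is injective. *)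

theory Defs
  imports
    "HOL-Algebra.Module"
    "HOL-Algebra.AbelCoset"
    "HOL-Algebra.Free_Abelian_Groups"
    "HOL-Library.Equipollence"
begin

section \<open>Sets and classes\<close>

text \<open>
  The theory is about functors on the category of all modules over a ring, so it needs a
  distinction between sets and classes. A type \<open>'u\<close> of the following class plays the role of the
  universe: subsets of \<open>'u\<close> are classes, and a collection \<open>A\<close> (of any type) is a set, or small, if
  \<open>A \<prec> (UNIV :: 'u set)\<close>. The axioms say that the cardinality of \<open>'u\<close> is a regular strong limit,
  i.e. small sets are closed under power sets and small unions (as in a Grothendieck universe).
  Infinity of \<open>'u\<close> follows. Uncountability is not needed and is not imposed: for \<open>'u = nat\<close>
  small means finite, and an uncountable \<open>'u\<close> has inaccessible cardinality.
\<close>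

class set_universe =
  assumes Pow_small: "(A :: 'a set) \<prec> (UNIV :: 'a set) \<Longrightarrow> Pow A \<prec> (UNIV :: 'a set)"
    and Union_small: "(A :: 'a set) \<prec> (UNIV :: 'a set) \<Longrightarrow>
          (\<And>a. a \<in> A \<Longrightarrow> (F a :: 'a set) \<prec> (UNIV :: 'a set)) \<Longrightarrow> (\<Union>a\<in>A. F a) \<prec> (UNIV :: 'a set)"

lemma lesspoll_UNIV_nat_iff: "A \<prec> (UNIV :: nat set) \<longleftrightarrow> finite A"
proof
  assume "A \<prec> (UNIV :: nat set)"
  then show "finite A"
    by (meson infinite_le_lepoll lesspoll_def lepoll_antisym)
next
  assume "finite A"
  then show "A \<prec> (UNIV :: nat set)"
    by (simp add: finite_lesspoll_infinite)
qed

instance nat :: set_universe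
  by standard (auto simp: lesspoll_UNIV_nat_iff)

section \<open>Modules\<close>

text \<open>
  HOL-Algebra only has modules over commutative rings; its record type is reused here.
  The fields \<open>mult\<close> and \<open>one\<close> that a module record inherits from rings play no role.
\<close>

locale left_module = R?: ring R + M?: abelian_group M for R (structure) and M (structure) +
  assumes smult_closed:
      "\<lbrakk>a \<in> carrier R; x \<in> carrier M\<rbrakk> \<Longrightarrow> a \<odot>\<^bsub>M\<^esub> x \<in> carrier M"
    and smult_l_distr:
      "\<lbrakk>a \<in> carrier R; b \<in> carrier R; x \<in> carrier M\<rbrakk> \<Longrightarrow>
        (a \<oplus> b) \<odot>\<^bsub>M\<^esub> x = a \<odot>\<^bsub>M\<^esub> x \<oplus>\<^bsub>M\<^esub> b \<odot>\<^bsub>M\<^esub> x"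
    and smult_r_distr:
      "\<lbrakk>a \<in> carrier R; x \<in> carrier M; y \<in> carrier M\<rbrakk> \<Longrightarrow>
        a \<odot>\<^bsub>M\<^esub> (x \<oplus>\<^bsub>M\<^esub> y) = a \<odot>\<^bsub>M\<^esub> x \<oplus>\<^bsub>M\<^esub> a \<odot>\<^bsub>M\<^esub> y"
    and smult_assoc:
      "\<lbrakk>a \<in> carrier R; b \<in> carrier R; x \<in> carrier M\<rbrakk> \<Longrightarrow>
        (a \<otimes> b) \<odot>\<^bsub>M\<^esub> x = a \<odot>\<^bsub>M\<^esub> (b \<odot>\<^bsub>M\<^esub> x)"
    and smult_one: "x \<in> carrier M \<Longrightarrow> \<one> \<odot>\<^bsub>M\<^esub> x = x"

text \<open>In a right module, \<open>a \<odot> x\<close> stands for \<open>x a\<close>.\<close>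

locale right_module = R?: ring R + M?: abelian_group M for R (structure) and M (structure) +
  assumes smult_closed:
      "\<lbrakk>a \<in> carrier R; x \<in> carrier M\<rbrakk> \<Longrightarrow> a \<odot>\<^bsub>M\<^esub> x \<in> carrier M"
    and smult_l_distr:
      "\<lbrakk>a \<in> carrier R; b \<in> carrier R; x \<in> carrier M\<rbrakk> \<Longrightarrow>
        (a \<oplus> b) \<odot>\<^bsub>M\<^esub> x = a \<odot>\<^bsub>M\<^esub> x \<oplus>\<^bsub>M\<^esub> b \<odot>\<^bsub>M\<^esub> x"
    and smult_r_distr:
      "\<lbrakk>a \<in> carrier R; x \<in> carrier M; y \<in> carrier M\<rbrakk> \<Longrightarrow>
        a \<odot>\<^bsub>M\<^esub> (x \<oplus>\<^bsub>M\<^esub> y) = a \<odot>\<^bsub>M\<^esub> x \<oplus>\<^bsub>M\<^esub> a \<odot>\<^bsub>M\<^esub> y"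
    and smult_assoc:
      "\<lbrakk>a \<in> carrier R; b \<in> carrier R; x \<in> carrier M\<rbrakk> \<Longrightarrow>
        (a \<otimes> b) \<odot>\<^bsub>M\<^esub> x = b \<odot>\<^bsub>M\<^esub> (a \<odot>\<^bsub>M\<^esub> x)"
    and smult_one: "x \<in> carrier M \<Longrightarrow> \<one> \<odot>\<^bsub>M\<^esub> x = x"

type_synonym 'u mdl = "('u, 'u) module"

definition LMod :: "('u::set_universe) ring \<Rightarrow> 'u mdl set" where
  "LMod R = {X. left_module R X \<and> carrier X \<prec> (UNIV :: 'u set)}"

definition RMod :: "('u::set_universe) ring \<Rightarrow> 'u mdl set" where
  "RMod R = {Y. right_module R Y \<and> carrier Y \<prec> (UNIV :: 'u set)}"

definition regular_right :: "'u ring \<Rightarrow> 'u mdl" where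
  "regular_right R = \<lparr>carrier = carrier R, monoid.mult = monoid.mult R, one = one R,
     ring.zero = ring.zero R, add = add R, smult = (\<lambda>a x. x \<otimes>\<^bsub>R\<^esub> a)\<rparr>"

text \<open>
  Linear maps are extensional (\<open>undefined\<close> outside the carrier of the source), so that equality in
  HOL is equality of maps.
\<close>

definition mod_hom :: "'u ring \<Rightarrow> 'u mdl \<Rightarrow> 'u mdl \<Rightarrow> ('u \<Rightarrow> 'u) set" where
  "mod_hom R X Y = {f \<in> carrier X \<rightarrow>\<^sub>E carrier Y.
     (\<forall>x\<in>carrier X. \<forall>y\<in>carrier X. f (x \<oplus>\<^bsub>X\<^esub> y) = f x \<oplus>\<^bsub>Y\<^esub> f y) \<and>
     (\<forall>a\<in>carrier R. \<forall>x\<in>carrier X. f (a \<odot>\<^bsub>X\<^esub> x) = a \<odot>\<^bsub>Y\<^esub> f x)}"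

section \<open>Tensor products\<close>

type_synonym 'u tensor_elt = "('u \<times> 'u \<Rightarrow>\<^sub>0 int) set"

definition tensor_relators :: "'u ring \<Rightarrow> 'u mdl \<Rightarrow> 'u mdl \<Rightarrow> ('u \<times> 'u \<Rightarrow>\<^sub>0 int) set" where
  "tensor_relators R Y X =
     {frag_of (y \<oplus>\<^bsub>Y\<^esub> y', x) - frag_of (y, x) - frag_of (y', x) | y y' x.
        y \<in> carrier Y \<and> y' \<in> carrier Y \<and> x \<in> carrier X} \<union>
     {frag_of (y, x \<oplus>\<^bsub>X\<^esub> x') - frag_of (y, x) - frag_of (y, x') | y x x'.
        y \<in> carrier Y \<and> x \<in> carrier X \<and> x' \<in> carrier X} \<union>
     {frag_of (a \<odot>\<^bsub>Y\<^esub> y, x) - frag_of (y, a \<odot>\<^bsub>X\<^esub> x) | a y x.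
        a \<in> carrier R \<and> y \<in> carrier Y \<and> x \<in> carrier X}"

definition tensor_null :: "'u ring \<Rightarrow> 'u mdl \<Rightarrow> 'u mdl \<Rightarrow> ('u \<times> 'u \<Rightarrow>\<^sub>0 int) set" where
  "tensor_null R Y X =
     generate (free_Abelian_group (carrier Y \<times> carrier X)) (tensor_relators R Y X)"

definition tensor :: "'u ring \<Rightarrow> 'u mdl \<Rightarrow> 'u mdl \<Rightarrow> 'u tensor_elt monoid" where
  "tensor R Y X = free_Abelian_group (carrier Y \<times> carrier X) Mod tensor_null R Y X"

definition pure_tensor :: "'u ring \<Rightarrow> 'u mdl \<Rightarrow> 'u mdl \<Rightarrow> 'u \<Rightarrow> 'u \<Rightarrow> 'u tensor_elt" where
  "pure_tensor R Y X y x =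
     tensor_null R Y X #>\<^bsub>free_Abelian_group (carrier Y \<times> carrier X)\<^esub> frag_of (y, x)"

text \<open>
  The map \<open>Y \<otimes> f : Y \<otimes> X \<rightarrow> Y \<otimes> X'\<close>. A coset is mapped elementwise into
  the free group on \<open>Y \<times> X'\<close>; the image is contained in a single coset, which is recovered by
  multiplying with the subgroup of relations.
\<close>

definition tensor_map ::
  "'u ring \<Rightarrow> 'u mdl \<Rightarrow> 'u mdl \<Rightarrow> 'u mdl \<Rightarrow> ('u \<Rightarrow> 'u) \<Rightarrow> 'u tensor_elt \<Rightarrow> 'u tensor_elt" where
  "tensor_map R Y X X' f t =
     tensor_null R Y X' <#>\<^bsub>free_Abelian_group (carrier Y \<times> carrier X')\<^esub>
       frag_extend (\<lambda>(y, x). frag_of (y, f x)) ` t"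

section \<open>Functors from left modules to abelian groups\<close>

text \<open>
  Abelian groups are written multiplicatively. Their elements may have any type \<open>'v\<close>, as
  tensor products and groups of linear maps do not live in \<open>'u\<close> itself.
\<close>

record ('u, 'v) module_functor =
  Fob :: "'u mdl \<Rightarrow> 'v monoid"
  Fmap :: "'u mdl \<Rightarrow> 'u mdl \<Rightarrow> ('u \<Rightarrow> 'u) \<Rightarrow> 'v \<Rightarrow> 'v"

locale functorial_module =
  fixes R :: "('u::set_universe) ring" and M :: "('u, 'v) module_functor"
  assumes Fob_group: "X \<in> LMod R \<Longrightarrow> comm_group (Fob M X)"
    and Fob_small: "X \<in> LMod R \<Longrightarrow> carrier (Fob M X) \<prec> (UNIV :: 'u set)"
    and Fmap_hom: "\<lbrakk>X \<in> LMod R; Y \<in> LMod R; f \<in> mod_hom R X Y\<rbrakk> \<Longrightarrow>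
          Fmap M X Y f \<in> hom (Fob M X) (Fob M Y)"
    and Fmap_id: "\<lbrakk>X \<in> LMod R; m \<in> carrier (Fob M X)\<rbrakk> \<Longrightarrow>
          Fmap M X X (\<lambda>x\<in>carrier X. x) m = m"
    and Fmap_comp: "\<lbrakk>X \<in> LMod R; Y \<in> LMod R; Z \<in> LMod R; f \<in> mod_hom R X Y; g \<in> mod_hom R Y Z;
          m \<in> carrier (Fob M X)\<rbrakk> \<Longrightarrow>
          Fmap M X Z (compose (carrier X) g f) m = Fmap M Y Z g (Fmap M X Y f m)"
    and Fmap_add: "\<lbrakk>X \<in> LMod R; Y \<in> LMod R; f \<in> mod_hom R X Y; g \<in> mod_hom R X Y;
          m \<in> carrier (Fob M X)\<rbrakk> \<Longrightarrow>
          Fmap M X Y (\<lambda>x\<in>carrier X. f x \<oplus>\<^bsub>Y\<^esub> g x) m = Fmap M X Y f m \<otimes>\<^bsub>Fob M Y\<^esub> Fmap M X Y g m"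

text \<open>
  Natural transformations, again extensional (in the module as well as in the element).
\<close>

definition nat_hom :: "('u::set_universe) ring \<Rightarrow> ('u, 'v) module_functor \<Rightarrow>
    ('u, 'w) module_functor \<Rightarrow> ('u mdl \<Rightarrow> 'v \<Rightarrow> 'w) set" where
  "nat_hom R F G =
     {t \<in> (\<Pi>\<^sub>E X\<in>LMod R. hom (Fob F X) (Fob G X) \<inter> extensional (carrier (Fob F X))).
        \<forall>X\<in>LMod R. \<forall>Y\<in>LMod R. \<forall>f\<in>mod_hom R X Y. \<forall>m\<in>carrier (Fob F X).
          t Y (Fmap F X Y f m) = Fmap G X Y f (t X m)}"

definition nat_iso :: "('u::set_universe) ring \<Rightarrow> ('u, 'v) module_functor \<Rightarrow>
    ('u, 'w) module_functor \<Rightarrow> ('u mdl \<Rightarrow> 'v \<Rightarrow> 'w) set" where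
  "nat_iso R F G =
     {t \<in> nat_hom R F G. \<forall>X\<in>LMod R. bij_betw (t X) (carrier (Fob F X)) (carrier (Fob G X))}"

text \<open>The quasi-coherent module \<open>X \<mapsto> Y \<otimes> X\<close> of a right module \<open>Y\<close>.\<close>

definition quasi_coherent :: "'u ring \<Rightarrow> 'u mdl \<Rightarrow> ('u, 'u tensor_elt) module_functor" where
  "quasi_coherent R Y = \<lparr>Fob = tensor R Y, Fmap = tensor_map R Y\<rparr>"

text \<open>The value at the right module \<open>Y\<close> of the dual of \<open>M\<close>.\<close>

definition dual :: "('u::set_universe) ring \<Rightarrow> ('u, 'v) module_functor \<Rightarrow> 'u mdl \<Rightarrow>
    ('u mdl \<Rightarrow> 'v \<Rightarrow> 'u tensor_elt) set" where
  "dual R M Y = nat_hom R M (quasi_coherent R Y)"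

text \<open>The module scheme \<open>Hom(N, -)\<close> of a left module \<open>N\<close>.\<close>

definition module_scheme :: "'u ring \<Rightarrow> 'u mdl \<Rightarrow> ('u, 'u \<Rightarrow> 'u) module_functor" where
  "module_scheme R N = \<lparr>
     Fob = (\<lambda>X. \<lparr>carrier = mod_hom R N X, monoid.mult = (\<lambda>f g. \<lambda>x\<in>carrier N. f x \<oplus>\<^bsub>X\<^esub> g x),
                 one = (\<lambda>x\<in>carrier N. \<zero>\<^bsub>X\<^esub>)\<rparr>),
     Fmap = (\<lambda>X Y h f. compose (carrier N) h f)\<rparr>"

section \<open>Submodule schemes and dual morphisms\<close>

definition submodule_functor ::
    "('u::set_universe) ring \<Rightarrow> ('u, 'v) module_functor \<Rightarrow> ('u mdl \<Rightarrow> 'v set) \<Rightarrow> bool" where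
  "submodule_functor R M S \<longleftrightarrow>
     (\<forall>X\<in>LMod R. subgroup (S X) (Fob M X)) \<and>
     (\<forall>X\<in>LMod R. \<forall>Y\<in>LMod R. \<forall>f\<in>mod_hom R X Y. Fmap M X Y f ` S X \<subseteq> S Y)"

definition restrict_functor ::
    "('u, 'v) module_functor \<Rightarrow> ('u mdl \<Rightarrow> 'v set) \<Rightarrow> ('u, 'v) module_functor" where
  "restrict_functor M S = \<lparr>Fob = (\<lambda>X. (Fob M X)\<lparr>carrier := S X\<rparr>), Fmap = Fmap M\<rparr>"

text \<open>
  \<open>S\<close> is a submodule scheme of \<open>M\<close>, identified with the module scheme of \<open>N\<close> via \<open>\<theta>\<close>.
  As a function, \<open>\<theta>\<close> is also the resulting monomorphism from the module scheme to \<open>M\<close>.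
\<close>

definition submodule_scheme :: "('u::set_universe) ring \<Rightarrow> ('u, 'v) module_functor \<Rightarrow>
    ('u mdl \<Rightarrow> 'v set) \<Rightarrow> 'u mdl \<Rightarrow> ('u mdl \<Rightarrow> ('u \<Rightarrow> 'u) \<Rightarrow> 'v) \<Rightarrow> bool" where
  "submodule_scheme R M S N \<theta> \<longleftrightarrow>
     submodule_functor R M S \<and> N \<in> LMod R \<and>
     \<theta> \<in> nat_iso R (module_scheme R N) (restrict_functor M S)"

text \<open>\<open>transpose R F \<phi>\<close> is precomposition with \<open>\<phi> : F \<rightarrow> M\<close>, from the dual of \<open>M\<close> to the dual of \<open>F\<close>.\<close>

definition transpose :: "('u::set_universe) ring \<Rightarrow> ('u, 'w) module_functor \<Rightarrow>
    ('u mdl \<Rightarrow> 'w \<Rightarrow> 'v) \<Rightarrow> ('u mdl \<Rightarrow> 'v \<Rightarrow> 'z) \<Rightarrow> ('u mdl \<Rightarrow> 'w \<Rightarrow> 'z)" where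
  "transpose R F \<phi> w = (\<lambda>X\<in>LMod R. compose (carrier (Fob F X)) (w X) (\<phi> X))"

text \<open>
  The canonical morphism from \<open>Y \<otimes> N\<close> to the value at \<open>Y\<close> of the bidual of \<open>N\<close>, i.e. of the dual
  of \<open>module_scheme R N\<close>: it sends \<open>t\<close> to \<open>f \<mapsto> (Y \<otimes> f) t\<close>. It is bijective, which gives the
  identification used in \<open>dual_morphism\<close>.
\<close>

definition bidual_map :: "('u::set_universe) ring \<Rightarrow> 'u mdl \<Rightarrow> 'u mdl \<Rightarrow> 'u tensor_elt \<Rightarrow>
    ('u mdl \<Rightarrow> ('u \<Rightarrow> 'u) \<Rightarrow> 'u tensor_elt)" where
  "bidual_map R N Y t = (\<lambda>X\<in>LMod R. \<lambda>f\<in>mod_hom R N X. tensor_map R Y N X f t)"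

definition dual_morphism :: "('u::set_universe) ring \<Rightarrow> 'u mdl \<Rightarrow>
    ('u mdl \<Rightarrow> ('u \<Rightarrow> 'u) \<Rightarrow> 'v) \<Rightarrow> 'u mdl \<Rightarrow>
    ('u mdl \<Rightarrow> 'v \<Rightarrow> 'u tensor_elt) \<Rightarrow> 'u tensor_elt" where
  "dual_morphism R N \<phi> Y w =
     the_inv_into (carrier (tensor R Y N)) (bidual_map R N Y) (transpose R (module_scheme R N) \<phi> w)"

definition dual_morphism_epi :: "('u::set_universe) ring \<Rightarrow> ('u, 'v) module_functor \<Rightarrow> 'u mdl \<Rightarrow>
    ('u mdl \<Rightarrow> ('u \<Rightarrow> 'u) \<Rightarrow> 'v) \<Rightarrow> bool" where
  "dual_morphism_epi R M N \<phi> \<longleftrightarrow>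
     (\<forall>Y\<in>RMod R. dual_morphism R N \<phi> Y ` dual R M Y = carrier (tensor R Y N))"

definition direct_limit_of_submodule_schemes :: "('u::set_universe) ring \<Rightarrow>
    ('u, 'v) module_functor \<Rightarrow> 'u set \<Rightarrow> ('u \<Rightarrow> 'u mdl \<Rightarrow> 'v set) \<Rightarrow> ('u \<Rightarrow> 'u mdl) \<Rightarrow>
    ('u \<Rightarrow> 'u mdl \<Rightarrow> ('u \<Rightarrow> 'u) \<Rightarrow> 'v) \<Rightarrow> bool" where
  "direct_limit_of_submodule_schemes R M I S N \<theta> \<longleftrightarrow>
     I \<prec> (UNIV :: 'u set) \<and> I \<noteq> {} \<and>
     (\<forall>i\<in>I. submodule_scheme R M (S i) (N i) (\<theta> i)) \<and>
     (\<forall>i\<in>I. \<forall>j\<in>I. \<exists>k\<in>I. \<forall>X\<in>LMod R. S i X \<subseteq> S k X \<and> S j X \<subseteq> S k X) \<and>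
     (\<forall>X\<in>LMod R. carrier (Fob M X) = (\<Union>i\<in>I. S i X))"

section \<open>Left-exact, Mittag-Leffler and strict Mittag-Leffler modules\<close>

definition left_exact :: "('u::set_universe) ring \<Rightarrow> ('u, 'v) module_functor \<Rightarrow> bool" where
  "left_exact R M \<longleftrightarrow>
     (\<forall>A\<in>LMod R. \<forall>B\<in>LMod R. \<forall>C\<in>LMod R. \<forall>f\<in>mod_hom R A B. \<forall>g\<in>mod_hom R B C.
        inj_on f (carrier A) \<and> f ` carrier A = a_kernel B C g \<longrightarrow>
        inj_on (Fmap M A B f) (carrier (Fob M A)) \<and>
        Fmap M A B f ` carrier (Fob M A) = kernel (Fob M B) (Fob M C) (Fmap M B C g))"

text \<open>
  The set of families indexed by \<open>I\<close> is not a subset of \<open>'u\<close>, so a product is any module \<open>P\<close> whose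
  projections \<open>\<pi> i\<close> identify it with the set of families. Every small family has such a product, by
  the axioms of \<open>set_universe\<close>, and any two are isomorphic.
\<close>

definition is_product :: "('u::set_universe) ring \<Rightarrow> 'u set \<Rightarrow> ('u \<Rightarrow> 'u mdl) \<Rightarrow> 'u mdl \<Rightarrow>
    ('u \<Rightarrow> 'u \<Rightarrow> 'u) \<Rightarrow> bool" where
  "is_product R I N P \<pi> \<longleftrightarrow>
     P \<in> LMod R \<and> (\<forall>i\<in>I. \<pi> i \<in> mod_hom R P (N i)) \<and>
     bij_betw (\<lambda>x. \<lambda>i\<in>I. \<pi> i x) (carrier P) (\<Pi>\<^sub>E i\<in>I. carrier (N i))"

definition mittag_leffler :: "('u::set_universe) ring \<Rightarrow> ('u, 'v) module_functor \<Rightarrow> bool" where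
  "mittag_leffler R M \<longleftrightarrow>
     (\<forall>I N P \<pi>. I \<prec> (UNIV :: 'u set) \<and> (\<forall>i\<in>I. N i \<in> LMod R) \<and> is_product R I N P \<pi> \<longrightarrow>
        inj_on (\<lambda>m. \<lambda>i\<in>I. Fmap M P (N i) (\<pi> i) m) (carrier (Fob M P)))"

text \<open>
  The identification of \<open>R \<otimes> N\<close> with \<open>N\<close>, as the inverse of \<open>n \<mapsto> 1 \<otimes> n\<close>.
\<close>

definition tensor_unit :: "('u::set_universe) ring \<Rightarrow> 'u mdl \<Rightarrow> 'u tensor_elt \<Rightarrow> 'u" where
  "tensor_unit R N =
     the_inv_into (carrier N) (pure_tensor R (regular_right R) N \<one>\<^bsub>R\<^esub>)"

text \<open>
  The map sending \<open>m\<close> to \<open>w \<mapsto> w\<^sub>N(m)\<close>, defined for \<open>w\<close> in the dual of \<open>M\<close> evaluated at \<open>R\<close>. Its values are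
  linear for the left module structure that this dual inherits from \<open>R\<close>; the structure itself does not
  enter into the injectivity of the map.
\<close>

definition eval_map :: "('u::set_universe) ring \<Rightarrow> ('u, 'v) module_functor \<Rightarrow> 'u mdl \<Rightarrow> 'v \<Rightarrow>
    ('u mdl \<Rightarrow> 'v \<Rightarrow> 'u tensor_elt) \<Rightarrow> 'u" where
  "eval_map R M N m = (\<lambda>w\<in>dual R M (regular_right R). tensor_unit R N (w N m))"

definition strict_mittag_leffler :: "('u::set_universe) ring \<Rightarrow> ('u, 'v) module_functor \<Rightarrow> bool" where
  "strict_mittag_leffler R M \<longleftrightarrow> (\<forall>N\<in>LMod R. inj_on (eval_map R M N) (carrier (Fob M N)))"

end

theory Submission
  imports Defs
begin

text \<open>
  Write \<open>D\<close> for the dual of \<open>M\<close> evaluated at \<open>R\<close>. An element \<open>m\<close> of \<open>M(X)\<close> gives a linear map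
  \<open>m~ : D \<rightarrow> X\<close>, \<open>w \<mapsto> w\<^sub>X(m)\<close> (written \<open>val X m\<close> below), natural in the sense that \<open>(f\<^sub>* m)~ = f \<circ> m~\<close>; \<open>M\<close> is strict
  Mittag-Leffler iff \<open>m~ = 0\<close> forces \<open>m = 0\<close>. By the Yoneda lemma a morphism from the module scheme of
  \<open>N\<close> to \<open>M\<close> is an element \<open>n\<close> of \<open>M(N)\<close>. It is a monomorphism iff \<open>n\<close> is faithful: a linear map
  \<open>f\<close> on \<open>N\<close> is determined by \<open>f\<^sub>* n\<close>. Its dual morphism is \<open>w \<mapsto> w\<^sub>N(n)\<close>, and it is an epimorphism
  iff \<open>n~\<close> maps onto \<open>N\<close> (\<open>dual_morphism_epi_iff\<close>): for a right module \<open>Y\<close> the tensor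
  \<open>y \<otimes> n~(w)\<close> is the value at \<open>n\<close> of the composite of \<open>w\<close> with \<open>y : R \<rightarrow> Y\<close>. In that case \<open>n\<close> is
  called a dual generator; naturality of \<open>n~\<close> shows that it is faithful. The theorem thus compares the
  smallest submodule \<open>N \<subseteq> X\<close> with \<open>m \<in> M(N)\<close> and the image of \<open>m~\<close>.

  Let \<open>M\<close> be left exact and strict Mittag-Leffler, \<open>m \<in> M(X)\<close>, and \<open>N\<close> the image of \<open>m~\<close>. The image
  of \<open>m\<close> in \<open>M(X/N)\<close> induces the zero map on \<open>D\<close>, hence is \<open>0\<close>, and \<open>m\<close> comes from some
  \<open>n \<in> M(N)\<close> by left exactness; this \<open>n\<close> is a dual generator (\<open>exists_dual_generator\<close>). So \<open>M\<close> is the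
  union of the submodule schemes given by dual generators. The union is directed: two dual generators
  \<open>n\<^sub>1\<close>, \<open>n\<^sub>2\<close> give an element of \<open>M(N\<^sub>1 \<times> N\<^sub>2)\<close>, and a dual generator for that element dominates both. It
  is indexed by a set: \<open>N\<close> is the quotient of \<open>D\<close> by the kernel of \<open>n~\<close>, and \<open>n\<close> is determined by
  \<open>n~\<close>, so that the subsets of \<open>D\<close> suffice as indices (\<open>dual_generator_factor\<close>).

  Conversely, a union of module schemes is left exact because each of them is
  (\<open>left_exact_if_covered_by_schemes\<close>), and if \<open>m = h\<^sub>* n\<close> with \<open>n\<close> a dual generator, then \<open>m~ = h \<circ> n~\<close>
  vanishes only for \<open>h = 0\<close> (\<open>strict_mittag_leffler_if_covered_by_dual_generators\<close>).

  For the second equivalence, a strict Mittag-Leffler module is Mittag-Leffler because \<open>m~\<close> is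
  computed coordinatewise on a product, and for faithful \<open>n\<close> the map from \<open>N\<close> to the quotient by the image of
  \<open>n~\<close> kills \<open>n\<close>, hence is zero, so \<open>n\<close> is a dual generator. In the other direction, a left exact
  Mittag-Leffler module commutes with intersections of submodules: if \<open>m\<close> lies in \<open>M(K)\<close> for all
  \<open>K\<close> in a family, it vanishes in the product of the quotients \<open>X/K\<close>. Hence there is a smallest \<open>N\<close>
  with \<open>m \<in> M(N)\<close>, and minimality makes \<open>m\<close> faithful as an element of \<open>M(N)\<close>
  (\<open>exists_faithful_element\<close>). By hypothesis this element is a dual generator, and the covering argument applies.
\<close>

section \<open>Small sets\<close>

text \<open>
  In a universe with \<open>n\<close> elements, the complement of a point would be small although its power set has
  \<open>2 ^ (n - 1) \<ge> n\<close> elements.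
\<close>

lemma infinite_universe: "infinite (UNIV :: 'u::set_universe set)"
proof
  assume fin: "finite (UNIV :: 'u set)"
  let ?A = "UNIV - {undefined :: 'u}"
  have card: "card ?A = card (UNIV :: 'u set) - 1"
    by (simp add: card_Diff_singleton)
  have pos: "card (UNIV :: 'u set) > 0"
    using fin by (simp add: card_gt_0_iff)
  have "?A \<prec> (UNIV :: 'u set)"
    using fin card pos by (auto simp: lesspoll_def lepoll_iff_card_le eqpoll_iff_card finite_subset)
  then have "Pow ?A \<prec> (UNIV :: 'u set)"
    by (rule Pow_small)
  then have "card (Pow ?A) \<le> card (UNIV :: 'u set)" "card (Pow ?A) \<noteq> card (UNIV :: 'u set)"
    using fin by (auto simp: lesspoll_def lepoll_iff_card_le eqpoll_iff_card finite_subset)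
  then have "2 ^ (card (UNIV :: 'u set) - 1) < card (UNIV :: 'u set)"
    using card card_Pow[of ?A] fin finite_subset[of ?A UNIV] by simp
  moreover have "card (UNIV :: 'u set) - 1 < 2 ^ (card (UNIV :: 'u set) - 1)"
    by (rule less_exp)
  ultimately show False
    by linarith
qed

lemma small_Pow:
  assumes "A \<prec> (UNIV :: 'u::set_universe set)"
  shows "Pow A \<prec> (UNIV :: 'u set)"
proof -
  obtain f :: "'a \<Rightarrow> 'u" where f: "inj_on f A"
    using assms by (auto simp: lesspoll_def lepoll_def)
  have "Pow (f ` A) \<prec> (UNIV :: 'u set)"
    by (rule Pow_small) (use assms f in simp)
  moreover have "Pow A \<lesssim> Pow (f ` A)"
    unfolding lepoll_def using f by (intro exI[of _ "(`) f"]) (auto intro: inj_on_image_Pow)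
  ultimately show ?thesis
    using lesspoll_trans1 by blast
qed

text \<open>
  An infinite universe contains its own square, so that the product becomes a small union of copies of
  \<open>B\<close> inside \<open>'u\<close>.
\<close>

lemma small_Times:
  assumes "A \<prec> (UNIV :: 'u::set_universe set)" "B \<prec> (UNIV :: 'u set)"
  shows "(A :: 'u set) \<times> (B :: 'u set) \<prec> (UNIV :: 'u set)"
proof -
  have "(UNIV :: 'u set) \<times> (UNIV :: 'u set) \<approx> (UNIV :: 'u set)"
    using card_of_Times_same_infinite[OF infinite_universe] by (simp add: eqpoll_iff_card_of_ordIso)
  then obtain p :: "'u \<times> 'u \<Rightarrow> 'u" where p: "inj p"
    by (auto simp: eqpoll_def bij_betw_def)
  have "(\<lambda>b. p (a, b)) ` B \<prec> (UNIV :: 'u set)" for a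
    using assms(2) p lesspoll_trans1[OF image_lepoll] by blast
  then have "(\<Union>a\<in>A. (\<lambda>b. p (a, b)) ` B) \<prec> (UNIV :: 'u set)"
    by (rule Union_small[OF assms(1)])
  also have "(\<Union>a\<in>A. (\<lambda>b. p (a, b)) ` B) = p ` (A \<times> B)"
    by auto
  finally show ?thesis
    using inj_on_subset[OF p, of "A \<times> B"] by simp
qed

lemma small_PiE:
  assumes "I \<prec> (UNIV :: 'u::set_universe set)" "\<And>i. i \<in> I \<Longrightarrow> A i \<prec> (UNIV :: 'u set)"
  shows "Pi\<^sub>E (I :: 'u set) (A :: 'u \<Rightarrow> 'u set) \<prec> (UNIV :: 'u set)"
proof -
  have "Pow (I \<times> (\<Union>i\<in>I. A i)) \<prec> (UNIV :: 'u set)"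
    using small_Pow[OF small_Times[OF assms(1) Union_small[OF assms(1), of A]]] assms(2) by simp
  moreover have "Pi\<^sub>E I A \<lesssim> Pow (I \<times> (\<Union>i\<in>I. A i))"
    unfolding lepoll_def
  proof (intro exI conjI)
    show "inj_on (\<lambda>f. (\<lambda>i. (i, f i)) ` I) (Pi\<^sub>E I A)"
    proof (rule inj_onI)
      fix f g
      assume fg: "f \<in> Pi\<^sub>E I A" "g \<in> Pi\<^sub>E I A" and eq: "(\<lambda>i. (i, f i)) ` I = (\<lambda>i. (i, g i)) ` I"
      have "f i = g i" if "i \<in> I" for i
      proof -
        have "(i, f i) \<in> (\<lambda>i. (i, g i)) ` I"
          using that by (simp flip: eq)
        then show ?thesis by auto
      qed
      with fg show "f = g"
        by (rule PiE_ext)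
    qed
  qed (auto simp: PiE_iff)
  ultimately show ?thesis
    using lesspoll_trans1 by blast
qed

section \<open>Submodules, quotients and products of left modules\<close>

lemma left_moduleI:
  fixes R (structure) and M (structure)
  assumes "ring R" "abelian_group M"
    and "\<And>a x. \<lbrakk>a \<in> carrier R; x \<in> carrier M\<rbrakk> \<Longrightarrow> a \<odot>\<^bsub>M\<^esub> x \<in> carrier M"
    and "\<And>a b x. \<lbrakk>a \<in> carrier R; b \<in> carrier R; x \<in> carrier M\<rbrakk> \<Longrightarrow>
           (a \<oplus>\<^bsub>R\<^esub> b) \<odot>\<^bsub>M\<^esub> x = a \<odot>\<^bsub>M\<^esub> x \<oplus>\<^bsub>M\<^esub> b \<odot>\<^bsub>M\<^esub> x"
    and "\<And>a x y. \<lbrakk>a \<in> carrier R; x \<in> carrier M; y \<in> carrier M\<rbrakk> \<Longrightarrow>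
           a \<odot>\<^bsub>M\<^esub> (x \<oplus>\<^bsub>M\<^esub> y) = a \<odot>\<^bsub>M\<^esub> x \<oplus>\<^bsub>M\<^esub> a \<odot>\<^bsub>M\<^esub> y"
    and "\<And>a b x. \<lbrakk>a \<in> carrier R; b \<in> carrier R; x \<in> carrier M\<rbrakk> \<Longrightarrow>
           (a \<otimes>\<^bsub>R\<^esub> b) \<odot>\<^bsub>M\<^esub> x = a \<odot>\<^bsub>M\<^esub> (b \<odot>\<^bsub>M\<^esub> x)"
    and "\<And>x. x \<in> carrier M \<Longrightarrow> \<one>\<^bsub>R\<^esub> \<odot>\<^bsub>M\<^esub> x = x"
  shows "left_module R M"
  using assms by (simp add: left_module_def left_module_axioms_def)

lemma (in left_module) smult_zero_right:
  assumes "a \<in> carrier R" shows "a \<odot>\<^bsub>M\<^esub> \<zero>\<^bsub>M\<^esub> = \<zero>\<^bsub>M\<^esub>"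
proof -
  have "a \<odot>\<^bsub>M\<^esub> \<zero>\<^bsub>M\<^esub> \<oplus>\<^bsub>M\<^esub> a \<odot>\<^bsub>M\<^esub> \<zero>\<^bsub>M\<^esub> = a \<odot>\<^bsub>M\<^esub> \<zero>\<^bsub>M\<^esub>"
    using smult_r_distr[OF assms, of "\<zero>\<^bsub>M\<^esub>" "\<zero>\<^bsub>M\<^esub>"] assms smult_closed by simp
  then show ?thesis
    using assms smult_closed by simp
qed

lemma (in left_module) smult_zero_left:
  assumes "x \<in> carrier M" shows "\<zero>\<^bsub>R\<^esub> \<odot>\<^bsub>M\<^esub> x = \<zero>\<^bsub>M\<^esub>"
proof -
  have "\<zero>\<^bsub>R\<^esub> \<odot>\<^bsub>M\<^esub> x \<oplus>\<^bsub>M\<^esub> \<zero>\<^bsub>R\<^esub> \<odot>\<^bsub>M\<^esub> x = \<zero>\<^bsub>R\<^esub> \<odot>\<^bsub>M\<^esub> x"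
    using smult_l_distr[of "\<zero>\<^bsub>R\<^esub>" "\<zero>\<^bsub>R\<^esub>" x] assms smult_closed by simp
  then show ?thesis
    using assms smult_closed by simp
qed

lemma (in left_module) smult_minus_one:
  assumes "x \<in> carrier M" shows "(\<ominus>\<^bsub>R\<^esub> \<one>\<^bsub>R\<^esub>) \<odot>\<^bsub>M\<^esub> x = \<ominus>\<^bsub>M\<^esub> x"
proof -
  have "(\<ominus>\<^bsub>R\<^esub> \<one>\<^bsub>R\<^esub>) \<odot>\<^bsub>M\<^esub> x \<oplus>\<^bsub>M\<^esub> x = (\<ominus>\<^bsub>R\<^esub> \<one>\<^bsub>R\<^esub> \<oplus>\<^bsub>R\<^esub> \<one>\<^bsub>R\<^esub>) \<odot>\<^bsub>M\<^esub> x"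
    using smult_l_distr[of "\<ominus>\<^bsub>R\<^esub> \<one>\<^bsub>R\<^esub>" "\<one>\<^bsub>R\<^esub>" x] assms smult_one by simp
  also have "\<dots> = \<zero>\<^bsub>M\<^esub>"
    using assms smult_zero_left by (simp add: R.l_neg)
  finally show ?thesis
    using assms smult_closed M.minus_equality by (metis R.a_inv_closed R.one_closed)
qed

lemma (in left_module) smult_minus:
  assumes "a \<in> carrier R" "x \<in> carrier M" shows "a \<odot>\<^bsub>M\<^esub> (\<ominus>\<^bsub>M\<^esub> x) = \<ominus>\<^bsub>M\<^esub> (a \<odot>\<^bsub>M\<^esub> x)"
proof (rule M.minus_equality[symmetric])
  show "a \<odot>\<^bsub>M\<^esub> (\<ominus>\<^bsub>M\<^esub> x) \<oplus>\<^bsub>M\<^esub> a \<odot>\<^bsub>M\<^esub> x = \<zero>\<^bsub>M\<^esub>"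
    using assms by (simp add: M.l_neg smult_zero_right flip: smult_r_distr)
qed (use assms smult_closed in auto)

text \<open>
  All module axioms are equations, hence can be tested after applying the maps \<open>p i\<close>; the negative of
  \<open>x\<close> is \<open>(-1) x\<close>. Submodules and products are modules for this reason.
\<close>

lemma left_module_separating_maps:
  fixes R :: "'a ring" and P :: "('a, 'b) module" and N :: "'i \<Rightarrow> ('a, 'c) module"
  assumes R: "ring R" and N: "\<And>i. i \<in> I \<Longrightarrow> left_module R (N i)"
    and add: "\<And>x y. \<lbrakk>x \<in> carrier P; y \<in> carrier P\<rbrakk> \<Longrightarrow> x \<oplus>\<^bsub>P\<^esub> y \<in> carrier P"
    and zero: "\<zero>\<^bsub>P\<^esub> \<in> carrier P"
    and smult: "\<And>a x. \<lbrakk>a \<in> carrier R; x \<in> carrier P\<rbrakk> \<Longrightarrow> a \<odot>\<^bsub>P\<^esub> x \<in> carrier P"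
    and p: "\<And>i x. \<lbrakk>i \<in> I; x \<in> carrier P\<rbrakk> \<Longrightarrow> p i x \<in> carrier (N i)"
    and p_add: "\<And>i x y. \<lbrakk>i \<in> I; x \<in> carrier P; y \<in> carrier P\<rbrakk> \<Longrightarrow> p i (x \<oplus>\<^bsub>P\<^esub> y) = p i x \<oplus>\<^bsub>N i\<^esub> p i y"
    and p_zero: "\<And>i. i \<in> I \<Longrightarrow> p i \<zero>\<^bsub>P\<^esub> = \<zero>\<^bsub>N i\<^esub>"
    and p_smult: "\<And>i a x. \<lbrakk>i \<in> I; a \<in> carrier R; x \<in> carrier P\<rbrakk> \<Longrightarrow> p i (a \<odot>\<^bsub>P\<^esub> x) = a \<odot>\<^bsub>N i\<^esub> p i x"
    and sep: "\<And>x y. \<lbrakk>x \<in> carrier P; y \<in> carrier P; \<And>i. i \<in> I \<Longrightarrow> p i x = p i y\<rbrakk> \<Longrightarrow> x = y"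
  shows "left_module R P"
proof (rule left_moduleI[OF R])
  interpret R: ring R by fact
  have grp: "abelian_group (N i)" if "i \<in> I" for i
    using N[OF that] by (simp add: left_module_def)
  note mon = abelian_group.axioms(1)[OF grp]
  show "abelian_group P"
  proof (rule abelian_groupI)
    fix x assume x: "x \<in> carrier P"
    have m1: "\<ominus>\<^bsub>R\<^esub> \<one>\<^bsub>R\<^esub> \<in> carrier R"
      by simp
    show "\<exists>y\<in>carrier P. y \<oplus>\<^bsub>P\<^esub> x = \<zero>\<^bsub>P\<^esub>"
    proof
      show "(\<ominus>\<^bsub>R\<^esub> \<one>\<^bsub>R\<^esub>) \<odot>\<^bsub>P\<^esub> x \<in> carrier P"
        using m1 x smult by blast
      then show "(\<ominus>\<^bsub>R\<^esub> \<one>\<^bsub>R\<^esub>) \<odot>\<^bsub>P\<^esub> x \<oplus>\<^bsub>P\<^esub> x = \<zero>\<^bsub>P\<^esub>"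
        using m1 x by (intro sep)
          (auto simp: add zero p_add p_zero p_smult p left_module.smult_minus_one[OF N] abelian_group.l_neg[OF grp])
    qed
  next
    fix x y assume "x \<in> carrier P" "y \<in> carrier P"
    then show "x \<oplus>\<^bsub>P\<^esub> y = y \<oplus>\<^bsub>P\<^esub> x"
      by (intro sep) (auto simp: add p_add p intro: abelian_monoid.a_comm[OF mon])
  next
    fix x y z assume "x \<in> carrier P" "y \<in> carrier P" "z \<in> carrier P"
    then show "x \<oplus>\<^bsub>P\<^esub> y \<oplus>\<^bsub>P\<^esub> z = x \<oplus>\<^bsub>P\<^esub> (y \<oplus>\<^bsub>P\<^esub> z)"
      by (intro sep) (auto simp: add p_add p intro: abelian_monoid.a_assoc[OF mon])
  next
    fix x assume "x \<in> carrier P"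
    then show "\<zero>\<^bsub>P\<^esub> \<oplus>\<^bsub>P\<^esub> x = x"
      by (intro sep) (auto simp: add zero p_add p_zero p intro: abelian_monoid.l_zero[OF mon])
  qed (use add zero in auto)
qed (auto intro!: sep simp: smult add p_smult p_add p left_module.smult_closed[OF N]
    left_module.smult_l_distr[OF N] left_module.smult_r_distr[OF N] left_module.smult_assoc[OF N]
    left_module.smult_one[OF N] ring.ring_simprules(1,5,6)[OF R])

lemma left_module_surjective_image:
  fixes R :: "'a ring" and X :: "('a, 'b) module" and C :: "('a, 'c) module"
  assumes X: "left_module R X" and surj: "carrier C = g ` carrier X"
    and g_add: "\<And>x y. \<lbrakk>x \<in> carrier X; y \<in> carrier X\<rbrakk> \<Longrightarrow> g x \<oplus>\<^bsub>C\<^esub> g y = g (x \<oplus>\<^bsub>X\<^esub> y)"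
    and g_zero: "\<zero>\<^bsub>C\<^esub> = g \<zero>\<^bsub>X\<^esub>"
    and g_smult: "\<And>a x. \<lbrakk>a \<in> carrier R; x \<in> carrier X\<rbrakk> \<Longrightarrow> a \<odot>\<^bsub>C\<^esub> g x = g (a \<odot>\<^bsub>X\<^esub> x)"
  shows "left_module R C"
proof -
  interpret X: left_module R X by fact
  show ?thesis
  proof (rule left_moduleI)
    show "abelian_group C"
    proof (rule abelian_groupI)
      fix x assume "x \<in> carrier C"
      then obtain y where y: "x = g y" "y \<in> carrier X"
        by (auto simp: surj)
      then show "\<exists>y\<in>carrier C. y \<oplus>\<^bsub>C\<^esub> x = \<zero>\<^bsub>C\<^esub>"
        by (intro bexI[of _ "g (\<ominus>\<^bsub>X\<^esub> y)"]) (auto simp: surj g_add g_zero X.M.l_neg)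
    next
      fix x y assume "x \<in> carrier C" "y \<in> carrier C"
      then obtain x' y' where "x = g x'" "y = g y'" "x' \<in> carrier X" "y' \<in> carrier X"
        by (auto simp: surj)
      then show "x \<oplus>\<^bsub>C\<^esub> y = y \<oplus>\<^bsub>C\<^esub> x"
        by (simp add: g_add X.M.a_comm)
    qed (auto simp: surj g_add g_zero X.M.a_assoc)
  qed (auto simp: surj g_add g_smult X.R.ring_axioms X.smult_closed X.smult_l_distr X.smult_r_distr
        X.smult_assoc X.smult_one)
qed

lemma left_module_LMod: "X \<in> LMod R \<Longrightarrow> left_module R X"
  by (simp add: LMod_def)

lemma mod_homI:
  assumes "\<And>x. x \<in> carrier X \<Longrightarrow> f x \<in> carrier Y"
    and "\<And>x y. \<lbrakk>x \<in> carrier X; y \<in> carrier X\<rbrakk> \<Longrightarrow> f (x \<oplus>\<^bsub>X\<^esub> y) = f x \<oplus>\<^bsub>Y\<^esub> f y"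
    and "\<And>a x. \<lbrakk>a \<in> carrier R; x \<in> carrier X\<rbrakk> \<Longrightarrow> f (a \<odot>\<^bsub>X\<^esub> x) = a \<odot>\<^bsub>Y\<^esub> f x"
    and "left_module R X"
  shows "(\<lambda>x\<in>carrier X. f x) \<in> mod_hom R X Y"
proof -
  interpret X: left_module R X by fact
  show ?thesis
    using assms(1-3) by (auto simp: mod_hom_def X.smult_closed)
qed

lemma mod_homD:
  assumes "f \<in> mod_hom R X Y"
  shows "x \<in> carrier X \<Longrightarrow> f x \<in> carrier Y"
    and "\<lbrakk>x \<in> carrier X; y \<in> carrier X\<rbrakk> \<Longrightarrow> f (x \<oplus>\<^bsub>X\<^esub> y) = f x \<oplus>\<^bsub>Y\<^esub> f y"
    and "\<lbrakk>a \<in> carrier R; x \<in> carrier X\<rbrakk> \<Longrightarrow> f (a \<odot>\<^bsub>X\<^esub> x) = a \<odot>\<^bsub>Y\<^esub> f x"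
    and "f \<in> extensional (carrier X)"
  using assms by (auto simp: mod_hom_def PiE_def)

lemma mod_hom_eqI:
  assumes "f \<in> mod_hom R X Y" "g \<in> mod_hom R X Y'" "\<And>x. x \<in> carrier X \<Longrightarrow> f x = g x"
  shows "f = g"
  using assms by (meson mod_homD(4) extensionalityI)

lemma mod_hom_zero:
  assumes f: "f \<in> mod_hom R X Y" and X: "left_module R X" and Y: "left_module R Y"
  shows "f \<zero>\<^bsub>X\<^esub> = \<zero>\<^bsub>Y\<^esub>"
proof -
  interpret X: left_module R X by fact
  interpret Y: left_module R Y by fact
  have "f (\<zero>\<^bsub>R\<^esub> \<odot>\<^bsub>X\<^esub> \<zero>\<^bsub>X\<^esub>) = \<zero>\<^bsub>R\<^esub> \<odot>\<^bsub>Y\<^esub> f \<zero>\<^bsub>X\<^esub>"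
    using f by (intro mod_homD(3)[OF f]) auto
  then show ?thesis
    using mod_homD(1)[OF f] by (simp add: X.smult_zero_left Y.smult_zero_left)
qed

lemma mod_hom_compose:
  assumes "f \<in> mod_hom R X Y" "g \<in> mod_hom R Y Z" "left_module R X"
  shows "compose (carrier X) g f \<in> mod_hom R X Z"
  unfolding compose_def
  by (rule mod_homI) (use assms in \<open>auto simp: mod_homD\<close>)

lemma mod_hom_id: "left_module R X \<Longrightarrow> (\<lambda>x\<in>carrier X. x) \<in> mod_hom R X X"
  by (rule mod_homI) auto

lemma mod_hom_const_zero:
  assumes X: "left_module R X" and Y: "left_module R Y"
  shows "(\<lambda>x\<in>carrier X. \<zero>\<^bsub>Y\<^esub>) \<in> mod_hom R X Y"
proof -
  interpret Y: left_module R Y by fact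
  show ?thesis
    by (rule mod_homI) (auto simp: Y.smult_zero_right X)
qed

lemma mod_hom_add:
  assumes f: "f \<in> mod_hom R X Y" and g: "g \<in> mod_hom R X Y"
    and X: "left_module R X" and Y: "left_module R Y"
  shows "(\<lambda>x\<in>carrier X. f x \<oplus>\<^bsub>Y\<^esub> g x) \<in> mod_hom R X Y"
proof -
  interpret Y: left_module R Y by fact
  show ?thesis
    by (rule mod_homI) (use mod_homD[OF f] mod_homD[OF g] in \<open>auto simp: Y.smult_r_distr X Y.M.a_ac\<close>)
qed

lemma mod_hom_minus:
  assumes f: "f \<in> mod_hom R X Y" and X: "left_module R X" and Y: "left_module R Y"
  shows "(\<lambda>x\<in>carrier X. \<ominus>\<^bsub>Y\<^esub> f x) \<in> mod_hom R X Y"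
proof -
  interpret X: left_module R X by fact
  interpret Y: left_module R Y by fact
  show ?thesis
    by (intro mod_homI) (use mod_homD[OF f] X in \<open>auto simp: Y.M.minus_add Y.smult_minus\<close>)
qed

definition left_submodule :: "'u ring \<Rightarrow> 'u mdl \<Rightarrow> 'u set \<Rightarrow> bool" where
  "left_submodule R X N \<longleftrightarrow> N \<subseteq> carrier X \<and> \<zero>\<^bsub>X\<^esub> \<in> N \<and>
     (\<forall>x\<in>N. \<forall>y\<in>N. x \<oplus>\<^bsub>X\<^esub> y \<in> N) \<and> (\<forall>a\<in>carrier R. \<forall>x\<in>N. a \<odot>\<^bsub>X\<^esub> x \<in> N)"

lemma left_submodule_LMod:
  assumes X: "X \<in> LMod R" and N: "left_submodule R X N"
  shows "X\<lparr>carrier := N\<rparr> \<in> LMod R"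
proof -
  have "left_module R (X\<lparr>carrier := N\<rparr>)"
    by (rule left_module_separating_maps[where I = "{()}" and N = "\<lambda>_. X" and p = "\<lambda>_ x. x"])
      (use assms in \<open>auto simp: LMod_def left_submodule_def left_module_def\<close>)
  moreover have "N \<prec> (UNIV :: 'a set)"
    using assms lesspoll_trans1[OF subset_imp_lepoll] by (auto simp: LMod_def left_submodule_def)
  ultimately show ?thesis
    by (simp add: LMod_def)
qed

lemma left_submodule_inclusion:
  assumes X: "X \<in> LMod R" and N: "left_submodule R X N"
  shows "(\<lambda>x\<in>N. x) \<in> mod_hom R (X\<lparr>carrier := N\<rparr>) X"
  using N by (auto simp: mod_hom_def left_submodule_def)

lemma a_kernel_iff: "x \<in> a_kernel X Y f \<longleftrightarrow> x \<in> carrier X \<and> f x = \<zero>\<^bsub>Y\<^esub>"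
  by (simp add: a_kernel_def')

lemma left_submodule_kernel:
  assumes f: "f \<in> mod_hom R X Y" and X: "left_module R X" and Y: "left_module R Y"
  shows "left_submodule R X (a_kernel X Y f)"
proof -
  interpret X: left_module R X by fact
  interpret Y: left_module R Y by fact
  show ?thesis
    using mod_homD[OF f] mod_hom_zero[OF f X Y]
    by (auto simp: left_submodule_def a_kernel_iff X.smult_closed Y.smult_zero_right)
qed

lemma left_submodule_minus:
  assumes X: "left_module R X" and N: "left_submodule R X N" and x: "x \<in> N"
  shows "\<ominus>\<^bsub>X\<^esub> x \<in> N"
proof -
  interpret X: left_module R X by fact
  have "(\<ominus>\<^bsub>R\<^esub> \<one>\<^bsub>R\<^esub>) \<odot>\<^bsub>X\<^esub> x \<in> N"
    using N x by (auto simp: left_submodule_def)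
  then show ?thesis
    using N x by (simp add: left_submodule_def subset_iff X.smult_minus_one)
qed

text \<open>
  Cosets are not elements of \<open>'u\<close>, so the elements of the quotient are representatives: \<open>g\<close> selects one in
  each coset, and the operations of \<open>X\<close> are followed by \<open>g\<close>.
\<close>

lemma quotient_exists:
  assumes X: "X \<in> LMod R" and N: "left_submodule R X N"
  shows "\<exists>C\<in>LMod R. \<exists>g\<in>mod_hom R X C. a_kernel X C g = N"
proof -
  interpret X: left_module R X using left_module_LMod[OF X] .
  note closed = N[unfolded left_submodule_def]
  define E where "E x = {y \<in> carrier X. x \<ominus>\<^bsub>X\<^esub> y \<in> N}" for x
  define g where "g x = (SOME y. y \<in> E x)" for x
  have E_self: "x \<in> E x" if "x \<in> carrier X" for x
    using that closed by (simp add: E_def a_minus_def X.M.r_neg)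
  have g_E: "g x \<in> E x" if "x \<in> carrier X" for x
    unfolding g_def using E_self[OF that] by (rule someI)
  then have gX: "g x \<in> carrier X" and gN: "x \<ominus>\<^bsub>X\<^esub> g x \<in> N" if "x \<in> carrier X" for x
    using that by (auto simp: E_def)
  have trans: "x \<ominus>\<^bsub>X\<^esub> z \<in> N" if "x \<ominus>\<^bsub>X\<^esub> y \<in> N" "y \<ominus>\<^bsub>X\<^esub> z \<in> N" "x \<in> carrier X" "y \<in> carrier X" "z \<in> carrier X" for x y z
  proof -
    have "(x \<ominus>\<^bsub>X\<^esub> y) \<oplus>\<^bsub>X\<^esub> (y \<ominus>\<^bsub>X\<^esub> z) = x \<ominus>\<^bsub>X\<^esub> z"
      using that by (simp add: a_minus_def X.M.a_assoc X.M.r_neg1)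
    then show ?thesis
      using that closed by metis
  qed
  have sym: "y \<ominus>\<^bsub>X\<^esub> x \<in> N" if "x \<ominus>\<^bsub>X\<^esub> y \<in> N" "x \<in> carrier X" "y \<in> carrier X" for x y
  proof -
    have "y \<ominus>\<^bsub>X\<^esub> x = \<ominus>\<^bsub>X\<^esub> (x \<ominus>\<^bsub>X\<^esub> y)"
      using that by (simp add: a_minus_def X.M.minus_add X.M.a_comm)
    then show ?thesis
      using left_submodule_minus[OF X.left_module_axioms N] that by simp
  qed
  have g_eq: "g x = g y \<longleftrightarrow> x \<ominus>\<^bsub>X\<^esub> y \<in> N" if "x \<in> carrier X" "y \<in> carrier X" for x y
  proof
    assume "g x = g y"
    then show "x \<ominus>\<^bsub>X\<^esub> y \<in> N"
      using that gX gN sym trans by metis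
  next
    assume "x \<ominus>\<^bsub>X\<^esub> y \<in> N"
    then have "E x = E y"
      unfolding E_def using that sym trans by blast
    then show "g x = g y"
      by (simp add: g_def)
  qed
  have cong_add: "g (g x \<oplus>\<^bsub>X\<^esub> g y) = g (x \<oplus>\<^bsub>X\<^esub> y)" if "x \<in> carrier X" "y \<in> carrier X" for x y
  proof -
    have "(x \<oplus>\<^bsub>X\<^esub> y) \<ominus>\<^bsub>X\<^esub> (g x \<oplus>\<^bsub>X\<^esub> g y) = (x \<ominus>\<^bsub>X\<^esub> g x) \<oplus>\<^bsub>X\<^esub> (y \<ominus>\<^bsub>X\<^esub> g y)"
      using that gX by (simp add: a_minus_def X.M.minus_add X.M.a_ac)
    then have "(x \<oplus>\<^bsub>X\<^esub> y) \<ominus>\<^bsub>X\<^esub> (g x \<oplus>\<^bsub>X\<^esub> g y) \<in> N"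
      using closed gN that by metis
    then show ?thesis
      using that gX g_eq[of "x \<oplus>\<^bsub>X\<^esub> y" "g x \<oplus>\<^bsub>X\<^esub> g y"] by simp
  qed
  have cong_smult: "g (a \<odot>\<^bsub>X\<^esub> g x) = g (a \<odot>\<^bsub>X\<^esub> x)" if "a \<in> carrier R" "x \<in> carrier X" for a x
  proof -
    have "a \<odot>\<^bsub>X\<^esub> (x \<ominus>\<^bsub>X\<^esub> g x) = a \<odot>\<^bsub>X\<^esub> x \<oplus>\<^bsub>X\<^esub> a \<odot>\<^bsub>X\<^esub> (\<ominus>\<^bsub>X\<^esub> g x)"
      using that gX by (simp add: a_minus_def X.smult_r_distr)
    also have "a \<odot>\<^bsub>X\<^esub> (\<ominus>\<^bsub>X\<^esub> g x) = \<ominus>\<^bsub>X\<^esub> (a \<odot>\<^bsub>X\<^esub> g x)"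
      using that gX by (simp add: X.smult_minus)
    finally have "a \<odot>\<^bsub>X\<^esub> x \<ominus>\<^bsub>X\<^esub> a \<odot>\<^bsub>X\<^esub> g x = a \<odot>\<^bsub>X\<^esub> (x \<ominus>\<^bsub>X\<^esub> g x)"
      by (simp add: a_minus_def)
    then have "a \<odot>\<^bsub>X\<^esub> x \<ominus>\<^bsub>X\<^esub> a \<odot>\<^bsub>X\<^esub> g x \<in> N"
      using closed gN that by simp
    then show ?thesis
      using that gX X.smult_closed g_eq[of "a \<odot>\<^bsub>X\<^esub> x" "a \<odot>\<^bsub>X\<^esub> g x"] by simp
  qed
  define C where "C = X\<lparr>carrier := g ` carrier X, zero := g \<zero>\<^bsub>X\<^esub>,
    add := \<lambda>x y. g (x \<oplus>\<^bsub>X\<^esub> y), smult := \<lambda>a x. g (a \<odot>\<^bsub>X\<^esub> x)\<rparr>"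
  have C: "left_module R C"
    by (rule left_module_surjective_image[OF X.left_module_axioms, of _ g])
      (auto simp: C_def cong_add cong_smult)
  moreover have "carrier C \<prec> (UNIV :: 'a set)"
    using X lesspoll_trans1[OF image_lepoll[of g "carrier X"]] by (auto simp: C_def LMod_def)
  ultimately have "C \<in> LMod R"
    by (simp add: LMod_def)
  moreover have "(\<lambda>x\<in>carrier X. g x) \<in> mod_hom R X C"
    by (rule mod_homI) (auto simp: C_def cong_add cong_smult X.left_module_axioms)
  moreover have "a_kernel X C (\<lambda>x\<in>carrier X. g x) = N"
  proof -
    have "x \<ominus>\<^bsub>X\<^esub> \<zero>\<^bsub>X\<^esub> = x" if "x \<in> carrier X" for x
      using that by (simp add: a_minus_def X.M.add.inv_one)
    then show ?thesis
      using closed by (auto simp: a_kernel_iff C_def g_eq)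
  qed
  ultimately show ?thesis
    by blast
qed

text \<open>
  The set of families is small, so it can be encoded by elements of \<open>'u\<close>; \<open>d\<close> decodes.
\<close>

lemma product_exists:
  fixes R :: "('u::set_universe) ring"
  assumes R: "ring R" and I: "I \<prec> (UNIV :: 'u set)" and N: "\<And>i. i \<in> I \<Longrightarrow> N i \<in> LMod R"
  shows "\<exists>P \<pi>. is_product R I N P \<pi>"
proof -
  let ?F = "\<Pi>\<^sub>E i\<in>I. carrier (N i)"
  note Nmod = left_module_LMod[OF N]
  have grp: "abelian_group (N i)" if "i \<in> I" for i
    using Nmod[OF that] by (simp add: left_module_def)
  note mon = abelian_group.axioms(1)[OF grp]
  have "?F \<prec> (UNIV :: 'u set)"
    using I N by (intro small_PiE) (auto simp: LMod_def)
  then obtain e :: "('u \<Rightarrow> 'u) \<Rightarrow> 'u" where e: "inj_on e ?F" and eF: "e ` ?F \<prec> (UNIV :: 'u set)"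
    by (metis inj_on_image_lesspoll_1 lepoll_def lesspoll_imp_lepoll)
  define d where "d = the_inv_into ?F e"
  have de [simp]: "d (e f) = f" if "f \<in> ?F" for f
    using that e by (simp add: d_def the_inv_into_f_f)
  have add_F: "(\<lambda>i\<in>I. f i \<oplus>\<^bsub>N i\<^esub> f' i) \<in> ?F" if "f \<in> ?F" "f' \<in> ?F" for f f'
    using that by (auto simp: PiE_iff intro: abelian_monoid.a_closed[OF mon])
  have smult_F: "(\<lambda>i\<in>I. a \<odot>\<^bsub>N i\<^esub> f i) \<in> ?F" if "a \<in> carrier R" "f \<in> ?F" for f a
    using that by (auto simp: PiE_iff intro: left_module.smult_closed[OF Nmod])
  have zero_F: "(\<lambda>i\<in>I. \<zero>\<^bsub>N i\<^esub>) \<in> ?F"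
    by (auto intro: abelian_monoid.zero_closed[OF mon])
  define P :: "'u mdl" where "P = \<lparr>carrier = e ` ?F, monoid.mult = undefined, one = undefined,
     ring.zero = e (\<lambda>i\<in>I. \<zero>\<^bsub>N i\<^esub>), add = (\<lambda>x y. e (\<lambda>i\<in>I. d x i \<oplus>\<^bsub>N i\<^esub> d y i)),
     smult = (\<lambda>a x. e (\<lambda>i\<in>I. a \<odot>\<^bsub>N i\<^esub> d x i))\<rparr>"
  have dP: "d x \<in> ?F" and ed: "e (d x) = x" if "x \<in> carrier P" for x
    using that by (auto simp: P_def simp del: PiE_iff)
  have P_add: "x \<oplus>\<^bsub>P\<^esub> y \<in> carrier P" "d (x \<oplus>\<^bsub>P\<^esub> y) = (\<lambda>i\<in>I. d x i \<oplus>\<^bsub>N i\<^esub> d y i)"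
    if "x \<in> carrier P" "y \<in> carrier P" for x y
    using de[OF add_F[OF dP[OF that(1)] dP[OF that(2)]]] imageI[OF add_F[OF dP[OF that(1)] dP[OF that(2)]], of e]
    by (simp_all add: P_def)
  have P_smult: "a \<odot>\<^bsub>P\<^esub> x \<in> carrier P" "d (a \<odot>\<^bsub>P\<^esub> x) = (\<lambda>i\<in>I. a \<odot>\<^bsub>N i\<^esub> d x i)"
    if "a \<in> carrier R" "x \<in> carrier P" for a x
    using de[OF smult_F[OF that(1) dP[OF that(2)]]] imageI[OF smult_F[OF that(1) dP[OF that(2)]], of e]
    by (simp_all add: P_def)
  have P_zero: "\<zero>\<^bsub>P\<^esub> \<in> carrier P" "d \<zero>\<^bsub>P\<^esub> = (\<lambda>i\<in>I. \<zero>\<^bsub>N i\<^esub>)"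
    using de[OF zero_F] imageI[OF zero_F, of e] by (simp_all add: P_def)
  have P: "left_module R P"
  proof (rule left_module_separating_maps[where I = I and N = N and p = "\<lambda>i x. d x i"])
    show "x = y" if "x \<in> carrier P" "y \<in> carrier P" "\<And>i. i \<in> I \<Longrightarrow> d x i = d y i" for x y
      using PiE_ext[OF dP dP] ed that by metis
    show "d x i \<in> carrier (N i)" if "i \<in> I" "x \<in> carrier P" for i x
      using dP[OF that(2)] that(1) by auto
  qed (simp_all add: R Nmod P_add P_smult P_zero)
  moreover have "carrier P \<prec> (UNIV :: 'u set)"
    using eF by (simp add: P_def)
  moreover have "(\<lambda>x\<in>carrier P. d x i) \<in> mod_hom R P (N i)" if "i \<in> I" for i
    by (rule mod_homI) (use P dP P_add P_smult that in auto)
  moreover have "bij_betw (\<lambda>x. \<lambda>i\<in>I. (\<lambda>x\<in>carrier P. d x i) x) (carrier P) ?F"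
  proof (rule bij_betwI[where g = e])
    show coords: "(\<lambda>x. \<lambda>i\<in>I. (\<lambda>x\<in>carrier P. d x i) x) \<in> carrier P \<rightarrow> ?F"
      using PiE_mem[OF dP] by auto
    show "e \<in> ?F \<rightarrow> carrier P"
      by (auto simp: P_def)
    show "e (\<lambda>i\<in>I. (\<lambda>x\<in>carrier P. d x i) x) = x" if "x \<in> carrier P" for x
    proof -
      have "(\<lambda>i\<in>I. d x i) = d x"
        using dP[OF that] by (auto simp: PiE_iff extensional_restrict)
      then show ?thesis
        using ed that by simp
    qed
    show "(\<lambda>i\<in>I. (\<lambda>x\<in>carrier P. d x i) (e f)) = f" if "f \<in> ?F" for f
    proof -
      have "e f \<in> carrier P"
        using that by (auto simp: P_def)
      then show ?thesis
        using that de[OF that] by (auto simp: PiE_iff extensional_restrict)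
    qed
  qed
  ultimately have "is_product R I N P (\<lambda>i. \<lambda>x\<in>carrier P. d x i)"
    by (simp add: is_product_def LMod_def)
  then show ?thesis
    by blast
qed

lemma product_ext:
  assumes P: "is_product R I N P \<pi>" and "x \<in> carrier P" "y \<in> carrier P" "\<And>i. i \<in> I \<Longrightarrow> \<pi> i x = \<pi> i y"
  shows "x = y"
proof -
  have "inj_on (\<lambda>x. \<lambda>i\<in>I. \<pi> i x) (carrier P)"
    using P by (simp add: is_product_def bij_betw_def)
  then show ?thesis
    by (rule inj_onD) (use assms in auto)
qed

lemma product_lift:
  assumes P: "is_product R I N P \<pi>" and X: "left_module R X"
    and f: "\<And>i. i \<in> I \<Longrightarrow> f i \<in> mod_hom R X (N i)"
  obtains h where "h \<in> mod_hom R X P" "\<And>i x. \<lbrakk>i \<in> I; x \<in> carrier X\<rbrakk> \<Longrightarrow> \<pi> i (h x) = f i x"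
proof -
  interpret X: left_module R X by fact
  have Pmod: "left_module R P"
    using P by (simp add: is_product_def LMod_def)
  interpret P: left_module R P by fact
  have \<pi>: "\<pi> i \<in> mod_hom R P (N i)" if "i \<in> I" for i
    using P that by (simp add: is_product_def)
  have "\<exists>y\<in>carrier P. \<forall>i\<in>I. \<pi> i y = f i x" if "x \<in> carrier X" for x
  proof -
    have "(\<lambda>i\<in>I. f i x) \<in> (\<lambda>x. \<lambda>i\<in>I. \<pi> i x) ` carrier P"
      using P that mod_homD(1)[OF f] by (auto simp: is_product_def bij_betw_def)
    then obtain y where y: "y \<in> carrier P" "(\<lambda>i\<in>I. f i x) = (\<lambda>i\<in>I. \<pi> i y)"
      by blast
    moreover have "\<pi> i y = f i x" if "i \<in> I" for i
      using fun_cong[OF y(2), of i] that by simp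
    ultimately show ?thesis by blast
  qed
  then obtain h where h: "\<And>x. x \<in> carrier X \<Longrightarrow> h x \<in> carrier P"
      "\<And>i x. \<lbrakk>i \<in> I; x \<in> carrier X\<rbrakk> \<Longrightarrow> \<pi> i (h x) = f i x"
    by metis
  have "(\<lambda>x\<in>carrier X. h x) \<in> mod_hom R X P"
  proof (rule mod_homI)
    fix x y assume "x \<in> carrier X" "y \<in> carrier X"
    then show "h (x \<oplus>\<^bsub>X\<^esub> y) = h x \<oplus>\<^bsub>P\<^esub> h y"
      by - (rule product_ext[OF P], auto simp: h mod_homD[OF \<pi>] mod_homD[OF f])
  next
    fix a x assume "a \<in> carrier R" "x \<in> carrier X"
    then show "h (a \<odot>\<^bsub>X\<^esub> x) = a \<odot>\<^bsub>P\<^esub> h x"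
      by - (rule product_ext[OF P],
        auto simp: h mod_homD[OF \<pi>] mod_homD[OF f] X.smult_closed P.smult_closed)
  qed (use h X in auto)
  then show ?thesis
    by (rule that) (simp add: h)
qed

section \<open>Tensor products\<close>

lemma keys_diff_subset:
  "\<lbrakk>Poly_Mapping.keys a \<subseteq> S; Poly_Mapping.keys b \<subseteq> S\<rbrakk> \<Longrightarrow> Poly_Mapping.keys (a - b) \<subseteq> S"
  using keys_diff[of a b] by blast

definition tensor_class :: "'u ring \<Rightarrow> 'u mdl \<Rightarrow> 'u mdl \<Rightarrow> ('u \<times> 'u \<Rightarrow>\<^sub>0 int) \<Rightarrow> 'u tensor_elt" where
  "tensor_class R Y X c = tensor_null R Y X #>\<^bsub>free_Abelian_group (carrier Y \<times> carrier X)\<^esub> c"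

lemma tensor_class_altdef: "tensor_class R Y X c = (\<lambda>h. h + c) ` tensor_null R Y X"
  by (auto simp: tensor_class_def r_coset_def)

lemma pure_tensor_class: "pure_tensor R Y X y x = tensor_class R Y X (frag_of (y, x))"
  by (simp add: tensor_class_def pure_tensor_def)

lemma tensor_relatorsE:
  assumes "c \<in> tensor_relators R Y X"
  obtains (add_left) y y' x where "y \<in> carrier Y" "y' \<in> carrier Y" "x \<in> carrier X"
      "c = frag_of (y \<oplus>\<^bsub>Y\<^esub> y', x) - frag_of (y, x) - frag_of (y', x)"
    | (add_right) y x x' where "y \<in> carrier Y" "x \<in> carrier X" "x' \<in> carrier X"
      "c = frag_of (y, x \<oplus>\<^bsub>X\<^esub> x') - frag_of (y, x) - frag_of (y, x')"
    | (smult) a y x where "a \<in> carrier R" "y \<in> carrier Y" "x \<in> carrier X"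
      "c = frag_of (a \<odot>\<^bsub>Y\<^esub> y, x) - frag_of (y, a \<odot>\<^bsub>X\<^esub> x)"
  using assms unfolding tensor_relators_def by blast

lemma tensor_relatorsI:
  shows "\<lbrakk>y \<in> carrier Y; y' \<in> carrier Y; x \<in> carrier X\<rbrakk> \<Longrightarrow>
      frag_of (y \<oplus>\<^bsub>Y\<^esub> y', x) - frag_of (y, x) - frag_of (y', x) \<in> tensor_relators R Y X"
    and "\<lbrakk>y \<in> carrier Y; x \<in> carrier X; x' \<in> carrier X\<rbrakk> \<Longrightarrow>
      frag_of (y, x \<oplus>\<^bsub>X\<^esub> x') - frag_of (y, x) - frag_of (y, x') \<in> tensor_relators R Y X"
    and "\<lbrakk>a \<in> carrier R; y \<in> carrier Y; x \<in> carrier X\<rbrakk> \<Longrightarrow>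
      frag_of (a \<odot>\<^bsub>Y\<^esub> y, x) - frag_of (y, a \<odot>\<^bsub>X\<^esub> x) \<in> tensor_relators R Y X"
  unfolding tensor_relators_def by blast+

lemma keys_frag_extend_map:
  assumes "\<And>x. x \<in> A \<Longrightarrow> f x \<in> B" "Poly_Mapping.keys c \<subseteq> carrier Y \<times> A"
  shows "Poly_Mapping.keys (frag_extend (\<lambda>(y, x). frag_of (y, f x)) c) \<subseteq> carrier Y \<times> B"
proof (rule order_trans[OF keys_frag_extend], rule UN_least)
  fix p assume "p \<in> Poly_Mapping.keys c"
  then have "snd p \<in> A" "fst p \<in> carrier Y"
    using subsetD[OF assms(2), of p] by (auto simp: mem_Times_iff)
  then show "Poly_Mapping.keys (case p of (y, x) \<Rightarrow> frag_of (y, f x)) \<subseteq> carrier Y \<times> B"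
    using assms(1) by (simp add: split_beta keys_frag_of)
qed

locale tensor_pair = Y?: right_module R Y + X?: left_module R X
  for R :: "'u ring" and Y X :: "'u mdl"
begin

abbreviation "S \<equiv> carrier Y \<times> carrier X"
abbreviation "G \<equiv> free_Abelian_group S"
abbreviation "T \<equiv> tensor R Y X"

lemma relators_subset: "tensor_relators R Y X \<subseteq> carrier G"
proof
  fix c assume "c \<in> tensor_relators R Y X"
  then show "c \<in> carrier G"
    by (cases rule: tensor_relatorsE)
      (simp_all add: keys_frag_of keys_diff_subset Y.smult_closed X.smult_closed)
qed

lemma null_subgroup: "subgroup (tensor_null R Y X) G"
  unfolding tensor_null_def by (rule group.generate_is_subgroup) (simp_all only: relators_subset group_free_Abelian_group)

lemma null_normal: "tensor_null R Y X \<lhd> G"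
  by (rule comm_group.subgroup_imp_normal[OF abelian_free_Abelian_group null_subgroup])

lemma null_keys: "c \<in> tensor_null R Y X \<Longrightarrow> Poly_Mapping.keys c \<subseteq> S"
  using subsetD[OF subgroup.subset[OF null_subgroup], of c] by simp

lemma relator_in_null: "c \<in> tensor_relators R Y X \<Longrightarrow> c \<in> tensor_null R Y X"
  unfolding tensor_null_def by (rule generate.incl)

lemma null_zero: "0 \<in> tensor_null R Y X"
  using subgroup.one_closed[OF null_subgroup] by simp

lemma null_add: "\<lbrakk>c \<in> tensor_null R Y X; d \<in> tensor_null R Y X\<rbrakk> \<Longrightarrow> c + d \<in> tensor_null R Y X"
  using subgroup.m_closed[OF null_subgroup] by simp

lemma null_minus: "c \<in> tensor_null R Y X \<Longrightarrow> - c \<in> tensor_null R Y X"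
  using subgroup.m_inv_closed[OF null_subgroup] null_keys by simp

lemma comm_group_tensor: "comm_group T"
  unfolding tensor_def
  by (rule comm_group.abelian_FactGroup[OF abelian_free_Abelian_group null_subgroup])

lemma carrier_tensor: "carrier T = tensor_class R Y X ` {c. Poly_Mapping.keys c \<subseteq> S}"
  by (auto simp: tensor_def carrier_FactGroup tensor_class_def free_Abelian_group_def)

lemma tensor_class_closed: "Poly_Mapping.keys c \<subseteq> S \<Longrightarrow> tensor_class R Y X c \<in> carrier T"
  by (simp add: carrier_tensor)

lemma tensor_class_add:
  assumes "Poly_Mapping.keys c \<subseteq> S" "Poly_Mapping.keys d \<subseteq> S"
  shows "tensor_class R Y X c \<otimes>\<^bsub>T\<^esub> tensor_class R Y X d = tensor_class R Y X (c + d)"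
  using normal.rcos_sum[OF null_normal, of c d] assms by (simp add: tensor_def tensor_class_def)

lemma tensor_class_eq_iff:
  "tensor_class R Y X c = tensor_class R Y X d \<longleftrightarrow> c - d \<in> tensor_null R Y X"
proof
  assume "tensor_class R Y X c = tensor_class R Y X d"
  then have "c \<in> tensor_class R Y X d"
    using null_zero by (force simp: tensor_class_altdef)
  then show "c - d \<in> tensor_null R Y X"
    by (auto simp: tensor_class_altdef)
next
  assume cd: "c - d \<in> tensor_null R Y X"
  have "h + c \<in> tensor_class R Y X d" if "h \<in> tensor_null R Y X" for h
    unfolding tensor_class_altdef
    by (rule image_eqI[where x = "h + (c - d)"]) (auto intro: null_add that cd)
  moreover have "h + d \<in> tensor_class R Y X c" if "h \<in> tensor_null R Y X" for h
    unfolding tensor_class_altdef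
    by (rule image_eqI[where x = "h + - (c - d)"], simp) (rule null_add[OF that null_minus[OF cd]])
  ultimately show "tensor_class R Y X c = tensor_class R Y X d"
    by (auto simp: tensor_class_altdef)
qed

lemma tensor_class_zero: "tensor_class R Y X 0 = \<one>\<^bsub>T\<^esub>"
  by (simp add: tensor_def tensor_class_altdef)

lemma tensor_class_diff:
  assumes "Poly_Mapping.keys c \<subseteq> S" "Poly_Mapping.keys d \<subseteq> S"
  shows "tensor_class R Y X (c - d) = tensor_class R Y X c \<otimes>\<^bsub>T\<^esub> inv\<^bsub>T\<^esub> tensor_class R Y X d"
proof -
  interpret T: comm_group T by (rule comm_group_tensor)
  have "tensor_class R Y X (c - d) \<otimes>\<^bsub>T\<^esub> tensor_class R Y X d = tensor_class R Y X c"
    using assms by (simp add: tensor_class_add keys_diff_subset)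
  then show ?thesis
    using assms by (metis T.inv_solve_right' T.m_comm keys_diff_subset tensor_class_closed T.inv_solve_right)
qed

lemma pure_tensor_closed [simp]:
  "\<lbrakk>y \<in> carrier Y; x \<in> carrier X\<rbrakk> \<Longrightarrow> pure_tensor R Y X y x \<in> carrier T"
  by (simp add: pure_tensor_class tensor_class_closed keys_frag_of)

text \<open>
  The free abelian group is generated by its basis under subtraction; the neutral element is the
  difference of a pure tensor with itself.
\<close>

lemma tensor_induct [consumes 1, case_names pure_tensor diff]:
  assumes t: "t \<in> carrier T"
    and pure: "\<And>y x. \<lbrakk>y \<in> carrier Y; x \<in> carrier X\<rbrakk> \<Longrightarrow> P (pure_tensor R Y X y x)"
    and diff: "\<And>s t. \<lbrakk>s \<in> carrier T; t \<in> carrier T; P s; P t\<rbrakk> \<Longrightarrow> P (s \<otimes>\<^bsub>T\<^esub> inv\<^bsub>T\<^esub> t)"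
  shows "P t"
proof -
  interpret T: comm_group T by (rule comm_group_tensor)
  obtain c where c: "Poly_Mapping.keys c \<subseteq> S" "t = tensor_class R Y X c"
    using t by (auto simp: carrier_tensor)
  have "P (tensor_class R Y X c)"
  proof (rule free_Abelian_group_induct[OF c(1)])
    let ?p = "pure_tensor R Y X \<zero>\<^bsub>Y\<^esub> \<zero>\<^bsub>X\<^esub>"
    have "P (?p \<otimes>\<^bsub>T\<^esub> inv\<^bsub>T\<^esub> ?p)"
      by (intro diff pure) auto
    then show "P (tensor_class R Y X 0)"
      by (simp add: tensor_class_zero)
  next
    fix c d
    assume "Poly_Mapping.keys c \<subseteq> S" "Poly_Mapping.keys d \<subseteq> S"
      "P (tensor_class R Y X c)" "P (tensor_class R Y X d)"
    then show "P (tensor_class R Y X (c - d))"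
      by (simp add: tensor_class_diff diff tensor_class_closed)
  next
    fix a assume "a \<in> S"
    then show "P (tensor_class R Y X (frag_of a))"
      using pure by (auto simp: pure_tensor_class)
  qed
  then show ?thesis
    using c by simp
qed

lemma pure_tensor_add_right:
  assumes "y \<in> carrier Y" "x \<in> carrier X" "x' \<in> carrier X"
  shows "pure_tensor R Y X y (x \<oplus>\<^bsub>X\<^esub> x') = pure_tensor R Y X y x \<otimes>\<^bsub>T\<^esub> pure_tensor R Y X y x'"
proof -
  have "frag_of (y, x \<oplus>\<^bsub>X\<^esub> x') - frag_of (y, x) - frag_of (y, x') \<in> tensor_null R Y X"
    by (intro relator_in_null tensor_relatorsI assms)
  then show ?thesis
    using assms by (simp add: pure_tensor_class tensor_class_add keys_frag_of tensor_class_eq_iff diff_diff_eq)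
qed

lemma pure_tensor_smult:
  assumes "a \<in> carrier R" "y \<in> carrier Y" "x \<in> carrier X"
  shows "pure_tensor R Y X (a \<odot>\<^bsub>Y\<^esub> y) x = pure_tensor R Y X y (a \<odot>\<^bsub>X\<^esub> x)"
proof -
  have "frag_of (a \<odot>\<^bsub>Y\<^esub> y, x) - frag_of (y, a \<odot>\<^bsub>X\<^esub> x) \<in> tensor_null R Y X"
    by (intro relator_in_null tensor_relatorsI assms)
  then show ?thesis
    by (simp add: pure_tensor_class tensor_class_eq_iff)
qed

end

text \<open>
  The map induced on free groups sends relators to relators, hence a coset into a single coset.
\<close>

lemma tensor_map_class:
  assumes Y: "right_module R Y" and X: "left_module R X" and X': "left_module R X'"
    and f: "f \<in> mod_hom R X X'"
  shows "tensor_map R Y X X' f (tensor_class R Y X c) =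
     tensor_class R Y X' (frag_extend (\<lambda>(y, x). frag_of (y, f x)) c)"
proof -
  interpret A: tensor_pair R Y X using Y X by (simp add: tensor_pair_def)
  interpret B: tensor_pair R Y X' using Y X' by (simp add: tensor_pair_def)
  let ?\<phi> = "frag_extend (\<lambda>(y, x). frag_of (y, f x))"
  note mod_homD[OF f, simp]
  have keys: "Poly_Mapping.keys (?\<phi> c) \<subseteq> B.S" if "Poly_Mapping.keys c \<subseteq> A.S" for c
    using that mod_homD(1)[OF f] by (intro keys_frag_extend_map) auto
  have hom: "?\<phi> \<in> hom A.G B.G"
    by (rule homI) (simp_all add: keys frag_extend_add)
  interpret \<phi>: group_hom A.G B.G ?\<phi>
    by (simp add: group_hom_def group_hom_axioms_def hom)
  have "?\<phi> ` tensor_relators R Y X \<subseteq> tensor_relators R Y X'"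
  proof (rule image_subsetI)
    fix c assume "c \<in> tensor_relators R Y X"
    then show "?\<phi> c \<in> tensor_relators R Y X'"
      by (cases rule: tensor_relatorsE) (simp_all add: frag_extend_diff tensor_relatorsI)
  qed
  then have "generate B.G (?\<phi> ` tensor_relators R Y X) \<subseteq> tensor_null R Y X'"
    unfolding tensor_null_def by (rule group.mono_generate[OF group_free_Abelian_group])
  then have null: "?\<phi> h \<in> tensor_null R Y X'" if "h \<in> tensor_null R Y X" for h
    using that \<phi>.generate_img[OF A.relators_subset] by (auto simp: tensor_null_def)
  have "h' + ?\<phi> (h + c) \<in> tensor_class R Y X' (?\<phi> c)"
    if "h' \<in> tensor_null R Y X'" "h \<in> tensor_null R Y X" for h h'
    unfolding tensor_class_altdef
    by (rule image_eqI[where x = "h' + ?\<phi> h"]) (auto simp: frag_extend_add add.assoc intro: B.null_add that null)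
  then have "tensor_map R Y X X' f (tensor_class R Y X c) \<subseteq> tensor_class R Y X' (?\<phi> c)"
    by (auto simp: tensor_map_def set_mult_def tensor_class_altdef[of R Y X])
  moreover have "c \<in> tensor_class R Y X c"
    unfolding tensor_class_altdef by (rule image_eqI[where x = 0]) (simp_all add: A.null_zero)
  then have "h' + ?\<phi> c \<in> tensor_map R Y X X' f (tensor_class R Y X c)" if "h' \<in> tensor_null R Y X'" for h'
    using that by (auto simp: tensor_map_def set_mult_def)
  ultimately show ?thesis
    by (auto simp: tensor_class_altdef[of R Y X'])
qed

lemma tensor_map_pure:
  assumes "right_module R Y" "left_module R X" "left_module R X'" "f \<in> mod_hom R X X'"
  shows "tensor_map R Y X X' f (pure_tensor R Y X y x) = pure_tensor R Y X' y (f x)"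
  using tensor_map_class[OF assms, of "frag_of (y, x)"] by (simp add: pure_tensor_class)

lemma tensor_map_hom:
  assumes Y: "right_module R Y" and X: "left_module R X" and X': "left_module R X'"
    and f: "f \<in> mod_hom R X X'"
  shows "tensor_map R Y X X' f \<in> hom (tensor R Y X) (tensor R Y X')"
proof -
  interpret A: tensor_pair R Y X using Y X by (simp add: tensor_pair_def)
  interpret B: tensor_pair R Y X' using Y X' by (simp add: tensor_pair_def)
  let ?\<phi> = "frag_extend (\<lambda>(y, x). frag_of (y, f x))"
  have keys: "Poly_Mapping.keys (?\<phi> c) \<subseteq> B.S" if "Poly_Mapping.keys c \<subseteq> A.S" for c
    using that mod_homD(1)[OF f] by (intro keys_frag_extend_map) auto
  show ?thesis
    by (rule homI) (auto simp: A.carrier_tensor tensor_map_class[OF assms] B.tensor_class_closed keys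
        A.tensor_class_add B.tensor_class_add frag_extend_add)
qed

lemma tensor_map_id:
  assumes Y: "right_module R Y" and X: "left_module R X" and t: "t \<in> carrier (tensor R Y X)"
  shows "tensor_map R Y X X (\<lambda>x\<in>carrier X. x) t = t"
proof -
  interpret A: tensor_pair R Y X using Y X by (simp add: tensor_pair_def)
  interpret T: comm_group A.T by (rule A.comm_group_tensor)
  note id = mod_hom_id[OF X]
  define h where "h = tensor_map R Y X X (\<lambda>x\<in>carrier X. x)"
  interpret h: group_hom A.T A.T h
    using tensor_map_hom[OF Y X X id] by (simp add: group_hom_def group_hom_axioms_def T.is_group h_def)
  have "h t = t"
    using t
  proof (induction rule: A.tensor_induct)
    case (pure_tensor y x)
    then show ?case
      unfolding h_def tensor_map_pure[OF Y X X id] by simp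
  qed simp
  then show ?thesis
    by (simp only: h_def)
qed

lemma regular_right_module:
  assumes "ring R" shows "right_module R (regular_right R)"
proof -
  interpret R: ring R by fact
  have "abelian_group (regular_right R)"
    by (rule abelian_groupI) (auto simp: regular_right_def R.a_ac intro: bexI[of _ "\<ominus>\<^bsub>R\<^esub> x" for x] R.l_neg)
  then show ?thesis
    by (simp add: right_module_def right_module_axioms_def R.ring_axioms)
      (simp add: regular_right_def R.l_distr R.r_distr R.m_assoc)
qed

lemma regular_right_RMod:
  "\<lbrakk>ring R; carrier R \<prec> (UNIV :: 'u::set_universe set)\<rbrakk> \<Longrightarrow> regular_right R \<in> RMod (R :: 'u ring)"
  by (simp add: RMod_def regular_right_module) (simp add: regular_right_def)

text \<open>
  Surjectivity holds since \<open>a \<otimes> x = 1 \<otimes> a x\<close>. For injectivity, the homomorphism from the free group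
  to \<open>X\<close> with \<open>(a, x) \<mapsto> a x\<close> kills the relators and sends \<open>(1, x)\<close> to \<open>x\<close>.
\<close>

lemma pure_tensor_one_bij:
  assumes R: "ring R" and X: "left_module R X"
  shows "bij_betw (pure_tensor R (regular_right R) X \<one>\<^bsub>R\<^esub>) (carrier X) (carrier (tensor R (regular_right R) X))"
proof -
  interpret X: left_module R X by fact
  interpret A: tensor_pair R "regular_right R" X
    using regular_right_module[OF R] X by (simp add: tensor_pair_def)
  interpret T: comm_group A.T by (rule A.comm_group_tensor)
  have carrier [simp]: "carrier (regular_right R) = carrier R"
    by (simp add: regular_right_def)
  let ?p = "pure_tensor R (regular_right R) X"
  have p_hom: "?p \<one>\<^bsub>R\<^esub> \<in> hom (add_monoid X) A.T"
    by (rule homI) (simp_all add: A.pure_tensor_add_right)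
  interpret p: group_hom "add_monoid X" A.T "?p \<one>\<^bsub>R\<^esub>"
    using p_hom by (simp add: group_hom_def group_hom_axioms_def T.is_group X.M.a_group)
  have "t \<in> ?p \<one>\<^bsub>R\<^esub> ` carrier X" if "t \<in> carrier A.T" for t
    using that
  proof (induction rule: A.tensor_induct)
    case (pure_tensor a x)
    then have "?p (a \<odot>\<^bsub>regular_right R\<^esub> \<one>\<^bsub>R\<^esub>) x = ?p \<one>\<^bsub>R\<^esub> (a \<odot>\<^bsub>X\<^esub> x)"
      by (intro A.pure_tensor_smult) auto
    then have "?p a x = ?p \<one>\<^bsub>R\<^esub> (a \<odot>\<^bsub>X\<^esub> x)"
      using pure_tensor by (simp add: regular_right_def)
    then show ?case
      using pure_tensor X.smult_closed by auto
  next
    case (diff s t)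
    then obtain x x' where "s = ?p \<one>\<^bsub>R\<^esub> x" "t = ?p \<one>\<^bsub>R\<^esub> x'" "x \<in> carrier X" "x' \<in> carrier X"
      by auto
    moreover from this have "s \<otimes>\<^bsub>A.T\<^esub> inv\<^bsub>A.T\<^esub> t = ?p \<one>\<^bsub>R\<^esub> (x \<oplus>\<^bsub>X\<^esub> \<ominus>\<^bsub>X\<^esub> x')"
      using p.hom_mult p.hom_inv by (simp add: a_inv_def)
    ultimately show ?case
      by blast
  qed
  then have surj: "?p \<one>\<^bsub>R\<^esub> ` carrier X = carrier A.T"
    by auto
  have inj: "inj_on (?p \<one>\<^bsub>R\<^esub>) (carrier X)"
  proof (rule inj_onI)
    fix x x' assume x: "x \<in> carrier X" "x' \<in> carrier X" and eq: "?p \<one>\<^bsub>R\<^esub> x = ?p \<one>\<^bsub>R\<^esub> x'"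
    obtain h where h: "h \<in> hom A.G (add_monoid X)" and
      h_of: "\<And>z. z \<in> A.S \<Longrightarrow> h (frag_of z) = (\<lambda>(a, x). a \<odot>\<^bsub>X\<^esub> x) z"
      by (rule comm_group.free_Abelian_group_universal[OF X.M.a_comm_group, of "\<lambda>(a, x). a \<odot>\<^bsub>X\<^esub> x" A.S])
        (auto simp: X.smult_closed)
    interpret h: group_hom A.G "add_monoid X" h
      using h by (simp add: group_hom_def group_hom_axioms_def X.M.a_group)
    have h_diff: "h (c - d) = h c \<ominus>\<^bsub>X\<^esub> h d" if "Poly_Mapping.keys c \<subseteq> A.S" "Poly_Mapping.keys d \<subseteq> A.S" for c d
    proof -
      have "h (c \<otimes>\<^bsub>A.G\<^esub> inv\<^bsub>A.G\<^esub> d) = h c \<otimes>\<^bsub>add_monoid X\<^esub> inv\<^bsub>add_monoid X\<^esub> h d"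
        using that by (subst h.hom_mult, simp, simp, subst h.hom_inv) auto
      then show ?thesis
        using that by (simp add: a_minus_def a_inv_def)
    qed
    have "tensor_relators R (regular_right R) X \<subseteq> kernel A.G (add_monoid X) h"
    proof
      fix c assume c: "c \<in> tensor_relators R (regular_right R) X"
      have keys: "Poly_Mapping.keys c \<subseteq> A.S"
        using subsetD[OF A.relators_subset c] by simp
      have cancel: "u \<oplus>\<^bsub>X\<^esub> v \<ominus>\<^bsub>X\<^esub> u \<ominus>\<^bsub>X\<^esub> v = \<zero>\<^bsub>X\<^esub>" if "u \<in> carrier X" "v \<in> carrier X" for u v
      proof -
        have "u \<oplus>\<^bsub>X\<^esub> v \<oplus>\<^bsub>X\<^esub> \<ominus>\<^bsub>X\<^esub> u = v"
          using that by (subst X.M.a_comm[of u v]) (simp_all add: X.M.a_assoc X.M.r_neg)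
        then show ?thesis
          using that by (simp add: a_minus_def X.M.r_neg)
      qed
      have ops: "a \<oplus>\<^bsub>regular_right R\<^esub> b = a \<oplus>\<^bsub>R\<^esub> b" "a \<odot>\<^bsub>regular_right R\<^esub> b = b \<otimes>\<^bsub>R\<^esub> a" for a b
        by (simp_all add: regular_right_def)
      note h_simps = h_diff h_of keys_frag_of keys_diff_subset cancel X.smult_closed
      from c have "h c = \<zero>\<^bsub>X\<^esub>"
      proof (cases rule: tensor_relatorsE)
        case (add_left a b z)
        then show ?thesis by (simp add: ops h_simps X.smult_l_distr)
      next
        case (add_right a z z')
        then show ?thesis by (simp add: h_simps X.smult_r_distr)
      next
        case (smult a b z)
        then show ?thesis by (simp add: ops h_simps X.smult_assoc) (simp add: a_minus_def X.M.r_neg X.smult_closed)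
      qed
      then show "c \<in> kernel A.G (add_monoid X) h"
        using keys by (simp add: kernel_def)
    qed
    then have null: "tensor_null R (regular_right R) X \<subseteq> kernel A.G (add_monoid X) h"
      unfolding tensor_null_def by (intro group.generate_subgroup_incl h.subgroup_kernel) auto
    have "frag_of (\<one>\<^bsub>R\<^esub>, x) - frag_of (\<one>\<^bsub>R\<^esub>, x') \<in> tensor_null R (regular_right R) X"
      using eq by (simp add: pure_tensor_class A.tensor_class_eq_iff)
    then have "h (frag_of (\<one>\<^bsub>R\<^esub>, x) - frag_of (\<one>\<^bsub>R\<^esub>, x')) = \<zero>\<^bsub>X\<^esub>"
      using null by (auto simp: kernel_def)
    then have "x \<ominus>\<^bsub>X\<^esub> x' = \<zero>\<^bsub>X\<^esub>"
      using x by (simp add: h_diff h_of keys_frag_of X.smult_one)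
    then show "x = x'"
      using x X.M.minus_equality[of x "\<ominus>\<^bsub>X\<^esub> x'"] by (simp add: a_minus_def)
  qed
  show ?thesis
    using inj surj by (simp add: bij_betw_def)
qed

lemma tensor_unit_closed:
  assumes "ring R" "left_module R X" "t \<in> carrier (tensor R (regular_right R) X)"
  shows "tensor_unit R X t \<in> carrier X"
  unfolding tensor_unit_def
  by (rule the_inv_into_into) (use pure_tensor_one_bij[OF assms(1,2)] assms(3) in \<open>auto simp: bij_betw_def\<close>)

lemma tensor_unit_pure_one:
  assumes "ring R" "left_module R X" "x \<in> carrier X"
  shows "tensor_unit R X (pure_tensor R (regular_right R) X \<one>\<^bsub>R\<^esub> x) = x"
  unfolding tensor_unit_def
  by (rule the_inv_into_f_f) (use pure_tensor_one_bij[OF assms(1,2)] assms(3) in \<open>auto simp: bij_betw_def\<close>)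

lemma pure_one_tensor_unit:
  assumes "ring R" "left_module R X" "t \<in> carrier (tensor R (regular_right R) X)"
  shows "pure_tensor R (regular_right R) X \<one>\<^bsub>R\<^esub> (tensor_unit R X t) = t"
  unfolding tensor_unit_def
  by (rule f_the_inv_into_f) (use pure_tensor_one_bij[OF assms(1,2)] assms(3) in \<open>auto simp: bij_betw_def\<close>)

lemma tensor_unit_pure:
  assumes R: "ring R" and X: "left_module R X" and a: "a \<in> carrier R" and x: "x \<in> carrier X"
  shows "tensor_unit R X (pure_tensor R (regular_right R) X a x) = a \<odot>\<^bsub>X\<^esub> x"
proof -
  interpret R: ring R by fact
  interpret X: left_module R X by fact
  interpret A: tensor_pair R "regular_right R" X
    using regular_right_module[OF R] X by (simp add: tensor_pair_def)
  have "pure_tensor R (regular_right R) X (a \<odot>\<^bsub>regular_right R\<^esub> \<one>\<^bsub>R\<^esub>) x =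
      pure_tensor R (regular_right R) X \<one>\<^bsub>R\<^esub> (a \<odot>\<^bsub>X\<^esub> x)"
    using a x by (intro A.pure_tensor_smult) (auto simp: regular_right_def)
  then have "pure_tensor R (regular_right R) X a x = pure_tensor R (regular_right R) X \<one>\<^bsub>R\<^esub> (a \<odot>\<^bsub>X\<^esub> x)"
    using a by (simp add: regular_right_def)
  then show ?thesis
    using R X a x by (simp add: tensor_unit_pure_one X.smult_closed)
qed

lemma tensor_unit_mult:
  assumes R: "ring R" and X: "left_module R X"
    and s: "s \<in> carrier (tensor R (regular_right R) X)" and t: "t \<in> carrier (tensor R (regular_right R) X)"
  shows "tensor_unit R X (s \<otimes>\<^bsub>tensor R (regular_right R) X\<^esub> t) = tensor_unit R X s \<oplus>\<^bsub>X\<^esub> tensor_unit R X t"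
proof -
  interpret R: ring R by fact
  interpret X: left_module R X by fact
  interpret A: tensor_pair R "regular_right R" X
    using regular_right_module[OF R] X by (simp add: tensor_pair_def)
  have "s \<otimes>\<^bsub>A.T\<^esub> t = pure_tensor R (regular_right R) X \<one>\<^bsub>R\<^esub> (tensor_unit R X s \<oplus>\<^bsub>X\<^esub> tensor_unit R X t)"
    using assms by (subst A.pure_tensor_add_right)
      (auto simp: tensor_unit_closed pure_one_tensor_unit, simp add: regular_right_def)
  then show ?thesis
    using assms by (simp add: tensor_unit_pure_one tensor_unit_closed)
qed

lemma tensor_unit_tensor_map:
  assumes R: "ring R" and X: "left_module R X" and X': "left_module R X'" and f: "f \<in> mod_hom R X X'"
    and t: "t \<in> carrier (tensor R (regular_right R) X)"
  shows "tensor_unit R X' (tensor_map R (regular_right R) X X' f t) = f (tensor_unit R X t)"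
proof -
  have "tensor_map R (regular_right R) X X' f t =
      tensor_map R (regular_right R) X X' f (pure_tensor R (regular_right R) X \<one>\<^bsub>R\<^esub> (tensor_unit R X t))"
    using assms by (simp add: pure_one_tensor_unit)
  also have "\<dots> = pure_tensor R (regular_right R) X' \<one>\<^bsub>R\<^esub> (f (tensor_unit R X t))"
    using assms by (intro tensor_map_pure regular_right_module)
  finally show ?thesis
    using assms mod_homD(1)[OF f] by (simp add: tensor_unit_pure_one tensor_unit_closed)
qed

lemma tensor_unit_one:
  assumes R: "ring R" and X: "left_module R X"
  shows "tensor_unit R X \<one>\<^bsub>tensor R (regular_right R) X\<^esub> = \<zero>\<^bsub>X\<^esub>"
proof -
  interpret X: left_module R X by fact
  interpret A: tensor_pair R "regular_right R" X
    using regular_right_module[OF R] X by (simp add: tensor_pair_def)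
  interpret T: comm_group A.T by (rule A.comm_group_tensor)
  have "tensor_unit R X \<one>\<^bsub>A.T\<^esub> \<oplus>\<^bsub>X\<^esub> tensor_unit R X \<one>\<^bsub>A.T\<^esub> = tensor_unit R X \<one>\<^bsub>A.T\<^esub>"
    using tensor_unit_mult[OF R X, of "\<one>\<^bsub>A.T\<^esub>" "\<one>\<^bsub>A.T\<^esub>"] by simp
  then show ?thesis
    using tensor_unit_closed[OF R X, of "\<one>\<^bsub>A.T\<^esub>"] by simp
qed

section \<open>Evaluation of the dual at elements\<close>

locale functor_over_ring = R?: ring R + functorial_module R M
  for R :: "('u::set_universe) ring" and M :: "('u, 'v) module_functor" +
  assumes R_small: "carrier R \<prec> (UNIV :: 'u set)"
begin

abbreviation "D \<equiv> dual R M (regular_right R)"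
abbreviation "val \<equiv> eval_map R M"

lemmas LModD = left_module_LMod

lemma regular_right_in_RMod: "regular_right R \<in> RMod R"
  by (rule regular_right_RMod[OF R.ring_axioms R_small])

lemma Fob_is_group: "X \<in> LMod R \<Longrightarrow> group (Fob M X)"
  using Fob_group by (simp add: comm_group_def)

lemma Fmap_group_hom:
  "\<lbrakk>X \<in> LMod R; Y \<in> LMod R; f \<in> mod_hom R X Y\<rbrakk> \<Longrightarrow> group_hom (Fob M X) (Fob M Y) (Fmap M X Y f)"
  by (simp add: group_hom_def group_hom_axioms_def Fob_is_group Fmap_hom)

lemma Fmap_closed:
  "\<lbrakk>X \<in> LMod R; Y \<in> LMod R; f \<in> mod_hom R X Y; m \<in> carrier (Fob M X)\<rbrakk> \<Longrightarrow>
     Fmap M X Y f m \<in> carrier (Fob M Y)"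
  using Fmap_hom by (rule hom_in_carrier)

lemma Fmap_const_zero:
  assumes X: "X \<in> LMod R" and Y: "Y \<in> LMod R" and m: "m \<in> carrier (Fob M X)"
  shows "Fmap M X Y (\<lambda>x\<in>carrier X. \<zero>\<^bsub>Y\<^esub>) m = \<one>\<^bsub>Fob M Y\<^esub>"
proof -
  interpret Y: left_module R Y using LModD[OF Y] .
  interpret FY: group "Fob M Y" using Fob_is_group[OF Y] .
  let ?o = "\<lambda>x\<in>carrier X. \<zero>\<^bsub>Y\<^esub>"
  have o: "?o \<in> mod_hom R X Y"
    by (rule mod_hom_const_zero[OF LModD[OF X] LModD[OF Y]])
  have "(\<lambda>x\<in>carrier X. ?o x \<oplus>\<^bsub>Y\<^esub> ?o x) = ?o"
    by (rule restrict_ext) simp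
  then have "Fmap M X Y ?o m = Fmap M X Y ?o m \<otimes>\<^bsub>Fob M Y\<^esub> Fmap M X Y ?o m"
    using Fmap_add[OF X Y o o m] by simp
  then show ?thesis
    using Fmap_closed[OF X Y o m] by simp
qed

lemma Fmap_minus:
  assumes X: "X \<in> LMod R" and Y: "Y \<in> LMod R" and f: "f \<in> mod_hom R X Y" and m: "m \<in> carrier (Fob M X)"
  shows "Fmap M X Y (\<lambda>x\<in>carrier X. \<ominus>\<^bsub>Y\<^esub> f x) m = inv\<^bsub>Fob M Y\<^esub> Fmap M X Y f m"
proof -
  interpret Y: left_module R Y using LModD[OF Y] .
  interpret FY: comm_group "Fob M Y" using Fob_group[OF Y] .
  let ?n = "\<lambda>x\<in>carrier X. \<ominus>\<^bsub>Y\<^esub> f x"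
  have n: "?n \<in> mod_hom R X Y"
    by (rule mod_hom_minus[OF f LModD[OF X] LModD[OF Y]])
  have "(\<lambda>x\<in>carrier X. ?n x \<oplus>\<^bsub>Y\<^esub> f x) = (\<lambda>x\<in>carrier X. \<zero>\<^bsub>Y\<^esub>)"
    by (rule restrict_ext) (simp add: Y.M.l_neg mod_homD(1)[OF f])
  then have "Fmap M X Y ?n m \<otimes>\<^bsub>Fob M Y\<^esub> Fmap M X Y f m = \<one>\<^bsub>Fob M Y\<^esub>"
    using Fmap_add[OF X Y n f m] Fmap_const_zero[OF X Y m] by simp
  then show ?thesis
    using FY.inv_equality Fmap_closed[OF X Y f m] Fmap_closed[OF X Y n m] by metis
qed

lemma dualD:
  assumes "w \<in> dual R M Y" "X \<in> LMod R"
  shows "w X \<in> hom (Fob M X) (tensor R Y X)"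
    and "w X \<in> extensional (carrier (Fob M X))"
    and "\<lbrakk>X' \<in> LMod R; f \<in> mod_hom R X X'; m \<in> carrier (Fob M X)\<rbrakk> \<Longrightarrow>
      w X' (Fmap M X X' f m) = tensor_map R Y X X' f (w X m)"
  using assms by (auto simp: dual_def nat_hom_def quasi_coherent_def PiE_iff)

lemma dual_closed:
  "\<lbrakk>w \<in> dual R M Y; X \<in> LMod R; m \<in> carrier (Fob M X)\<rbrakk> \<Longrightarrow> w X m \<in> carrier (tensor R Y X)"
  using dualD(1) by (rule hom_in_carrier)

lemma dualI:
  assumes "\<And>X m. \<lbrakk>X \<in> LMod R; m \<in> carrier (Fob M X)\<rbrakk> \<Longrightarrow> w X m \<in> carrier (tensor R Y X)"
    and "\<And>X m m'. \<lbrakk>X \<in> LMod R; m \<in> carrier (Fob M X); m' \<in> carrier (Fob M X)\<rbrakk> \<Longrightarrow>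
      w X (m \<otimes>\<^bsub>Fob M X\<^esub> m') = w X m \<otimes>\<^bsub>tensor R Y X\<^esub> w X m'"
    and "\<And>X X' f m. \<lbrakk>X \<in> LMod R; X' \<in> LMod R; f \<in> mod_hom R X X'; m \<in> carrier (Fob M X)\<rbrakk> \<Longrightarrow>
      w X' (Fmap M X X' f m) = tensor_map R Y X X' f (w X m)"
  shows "(\<lambda>X\<in>LMod R. \<lambda>m\<in>carrier (Fob M X). w X m) \<in> dual R M Y"
proof -
  have "(\<lambda>m\<in>carrier (Fob M X). w X m) \<in> hom (Fob M X) (tensor R Y X)" if "X \<in> LMod R" for X
  proof -
    interpret group "Fob M X" using Fob_is_group[OF that] .
    show ?thesis
      using assms(1,2)[OF that] by (intro homI) auto
  qed
  then show ?thesis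
    using assms(3) Fmap_closed by (auto simp: dual_def nat_hom_def quasi_coherent_def)
qed

lemma val_eq: "w \<in> D \<Longrightarrow> val X m w = tensor_unit R X (w X m)"
  by (simp add: eval_map_def)

lemma val_closed:
  "\<lbrakk>X \<in> LMod R; m \<in> carrier (Fob M X); w \<in> D\<rbrakk> \<Longrightarrow> val X m w \<in> carrier X"
  by (simp add: val_eq tensor_unit_closed R.ring_axioms LModD dual_closed)

lemma val_Fmap:
  "\<lbrakk>X \<in> LMod R; X' \<in> LMod R; f \<in> mod_hom R X X'; m \<in> carrier (Fob M X); w \<in> D\<rbrakk> \<Longrightarrow>
     val X' (Fmap M X X' f m) w = f (val X m w)"
  by (simp add: val_eq dualD(3) tensor_unit_tensor_map R.ring_axioms LModD dual_closed)

lemma val_mult: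
  assumes X: "X \<in> LMod R" and m: "m \<in> carrier (Fob M X)" and m': "m' \<in> carrier (Fob M X)" and w: "w \<in> D"
  shows "val X (m \<otimes>\<^bsub>Fob M X\<^esub> m') w = val X m w \<oplus>\<^bsub>X\<^esub> val X m' w"
proof -
  have "w X (m \<otimes>\<^bsub>Fob M X\<^esub> m') = w X m \<otimes>\<^bsub>tensor R (regular_right R) X\<^esub> w X m'"
    using dualD(1)[OF w X] m m' by (rule hom_mult)
  then show ?thesis
    using assms by (simp add: val_eq tensor_unit_mult[OF R.ring_axioms LModD[OF X]] dual_closed)
qed

lemma val_one:
  assumes X: "X \<in> LMod R" and w: "w \<in> D"
  shows "val X \<one>\<^bsub>Fob M X\<^esub> w = \<zero>\<^bsub>X\<^esub>"
proof -
  interpret X: left_module R X using LModD[OF X] .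
  interpret FX: group "Fob M X" using Fob_is_group[OF X] .
  have "val X \<one>\<^bsub>Fob M X\<^esub> w \<oplus>\<^bsub>X\<^esub> val X \<one>\<^bsub>Fob M X\<^esub> w = val X \<one>\<^bsub>Fob M X\<^esub> w"
    using val_mult[OF X _ _ w, of "\<one>\<^bsub>Fob M X\<^esub>" "\<one>\<^bsub>Fob M X\<^esub>"] by simp
  then show ?thesis
    using val_closed[OF X _ w, of "\<one>\<^bsub>Fob M X\<^esub>"] by simp
qed

lemma dual_one:
  assumes Y: "Y \<in> RMod R"
  shows "(\<lambda>X\<in>LMod R. \<lambda>m\<in>carrier (Fob M X). \<one>\<^bsub>tensor R Y X\<^esub>) \<in> dual R M Y"
proof (rule dualI)
  have Ym: "right_module R Y"
    using Y by (simp add: RMod_def)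
  have grp: "group (tensor R Y X)" if "X \<in> LMod R" for X
    using tensor_pair.comm_group_tensor[of R Y X] Ym LModD[OF that] by (simp add: tensor_pair_def comm_group_def)
  show "\<one>\<^bsub>tensor R Y X\<^esub> \<in> carrier (tensor R Y X)" if "X \<in> LMod R" for X
    using grp[OF that] by (simp add: group.is_monoid)
  show "\<one>\<^bsub>tensor R Y X\<^esub> = \<one>\<^bsub>tensor R Y X\<^esub> \<otimes>\<^bsub>tensor R Y X\<^esub> \<one>\<^bsub>tensor R Y X\<^esub>" if "X \<in> LMod R" for X
    using grp[OF that] by (simp add: group.is_monoid)
  show "\<one>\<^bsub>tensor R Y X'\<^esub> = tensor_map R Y X X' f \<one>\<^bsub>tensor R Y X\<^esub>"
    if "X \<in> LMod R" "X' \<in> LMod R" "f \<in> mod_hom R X X'" for X X' f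
    using hom_one[OF tensor_map_hom[OF Ym LModD LModD]] that grp by metis
qed

lemma dual_diff:
  assumes Y: "Y \<in> RMod R" and w: "w \<in> dual R M Y" and w': "w' \<in> dual R M Y"
  shows "(\<lambda>X\<in>LMod R. \<lambda>m\<in>carrier (Fob M X). w X m \<otimes>\<^bsub>tensor R Y X\<^esub> inv\<^bsub>tensor R Y X\<^esub> w' X m) \<in> dual R M Y"
proof (rule dualI)
  have Ym: "right_module R Y"
    using Y by (simp add: RMod_def)
  have grp: "comm_group (tensor R Y X)" if "X \<in> LMod R" for X
    using tensor_pair.comm_group_tensor[of R Y X] Ym LModD[OF that] by (simp add: tensor_pair_def)
  show "w X m \<otimes>\<^bsub>tensor R Y X\<^esub> inv\<^bsub>tensor R Y X\<^esub> w' X m \<in> carrier (tensor R Y X)"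
    if X: "X \<in> LMod R" "m \<in> carrier (Fob M X)" for X m
  proof -
    interpret T: comm_group "tensor R Y X" by (rule grp[OF X(1)])
    show ?thesis
      using dual_closed[OF w X] dual_closed[OF w' X] by simp
  qed
  show "w X (m \<otimes>\<^bsub>Fob M X\<^esub> m') \<otimes>\<^bsub>tensor R Y X\<^esub> inv\<^bsub>tensor R Y X\<^esub> w' X (m \<otimes>\<^bsub>Fob M X\<^esub> m') =
      (w X m \<otimes>\<^bsub>tensor R Y X\<^esub> inv\<^bsub>tensor R Y X\<^esub> w' X m) \<otimes>\<^bsub>tensor R Y X\<^esub>
      (w X m' \<otimes>\<^bsub>tensor R Y X\<^esub> inv\<^bsub>tensor R Y X\<^esub> w' X m')"
    if X: "X \<in> LMod R" "m \<in> carrier (Fob M X)" "m' \<in> carrier (Fob M X)" for X m m'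
  proof -
    interpret T: comm_group "tensor R Y X" by (rule grp[OF X(1)])
    show ?thesis
      using hom_mult[OF dualD(1)[OF w X(1)] X(2,3)] hom_mult[OF dualD(1)[OF w' X(1)] X(2,3)]
        dual_closed[OF w X(1,2)] dual_closed[OF w X(1,3)] dual_closed[OF w' X(1,2)] dual_closed[OF w' X(1,3)]
      by (simp add: T.inv_mult T.m_ac)
  qed
  show "w X' (Fmap M X X' f m) \<otimes>\<^bsub>tensor R Y X'\<^esub> inv\<^bsub>tensor R Y X'\<^esub> w' X' (Fmap M X X' f m) =
      tensor_map R Y X X' f (w X m \<otimes>\<^bsub>tensor R Y X\<^esub> inv\<^bsub>tensor R Y X\<^esub> w' X m)"
    if X: "X \<in> LMod R" "X' \<in> LMod R" "f \<in> mod_hom R X X'" "m \<in> carrier (Fob M X)" for X X' f m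
  proof -
    interpret T: comm_group "tensor R Y X" by (rule grp[OF X(1)])
    interpret T': comm_group "tensor R Y X'" by (rule grp[OF X(2)])
    interpret h: group_hom "tensor R Y X" "tensor R Y X'" "tensor_map R Y X X' f"
      using tensor_map_hom[OF Ym LModD[OF X(1)] LModD[OF X(2)] X(3)]
      by (simp add: group_hom_def group_hom_axioms_def T.is_group T'.is_group)
    show ?thesis
      using dual_closed[OF w X(1,4)] dual_closed[OF w' X(1,4)]
      by (simp add: dualD(3)[OF w X] dualD(3)[OF w' X])
  qed
qed

text \<open>
  This is the composite of \<open>w\<close> with the morphism from \<open>R \<otimes> -\<close> to \<open>Y \<otimes> -\<close> induced by the linear map
  \<open>R \<rightarrow> Y\<close>, \<open>1 \<mapsto> y\<close>; it is formulated through the identification of \<open>R \<otimes> X\<close> with \<open>X\<close>. For \<open>Y = R\<close> it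
  gives the left multiplication by \<open>y\<close> on \<open>D\<close>.
\<close>

lemma dual_pure:
  assumes Y: "Y \<in> RMod R" and y: "y \<in> carrier Y" and w: "w \<in> D"
  shows "(\<lambda>X\<in>LMod R. \<lambda>m\<in>carrier (Fob M X). pure_tensor R Y X y (val X m w)) \<in> dual R M Y"
proof (rule dualI)
  have Ym: "right_module R Y"
    using Y by (simp add: RMod_def)
  have pair: "tensor_pair R Y X" if "X \<in> LMod R" for X
    using Ym LModD[OF that] by (simp add: tensor_pair_def)
  show "pure_tensor R Y X y (val X m w) \<in> carrier (tensor R Y X)"
    if "X \<in> LMod R" "m \<in> carrier (Fob M X)" for X m
    using that by (intro tensor_pair.pure_tensor_closed[OF pair] y val_closed w)
  show "pure_tensor R Y X y (val X (m \<otimes>\<^bsub>Fob M X\<^esub> m') w) =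
      pure_tensor R Y X y (val X m w) \<otimes>\<^bsub>tensor R Y X\<^esub> pure_tensor R Y X y (val X m' w)"
    if "X \<in> LMod R" "m \<in> carrier (Fob M X)" "m' \<in> carrier (Fob M X)" for X m m'
    using that by (simp add: val_mult w tensor_pair.pure_tensor_add_right[OF pair] y val_closed)
  show "pure_tensor R Y X' y (val X' (Fmap M X X' f m) w) =
      tensor_map R Y X X' f (pure_tensor R Y X y (val X m w))"
    if "X \<in> LMod R" "X' \<in> LMod R" "f \<in> mod_hom R X X'" "m \<in> carrier (Fob M X)" for X X' f m
    using that by (simp add: val_Fmap w tensor_map_pure Ym LModD)
qed

text \<open>
  This and the next lemmas on \<open>D\<close> express its left module structure and the linearity of all maps \<open>val X m\<close>:
  the element of \<open>D\<close> obtained depends neither on \<open>X\<close> nor on \<open>m\<close>.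
\<close>

lemma exists_dual_zero: "\<exists>w\<in>D. \<forall>X\<in>LMod R. \<forall>m\<in>carrier (Fob M X). val X m w = \<zero>\<^bsub>X\<^esub>"
  using dual_one[OF regular_right_in_RMod]
  by (intro bexI) (auto simp: val_eq tensor_unit_one R.ring_axioms LModD)

lemma tensor_unit_diff:
  assumes X: "left_module R X" and s: "s \<in> carrier (tensor R (regular_right R) X)"
    and t: "t \<in> carrier (tensor R (regular_right R) X)"
  shows "tensor_unit R X (s \<otimes>\<^bsub>tensor R (regular_right R) X\<^esub> inv\<^bsub>tensor R (regular_right R) X\<^esub> t) =
     tensor_unit R X s \<ominus>\<^bsub>X\<^esub> tensor_unit R X t"
proof -
  interpret X: left_module R X by fact
  interpret T: comm_group "tensor R (regular_right R) X"
    using tensor_pair.comm_group_tensor[of R "regular_right R" X] X regular_right_module[OF R.ring_axioms]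
    by (simp add: tensor_pair_def)
  note unit = tensor_unit_mult[OF R.ring_axioms X] tensor_unit_closed[OF R.ring_axioms X]
    tensor_unit_one[OF R.ring_axioms X]
  have "tensor_unit R X (inv\<^bsub>tensor R (regular_right R) X\<^esub> t) \<oplus>\<^bsub>X\<^esub> tensor_unit R X t = \<zero>\<^bsub>X\<^esub>"
    using t by (simp add: unit flip: unit(1))
  then have "tensor_unit R X (inv\<^bsub>tensor R (regular_right R) X\<^esub> t) = \<ominus>\<^bsub>X\<^esub> tensor_unit R X t"
    using t X.M.minus_equality unit(2) T.inv_closed by metis
  then show ?thesis
    using s t by (simp add: unit a_minus_def)
qed

lemma exists_dual_diff:
  assumes w: "w \<in> D" and w': "w' \<in> D"
  shows "\<exists>v\<in>D. \<forall>X\<in>LMod R. \<forall>m\<in>carrier (Fob M X). val X m v = val X m w \<ominus>\<^bsub>X\<^esub> val X m w'"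
  using dual_diff[OF regular_right_in_RMod w w']
  by (intro bexI) (auto simp: val_eq w w' tensor_unit_diff LModD dual_closed[OF w] dual_closed[OF w'])

lemma exists_dual_add:
  assumes w: "w \<in> D" and w': "w' \<in> D"
  shows "\<exists>v\<in>D. \<forall>X\<in>LMod R. \<forall>m\<in>carrier (Fob M X). val X m v = val X m w \<oplus>\<^bsub>X\<^esub> val X m w'"
proof -
  obtain z where z: "z \<in> D" "\<And>X m. \<lbrakk>X \<in> LMod R; m \<in> carrier (Fob M X)\<rbrakk> \<Longrightarrow> val X m z = \<zero>\<^bsub>X\<^esub>"
    using exists_dual_zero by blast
  obtain u where u: "u \<in> D" "\<And>X m. \<lbrakk>X \<in> LMod R; m \<in> carrier (Fob M X)\<rbrakk> \<Longrightarrow> val X m u = val X m z \<ominus>\<^bsub>X\<^esub> val X m w'"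
    using exists_dual_diff[OF z(1) w'] by blast
  obtain v where v: "v \<in> D" "\<And>X m. \<lbrakk>X \<in> LMod R; m \<in> carrier (Fob M X)\<rbrakk> \<Longrightarrow> val X m v = val X m w \<ominus>\<^bsub>X\<^esub> val X m u"
    using exists_dual_diff[OF w u(1)] by blast
  have "val X m v = val X m w \<oplus>\<^bsub>X\<^esub> val X m w'" if X: "X \<in> LMod R" "m \<in> carrier (Fob M X)" for X m
  proof -
    interpret X: left_module R X using LModD[OF X(1)] .
    show ?thesis
      using val_closed[OF X w] val_closed[OF X w'] by (simp add: v u z X a_minus_def)
  qed
  then show ?thesis
    using v by blast
qed

lemma exists_dual_smult:
  assumes a: "a \<in> carrier R" and w: "w \<in> D"
  shows "\<exists>v\<in>D. \<forall>X\<in>LMod R. \<forall>m\<in>carrier (Fob M X). val X m v = a \<odot>\<^bsub>X\<^esub> val X m w"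
proof -
  have "a \<in> carrier (regular_right R)"
    using a by (simp add: regular_right_def)
  then show ?thesis
    using dual_pure[OF regular_right_in_RMod _ w, of a] a
    by (intro bexI) (auto simp: val_eq[of "restrict _ _"] tensor_unit_pure R.ring_axioms LModD val_closed[OF _ _ w])
qed

lemma val_range_submodule:
  assumes X: "X \<in> LMod R" and m: "m \<in> carrier (Fob M X)"
  shows "left_submodule R X (val X m ` D)"
  unfolding left_submodule_def
proof (intro conjI ballI)
  show "val X m ` D \<subseteq> carrier X"
    using val_closed[OF X m] by blast
  obtain z where z: "z \<in> D" "val X m z = \<zero>\<^bsub>X\<^esub>"
    using exists_dual_zero X m by blast
  show "\<zero>\<^bsub>X\<^esub> \<in> val X m ` D"
    by (rule image_eqI[where x = z]) (simp_all add: z)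
  show "x \<oplus>\<^bsub>X\<^esub> y \<in> val X m ` D" if xy: "x \<in> val X m ` D" "y \<in> val X m ` D" for x y
  proof -
    obtain v w where vw: "v \<in> D" "w \<in> D" "x = val X m v" "y = val X m w"
      using xy by blast
    obtain u where u: "u \<in> D" "val X m u = val X m v \<oplus>\<^bsub>X\<^esub> val X m w"
      using exists_dual_add[OF vw(1,2)] X m by blast
    show ?thesis
      unfolding vw(3,4) by (rule image_eqI[where x = u]) (simp_all add: u)
  qed
  show "a \<odot>\<^bsub>X\<^esub> x \<in> val X m ` D" if ax: "a \<in> carrier R" "x \<in> val X m ` D" for a x
  proof -
    obtain w where w: "w \<in> D" "x = val X m w"
      using ax(2) by blast
    obtain u where u: "u \<in> D" "val X m u = a \<odot>\<^bsub>X\<^esub> val X m w"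
      using exists_dual_smult[OF ax(1) w(1)] X m by blast
    show ?thesis
      unfolding w(2) by (rule image_eqI[where x = u]) (simp_all add: u)
  qed
qed

section \<open>Submodule schemes and elements\<close>

text \<open>
  Equivalently, the morphism to \<open>M\<close> from the module scheme of \<open>N\<close> that corresponds to \<open>n\<close> has an
  epimorphism as its dual.
\<close>

definition dual_generator :: "'u mdl \<Rightarrow> 'v \<Rightarrow> bool" where
  "dual_generator N n \<longleftrightarrow> N \<in> LMod R \<and> n \<in> carrier (Fob M N) \<and> val N n ` D = carrier N"

text \<open>
  Equivalently, the morphism to \<open>M\<close> from the module scheme of \<open>N\<close> that corresponds to \<open>n\<close> is a
  monomorphism.
\<close>

definition faithful_element :: "'u mdl \<Rightarrow> 'v \<Rightarrow> bool" where
  "faithful_element N n \<longleftrightarrow> N \<in> LMod R \<and> n \<in> carrier (Fob M N) \<and>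
     (\<forall>X\<in>LMod R. inj_on (\<lambda>f. Fmap M N X f n) (mod_hom R N X))"

text \<open>
  \<open>f\<close> is determined by \<open>f\<^sub>* n\<close> since it sends the element \<open>val N n w\<close> to \<open>val X (f\<^sub>* n) w\<close>.
\<close>

lemma dual_generator_faithful:
  assumes "dual_generator N n" shows "faithful_element N n"
proof -
  have N: "N \<in> LMod R" and n: "n \<in> carrier (Fob M N)" and surj: "val N n ` D = carrier N"
    using assms by (auto simp: dual_generator_def)
  have "f = g" if X: "X \<in> LMod R" and f: "f \<in> mod_hom R N X" and g: "g \<in> mod_hom R N X"
    and eq: "Fmap M N X f n = Fmap M N X g n" for X f g
  proof (rule mod_hom_eqI[OF f g])
    fix x assume "x \<in> carrier N"
    then obtain w where "w \<in> D" "x = val N n w"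
      using surj by blast
    then show "f x = g x"
      using val_Fmap[OF N X f n] val_Fmap[OF N X g n] eq by simp
  qed
  then show ?thesis
    using N n by (auto simp: faithful_element_def inj_on_def)
qed

definition yoneda_image :: "'u mdl \<Rightarrow> 'v \<Rightarrow> 'u mdl \<Rightarrow> 'v set" where
  "yoneda_image N n X = (\<lambda>f. Fmap M N X f n) ` mod_hom R N X"

definition yoneda :: "'u mdl \<Rightarrow> 'v \<Rightarrow> 'u mdl \<Rightarrow> ('u \<Rightarrow> 'u) \<Rightarrow> 'v" where
  "yoneda N n = (\<lambda>X\<in>LMod R. \<lambda>f\<in>mod_hom R N X. Fmap M N X f n)"

lemma faithful_element_eq_zero:
  assumes n: "faithful_element N n" and X: "X \<in> LMod R" and f: "f \<in> mod_hom R N X"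
    and eq: "Fmap M N X f n = \<one>\<^bsub>Fob M X\<^esub>"
  shows "f = (\<lambda>x\<in>carrier N. \<zero>\<^bsub>X\<^esub>)"
proof -
  have N: "N \<in> LMod R" "n \<in> carrier (Fob M N)" and inj: "inj_on (\<lambda>f. Fmap M N X f n) (mod_hom R N X)"
    using n X by (auto simp: faithful_element_def)
  show ?thesis
    using inj_onD[OF inj, of f "\<lambda>x\<in>carrier N. \<zero>\<^bsub>X\<^esub>"] eq f Fmap_const_zero[OF N(1) X N(2)]
      mod_hom_const_zero[OF LModD[OF N(1)] LModD[OF X]] by simp
qed

lemma yoneda_submodule_functor:
  assumes N: "N \<in> LMod R" and n: "n \<in> carrier (Fob M N)"
  shows "submodule_functor R M (yoneda_image N n)"
  unfolding submodule_functor_def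
proof (intro conjI ballI)
  fix X assume X: "X \<in> LMod R"
  interpret X: left_module R X using LModD[OF X] .
  interpret FX: comm_group "Fob M X" using Fob_group[OF X] .
  note Nm = LModD[OF N] and Xm = LModD[OF X]
  show "subgroup (yoneda_image N n X) (Fob M X)"
  proof (rule FX.subgroupI)
    show "yoneda_image N n X \<subseteq> carrier (Fob M X)"
      using Fmap_closed[OF N X _ n] by (auto simp: yoneda_image_def)
    show "yoneda_image N n X \<noteq> {}"
      using mod_hom_const_zero[OF Nm Xm] by (auto simp: yoneda_image_def)
    fix a assume "a \<in> yoneda_image N n X"
    then obtain f where f: "f \<in> mod_hom R N X" "a = Fmap M N X f n"
      by (auto simp: yoneda_image_def)
    show "inv\<^bsub>Fob M X\<^esub> a \<in> yoneda_image N n X"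
      unfolding f(2) Fmap_minus[OF N X f(1) n, symmetric] yoneda_image_def
      by (rule imageI[OF mod_hom_minus[OF f(1) Nm Xm]])
    fix b assume "b \<in> yoneda_image N n X"
    then obtain g where g: "g \<in> mod_hom R N X" "b = Fmap M N X g n"
      by (auto simp: yoneda_image_def)
    show "a \<otimes>\<^bsub>Fob M X\<^esub> b \<in> yoneda_image N n X"
      unfolding f(2) g(2) Fmap_add[OF N X f(1) g(1) n, symmetric] yoneda_image_def
      by (rule imageI[OF mod_hom_add[OF f(1) g(1) Nm Xm]])
  qed
next
  fix X Y f assume X: "X \<in> LMod R" and Y: "Y \<in> LMod R" and f: "f \<in> mod_hom R X Y"
  show "Fmap M X Y f ` yoneda_image N n X \<subseteq> yoneda_image N n Y"
  proof (clarsimp simp: yoneda_image_def)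
    fix h assume h: "h \<in> mod_hom R N X"
    show "Fmap M X Y f (Fmap M N X h n) \<in> (\<lambda>f. Fmap M N Y f n) ` mod_hom R N Y"
      unfolding Fmap_comp[OF N X Y h f n, symmetric]
      by (rule imageI[OF mod_hom_compose[OF h f LModD[OF N]]])
  qed
qed

lemma yoneda_submodule_scheme:
  assumes "faithful_element N n"
  shows "submodule_scheme R M (yoneda_image N n) N (yoneda N n)"
proof -
  have N: "N \<in> LMod R" and n: "n \<in> carrier (Fob M N)"
    and inj: "\<And>X. X \<in> LMod R \<Longrightarrow> inj_on (\<lambda>f. Fmap M N X f n) (mod_hom R N X)"
    using assms by (auto simp: faithful_element_def)
  have hom: "yoneda N n X \<in> hom (Fob (module_scheme R N) X) (Fob (restrict_functor M (yoneda_image N n)) X)"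
    if X: "X \<in> LMod R" for X
    using Fmap_add[OF N X _ _ n] mod_hom_add[OF _ _ LModD[OF N] LModD[OF X]]
    by (auto simp: hom_def yoneda_def X module_scheme_def restrict_functor_def yoneda_image_def)
  have nat: "yoneda N n Y (Fmap (module_scheme R N) X Y f m) = Fmap (restrict_functor M (yoneda_image N n)) X Y f (yoneda N n X m)"
    if "X \<in> LMod R" "Y \<in> LMod R" "f \<in> mod_hom R X Y" "m \<in> carrier (Fob (module_scheme R N) X)" for X Y f m
    using that Fmap_comp[OF N that(1,2) _ that(3) n] mod_hom_compose[OF _ that(3) LModD[OF N]]
    by (simp add: module_scheme_def restrict_functor_def yoneda_def)
  have bij: "bij_betw (yoneda N n X) (carrier (Fob (module_scheme R N) X)) (carrier (Fob (restrict_functor M (yoneda_image N n)) X))"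
    if X: "X \<in> LMod R" for X
    using inj[OF X] by (auto simp: bij_betw_def yoneda_def X module_scheme_def restrict_functor_def yoneda_image_def inj_on_def)
  have "yoneda N n \<in> nat_hom R (module_scheme R N) (restrict_functor M (yoneda_image N n))"
    using hom nat by (auto simp: nat_hom_def yoneda_def module_scheme_def)
  then show ?thesis
    using bij N yoneda_submodule_functor[OF N n] by (simp add: submodule_scheme_def nat_iso_def)
qed

lemma yoneda_id:
  assumes "N \<in> LMod R" "n \<in> carrier (Fob M N)"
  shows "yoneda N n N (\<lambda>x\<in>carrier N. x) = n"
  using assms Fmap_id[OF assms] mod_hom_id[OF LModD[OF assms(1)]] by (simp add: yoneda_def)

text \<open>
  The Yoneda lemma: \<open>\<theta>\<close> is determined by its value at the identity of \<open>N\<close>.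
\<close>

lemma submodule_schemeD:
  assumes sub: "submodule_scheme R M S N \<theta>"
  defines "n \<equiv> \<theta> N (\<lambda>x\<in>carrier N. x)"
  shows "faithful_element N n" and "\<And>X. X \<in> LMod R \<Longrightarrow> S X = yoneda_image N n X"
    and "\<And>X f. \<lbrakk>X \<in> LMod R; f \<in> mod_hom R N X\<rbrakk> \<Longrightarrow> \<theta> X f = Fmap M N X f n"
proof -
  have N: "N \<in> LMod R" and closed: "submodule_functor R M S"
    and iso: "\<theta> \<in> nat_iso R (module_scheme R N) (restrict_functor M S)"
    using sub by (auto simp: submodule_scheme_def)
  have bij: "bij_betw (\<theta> X) (mod_hom R N X) (S X)" if "X \<in> LMod R" for X
    using iso that by (simp add: nat_iso_def module_scheme_def restrict_functor_def)
  have "\<forall>X\<in>LMod R. \<forall>Y\<in>LMod R. \<forall>f\<in>mod_hom R X Y. \<forall>h\<in>mod_hom R N X.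
      \<theta> Y (compose (carrier N) f h) = Fmap M X Y f (\<theta> X h)"
    using iso by (simp add: nat_iso_def nat_hom_def module_scheme_def restrict_functor_def)
  then have nat: "\<theta> Y (compose (carrier N) f h) = Fmap M X Y f (\<theta> X h)"
    if "X \<in> LMod R" "Y \<in> LMod R" "f \<in> mod_hom R X Y" "h \<in> mod_hom R N X" for X Y f h
    using that by blast
  have id: "(\<lambda>x\<in>carrier N. x) \<in> mod_hom R N N"
    by (rule mod_hom_id[OF LModD[OF N]])
  have "n \<in> S N"
    using bij[OF N] id by (auto simp: n_def bij_betw_def)
  moreover have "S N \<subseteq> carrier (Fob M N)"
    using closed N by (auto simp: submodule_functor_def subgroup_def)
  ultimately have n: "n \<in> carrier (Fob M N)"
    by blast
  show eq: "\<theta> X f = Fmap M N X f n" if "X \<in> LMod R" "f \<in> mod_hom R N X" for X f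
  proof -
    have "compose (carrier N) f (\<lambda>x\<in>carrier N. x) = f"
      using mod_homD(4)[OF that(2)] by (intro extensionalityI[of _ "carrier N"]) (auto simp: compose_eq)
    then show ?thesis
      using nat[OF N that id] by (simp add: n_def)
  qed
  show "S X = yoneda_image N n X" if "X \<in> LMod R" for X
    using bij_betw_imp_surj_on[OF bij[OF that]] eq[OF that] by (simp add: yoneda_image_def cong: image_cong)
  have "inj_on (\<lambda>f. Fmap M N X f n) (mod_hom R N X)" if "X \<in> LMod R" for X
  proof (rule inj_onI)
    fix f g assume "f \<in> mod_hom R N X" "g \<in> mod_hom R N X" "Fmap M N X f n = Fmap M N X g n"
    then show "f = g"
      using inj_onD[OF bij_betw_imp_inj_on[OF bij[OF that]]] eq[OF that] by simp
  qed
  then show "faithful_element N n"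
    using N n by (simp add: faithful_element_def)
qed

text \<open>
  With \<open>n = \<theta>(id)\<close>, the transpose of \<open>w\<close> sends \<open>f\<close> to \<open>w\<^sub>X(f\<^sub>* n) = (Y \<otimes> f)(w\<^sub>N(n))\<close>, so it is the
  image of \<open>w\<^sub>N(n)\<close> under \<open>bidual_map\<close>. The latter is injective because \<open>t\<close> is recovered as the value of
  its image at the identity of \<open>N\<close>.
\<close>

lemma dual_morphism_eval:
  assumes sub: "submodule_scheme R M S N \<theta>" and Y: "Y \<in> RMod R" and w: "w \<in> dual R M Y"
  shows "dual_morphism R N \<theta> Y w = w N (\<theta> N (\<lambda>x\<in>carrier N. x))"
proof -
  define n where "n = \<theta> N (\<lambda>x\<in>carrier N. x)"
  have N: "N \<in> LMod R" and n: "n \<in> carrier (Fob M N)"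
    using submodule_schemeD(1)[OF sub] by (auto simp: faithful_element_def n_def)
  have Ym: "right_module R Y"
    using Y by (simp add: RMod_def)
  have id: "(\<lambda>x\<in>carrier N. x) \<in> mod_hom R N N"
    by (rule mod_hom_id[OF LModD[OF N]])
  have inj: "inj_on (bidual_map R N Y) (carrier (tensor R Y N))"
  proof (rule inj_onI)
    fix s t assume s: "s \<in> carrier (tensor R Y N)" and t: "t \<in> carrier (tensor R Y N)"
      and eq: "bidual_map R N Y s = bidual_map R N Y t"
    have at_id: "bidual_map R N Y u N (\<lambda>x\<in>carrier N. x) = u" if "u \<in> carrier (tensor R Y N)" for u
      unfolding bidual_map_def restrict_apply'[OF N] restrict_apply'[OF id]
      by (rule tensor_map_id[OF Ym LModD[OF N] that])
    have "s = bidual_map R N Y s N (\<lambda>x\<in>carrier N. x)"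
      by (rule at_id[OF s, symmetric])
    also have "\<dots> = t"
      unfolding eq by (rule at_id[OF t])
    finally show "s = t" .
  qed
  have "transpose R (module_scheme R N) \<theta> w = bidual_map R N Y (w N n)"
    unfolding transpose_def bidual_map_def compose_def
  proof (rule restrict_ext)
    fix X assume X: "X \<in> LMod R"
    have "carrier (Fob (module_scheme R N) X) = mod_hom R N X"
      by (simp add: module_scheme_def)
    moreover have "w X (\<theta> X f) = tensor_map R Y N X f (w N n)" if f: "f \<in> mod_hom R N X" for f
      unfolding submodule_schemeD(3)[OF sub X f] n_def[symmetric] by (rule dualD(3)[OF w N X f n])
    ultimately show "(\<lambda>f\<in>carrier (Fob (module_scheme R N) X). w X (\<theta> X f)) =
        (\<lambda>f\<in>mod_hom R N X. tensor_map R Y N X f (w N n))"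
      by (simp cong: restrict_cong)
  qed
  then have "dual_morphism R N \<theta> Y w = w N n"
    unfolding dual_morphism_def using the_inv_into_f_f[OF inj dual_closed[OF w N n]] by (simp only:)
  then show ?thesis
    by (simp only: n_def)
qed

text \<open>
  Surjectivity at \<open>Y = R\<close> says that \<open>n = \<theta>(id)\<close> is a dual generator. Conversely, for a dual generator all
  pure tensors \<open>y \<otimes> x\<close> are values of elements of the dual by \<open>dual_pure\<close>, and the values are closed
  under subtraction.
\<close>

lemma dual_morphism_epi_iff:
  assumes sub: "submodule_scheme R M S N \<theta>"
  shows "dual_morphism_epi R M N \<theta> \<longleftrightarrow> dual_generator N (\<theta> N (\<lambda>x\<in>carrier N. x))"
proof -
  define n where "n = \<theta> N (\<lambda>x\<in>carrier N. x)"
  have N: "N \<in> LMod R" and n: "n \<in> carrier (Fob M N)"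
    using submodule_schemeD(1)[OF sub] by (auto simp: faithful_element_def n_def)
  have epi: "dual_morphism_epi R M N \<theta> \<longleftrightarrow> (\<forall>Y\<in>RMod R. (\<lambda>w. w N n) ` dual R M Y = carrier (tensor R Y N))"
    unfolding dual_morphism_epi_def using dual_morphism_eval[OF sub] by (simp add: n_def cong: image_cong)
  show ?thesis
    unfolding epi n_def[symmetric]
  proof
    assume surj: "\<forall>Y\<in>RMod R. (\<lambda>w. w N n) ` dual R M Y = carrier (tensor R Y N)"
    have "x \<in> val N n ` D" if x: "x \<in> carrier N" for x
    proof -
      have pair: "tensor_pair R (regular_right R) N"
        using LModD[OF N] regular_right_module[OF R.ring_axioms] by (simp add: tensor_pair_def)
      have "pure_tensor R (regular_right R) N \<one>\<^bsub>R\<^esub> x \<in> carrier (tensor R (regular_right R) N)"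
        using x by (intro tensor_pair.pure_tensor_closed[OF pair]) (auto simp: regular_right_def)
      then have "pure_tensor R (regular_right R) N \<one>\<^bsub>R\<^esub> x \<in> (\<lambda>w. w N n) ` D"
        using surj regular_right_in_RMod by simp
      then obtain w where w: "w \<in> D" "w N n = pure_tensor R (regular_right R) N \<one>\<^bsub>R\<^esub> x"
        by auto
      then have "val N n w = x"
        using tensor_unit_pure_one[OF R.ring_axioms LModD[OF N] x] by (simp add: val_eq)
      then show ?thesis
        using w by blast
    qed
    then show "dual_generator N n"
      using N n val_closed[OF N n] by (auto simp: dual_generator_def)
  next
    assume gen: "dual_generator N n"
    show "\<forall>Y\<in>RMod R. (\<lambda>w. w N n) ` dual R M Y = carrier (tensor R Y N)"
    proof
      fix Y assume Y: "Y \<in> RMod R"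
      interpret P: tensor_pair R Y N
        using Y LModD[OF N] by (simp add: RMod_def tensor_pair_def)
      have "t \<in> (\<lambda>w. w N n) ` dual R M Y" if "t \<in> carrier (tensor R Y N)" for t
        using that
      proof (induction rule: P.tensor_induct)
        case (pure_tensor y x)
        have "x \<in> val N n ` D"
          using gen pure_tensor(2) by (simp add: dual_generator_def)
        then obtain w where w: "w \<in> D" "val N n w = x"
          by blast
        show ?case
          by (rule image_eqI[OF _ dual_pure[OF Y pure_tensor(1) w(1)]]) (simp add: N n w)
      next
        case (diff s t)
        then obtain v w where vw: "v \<in> dual R M Y" "w \<in> dual R M Y" "s = v N n" "t = w N n"
          by blast
        show ?case
          by (rule image_eqI[OF _ dual_diff[OF Y vw(1,2)]]) (simp add: N n vw)
      qed
      then show "(\<lambda>w. w N n) ` dual R M Y = carrier (tensor R Y N)"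
        using dual_closed[OF _ N n] by blast
    qed
  qed
qed

section \<open>Left exactness and the strict Mittag-Leffler condition\<close>

lemma Fmap_one:
  "\<lbrakk>X \<in> LMod R; Y \<in> LMod R; f \<in> mod_hom R X Y\<rbrakk> \<Longrightarrow> Fmap M X Y f \<one>\<^bsub>Fob M X\<^esub> = \<one>\<^bsub>Fob M Y\<^esub>"
  using Fmap_group_hom by (rule group_hom.hom_one)

lemma left_exact_lift:
  assumes le: "left_exact R M" and X: "X \<in> LMod R" and C: "C \<in> LMod R" and g: "g \<in> mod_hom R X C"
    and m: "m \<in> carrier (Fob M X)" and gm: "Fmap M X C g m = \<one>\<^bsub>Fob M C\<^esub>"
  defines "N \<equiv> a_kernel X C g"
  shows "\<exists>n\<in>carrier (Fob M (X\<lparr>carrier := N\<rparr>)). Fmap M (X\<lparr>carrier := N\<rparr>) X (\<lambda>x\<in>N. x) n = m"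
proof -
  let ?N = "X\<lparr>carrier := N\<rparr>"
  let ?i = "\<lambda>x\<in>N. x"
  have sub: "left_submodule R X N"
    unfolding N_def by (rule left_submodule_kernel[OF g LModD[OF X] LModD[OF C]])
  have N: "?N \<in> LMod R" and i: "?i \<in> mod_hom R ?N X"
    by (rule left_submodule_LMod[OF X sub], rule left_submodule_inclusion[OF X sub])
  have "inj_on ?i (carrier ?N) \<and> ?i ` carrier ?N = a_kernel X C g"
    by (auto simp: N_def inj_on_def)
  then have "Fmap M ?N X ?i ` carrier (Fob M ?N) = kernel (Fob M X) (Fob M C) (Fmap M X C g)"
    using le[unfolded left_exact_def, rule_format, OF N X C i g] by simp
  moreover have "m \<in> kernel (Fob M X) (Fob M C) (Fmap M X C g)"
    using m gm by (simp add: kernel_def)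
  ultimately have "m \<in> Fmap M ?N X ?i ` carrier (Fob M ?N)"
    by (simp only:)
  then show ?thesis
    by blast
qed

lemma strict_mittag_lefflerD:
  assumes "strict_mittag_leffler R M" "X \<in> LMod R" "m \<in> carrier (Fob M X)" "m' \<in> carrier (Fob M X)"
    and "val X m = val X m'"
  shows "m = m'"
proof -
  have "inj_on (val X) (carrier (Fob M X))"
    using assms(1,2) by (simp add: strict_mittag_leffler_def)
  then show ?thesis
    using assms(3-5) by (simp add: inj_on_def)
qed

lemma strict_mittag_leffler_iff:
  "strict_mittag_leffler R M \<longleftrightarrow>
     (\<forall>X\<in>LMod R. \<forall>m\<in>carrier (Fob M X). (\<forall>w\<in>D. val X m w = \<zero>\<^bsub>X\<^esub>) \<longrightarrow> m = \<one>\<^bsub>Fob M X\<^esub>)"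
    (is "_ \<longleftrightarrow> ?triv")
proof
  assume sml: "strict_mittag_leffler R M"
  show ?triv
  proof (intro ballI impI)
    fix X m assume X: "X \<in> LMod R" and m: "m \<in> carrier (Fob M X)" and zero: "\<forall>w\<in>D. val X m w = \<zero>\<^bsub>X\<^esub>"
    interpret FX: group "Fob M X" by (rule Fob_is_group[OF X])
    have "val X m = val X \<one>\<^bsub>Fob M X\<^esub>"
    proof (rule extensionalityI[of _ D])
      show "val X m w = val X \<one>\<^bsub>Fob M X\<^esub> w" if "w \<in> D" for w
        using that zero val_one[OF X] by simp
    qed (simp_all add: eval_map_def)
    then show "m = \<one>\<^bsub>Fob M X\<^esub>"
      by (rule strict_mittag_lefflerD[OF sml X m FX.one_closed])
  qed
next
  assume triv: ?triv
  have "m = m'" if X: "X \<in> LMod R" and m: "m \<in> carrier (Fob M X)" and m': "m' \<in> carrier (Fob M X)"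
    and eq: "val X m = val X m'" for X m m'
  proof -
    interpret FX: comm_group "Fob M X" by (rule Fob_group[OF X])
    interpret X: left_module R X by (rule LModD[OF X])
    have "val X (m \<otimes>\<^bsub>Fob M X\<^esub> inv\<^bsub>Fob M X\<^esub> m') w = \<zero>\<^bsub>X\<^esub>" if w: "w \<in> D" for w
    proof -
      have "val X (m \<otimes>\<^bsub>Fob M X\<^esub> inv\<^bsub>Fob M X\<^esub> m') w = val X (m' \<otimes>\<^bsub>Fob M X\<^esub> inv\<^bsub>Fob M X\<^esub> m') w"
        using m m' eq by (simp only: val_mult[OF X _ _ w] FX.inv_closed)
      then show ?thesis
        using m' val_one[OF X w] by simp
    qed
    then have "m \<otimes>\<^bsub>Fob M X\<^esub> inv\<^bsub>Fob M X\<^esub> m' = \<one>\<^bsub>Fob M X\<^esub>"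
      using triv X m m' by simp
    then show ?thesis
      using m m' FX.inv_equality[of m "inv\<^bsub>Fob M X\<^esub> m'"] by simp
  qed
  then show "strict_mittag_leffler R M"
    by (auto simp: strict_mittag_leffler_def inj_on_def)
qed

lemma strict_mittag_leffler_vanish:
  assumes sml: "strict_mittag_leffler R M" and X: "X \<in> LMod R" and m: "m \<in> carrier (Fob M X)"
    and C: "C \<in> LMod R" and g: "g \<in> mod_hom R X C" and sub: "val X m ` D \<subseteq> a_kernel X C g"
  shows "Fmap M X C g m = \<one>\<^bsub>Fob M C\<^esub>"
proof -
  have "val C (Fmap M X C g m) w = \<zero>\<^bsub>C\<^esub>" if w: "w \<in> D" for w
  proof -
    have "val X m w \<in> a_kernel X C g"
      using sub w by blast
    then show ?thesis
      using val_Fmap[OF X C g m w] by (simp add: a_kernel_iff)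
  qed
  then show ?thesis
    using sml[unfolded strict_mittag_leffler_iff] C Fmap_closed[OF X C g m] by blast
qed

text \<open>
  The map from \<open>N\<close> to its quotient by the image of \<open>val N n\<close> kills \<open>n\<close> by the strict Mittag-Leffler
  property, so it is zero by faithfulness.
\<close>

lemma faithful_element_dual_generator:
  assumes sml: "strict_mittag_leffler R M" and n: "faithful_element N n"
  shows "dual_generator N n"
proof -
  have N: "N \<in> LMod R" and nN: "n \<in> carrier (Fob M N)"
    using n by (auto simp: faithful_element_def)
  obtain C g where C: "C \<in> LMod R" and g: "g \<in> mod_hom R N C" and ker: "a_kernel N C g = val N n ` D"
    using quotient_exists[OF N val_range_submodule[OF N nN]] by blast
  have "Fmap M N C g n = \<one>\<^bsub>Fob M C\<^esub>"
    using strict_mittag_leffler_vanish[OF sml N nN C g] ker by blast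
  then have "g = (\<lambda>x\<in>carrier N. \<zero>\<^bsub>C\<^esub>)"
    by (rule faithful_element_eq_zero[OF n C g])
  then have "a_kernel N C g = carrier N"
    by (auto simp: a_kernel_iff)
  then show ?thesis
    using ker N nN by (simp add: dual_generator_def)
qed

text \<open>
  \<open>N\<close> is the image of \<open>val X m\<close>: the strict Mittag-Leffler property makes \<open>m\<close> vanish in the quotient by
  \<open>N\<close>, and left exactness lifts \<open>m\<close> to \<open>N\<close>.
\<close>

lemma exists_dual_generator:
  assumes le: "left_exact R M" and sml: "strict_mittag_leffler R M"
    and X: "X \<in> LMod R" and m: "m \<in> carrier (Fob M X)"
  shows "\<exists>N n f. dual_generator N n \<and> f \<in> mod_hom R N X \<and> Fmap M N X f n = m"
proof -
  obtain C g where C: "C \<in> LMod R" and g: "g \<in> mod_hom R X C" and ker: "a_kernel X C g = val X m ` D"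
    using quotient_exists[OF X val_range_submodule[OF X m]] by blast
  have gm: "Fmap M X C g m = \<one>\<^bsub>Fob M C\<^esub>"
    using strict_mittag_leffler_vanish[OF sml X m C g] ker by blast
  define N where "N = X\<lparr>carrier := val X m ` D\<rparr>"
  define i where "i = (\<lambda>x\<in>val X m ` D. x)"
  have N: "N \<in> LMod R" and i: "i \<in> mod_hom R N X"
    unfolding N_def i_def
    by (rule left_submodule_LMod[OF X val_range_submodule[OF X m]],
        rule left_submodule_inclusion[OF X val_range_submodule[OF X m]])
  obtain n where n: "n \<in> carrier (Fob M N)" and i_n: "Fmap M N X i n = m"
    using left_exact_lift[OF le X C g m gm] unfolding ker N_def i_def by blast
  have carrierN: "carrier N = val X m ` D"
    by (simp add: N_def)
  have val_n: "val N n w = val X m w" if w: "w \<in> D" for w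
  proof -
    have "val X m w = i (val N n w)"
      using val_Fmap[OF N X i n w] i_n by simp
    then show ?thesis
      using val_closed[OF N n w] unfolding carrierN i_def by simp
  qed
  have "val N n ` D = val X m ` D"
    by (rule image_cong[OF refl val_n])
  then have "dual_generator N n"
    using N n by (simp add: dual_generator_def carrierN)
  then show ?thesis
    using i i_n by blast
qed

section \<open>Directed unions of submodule schemes\<close>

definition dual_kernel :: "'u mdl \<Rightarrow> 'v \<Rightarrow> ('u mdl \<Rightarrow> 'v \<Rightarrow> 'u tensor_elt) set" where
  "dual_kernel N n = {w \<in> D. val N n w = \<zero>\<^bsub>N\<^esub>}"

text \<open>
  The map \<open>val N n w \<mapsto> val N' n' w\<close> is well defined by the inclusion of kernels and linear. It sends \<open>n\<close>
  to an element that induces the same map on \<open>D\<close> as \<open>n'\<close>, hence to \<open>n'\<close>.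
\<close>

lemma dual_generator_factor:
  assumes sml: "strict_mittag_leffler R M" and gen: "dual_generator N n"
    and N': "N' \<in> LMod R" and n': "n' \<in> carrier (Fob M N')"
    and ker: "dual_kernel N n \<subseteq> dual_kernel N' n'"
  shows "\<exists>f\<in>mod_hom R N N'. Fmap M N N' f n = n'"
proof -
  have N: "N \<in> LMod R" and n: "n \<in> carrier (Fob M N)" and surj: "val N n ` D = carrier N"
    using gen by (auto simp: dual_generator_def)
  interpret N: left_module R N by (rule LModD[OF N])
  interpret N': left_module R N' by (rule LModD[OF N'])
  have well_def: "val N' n' v = val N' n' w" if v: "v \<in> D" and w: "w \<in> D" and eq: "val N n v = val N n w" for v w
  proof -
    obtain u where u: "u \<in> D" "\<forall>X\<in>LMod R. \<forall>m\<in>carrier (Fob M X). val X m u = val X m v \<ominus>\<^bsub>X\<^esub> val X m w"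
      using exists_dual_diff[OF v w] by blast
    then have "u \<in> dual_kernel N n"
      using N n eq val_closed[OF N n w] by (simp add: dual_kernel_def a_minus_def N.M.r_neg)
    then have "val N' n' v \<ominus>\<^bsub>N'\<^esub> val N' n' w = \<zero>\<^bsub>N'\<^esub>"
      using ker u N' n' by (auto simp: dual_kernel_def)
    then show ?thesis
      using val_closed[OF N' n' v] val_closed[OF N' n' w]
        N'.M.minus_equality[of "val N' n' v" "\<ominus>\<^bsub>N'\<^esub> val N' n' w"] by (simp add: a_minus_def)
  qed
  \<comment> \<open>By well_def the choice of the preimage w of x does not matter.\<close>
  define f where "f x = val N' n' (SOME w. w \<in> D \<and> val N n w = x)" for x
  have f_val: "f (val N n w) = val N' n' w" if w: "w \<in> D" for w
  proof -
    have "(SOME v. v \<in> D \<and> val N n v = val N n w) \<in> D \<and> val N n (SOME v. v \<in> D \<and> val N n v = val N n w) = val N n w"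
      by (rule someI[of "\<lambda>v. v \<in> D \<and> val N n v = val N n w" w]) (simp add: w)
    then show ?thesis
      unfolding f_def using well_def w by blast
  qed
  have surjE: "\<exists>w\<in>D. x = val N n w" if "x \<in> carrier N" for x
    using that surj by blast
  have f: "(\<lambda>x\<in>carrier N. f x) \<in> mod_hom R N N'"
  proof (rule mod_homI[OF _ _ _ N.left_module_axioms])
    fix x assume "x \<in> carrier N"
    then obtain w where "w \<in> D" "x = val N n w"
      using surjE by blast
    then show "f x \<in> carrier N'"
      by (simp add: f_val val_closed[OF N' n'])
  next
    fix x y assume "x \<in> carrier N" "y \<in> carrier N"
    then obtain v w where vw: "v \<in> D" "x = val N n v" "w \<in> D" "y = val N n w"
      using surjE by blast
    then obtain u where u: "u \<in> D" "\<forall>X\<in>LMod R. \<forall>m\<in>carrier (Fob M X). val X m u = val X m v \<oplus>\<^bsub>X\<^esub> val X m w"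
      using exists_dual_add by blast
    have "x \<oplus>\<^bsub>N\<^esub> y = val N n u"
      using u N n vw by simp
    moreover have "val N' n' u = val N' n' v \<oplus>\<^bsub>N'\<^esub> val N' n' w"
      using u N' n' by simp
    ultimately show "f (x \<oplus>\<^bsub>N\<^esub> y) = f x \<oplus>\<^bsub>N'\<^esub> f y"
      by (simp add: f_val u(1) vw)
  next
    fix a x assume a: "a \<in> carrier R" and "x \<in> carrier N"
    then obtain w where w: "w \<in> D" "x = val N n w"
      using surjE by blast
    then obtain u where u: "u \<in> D" "\<forall>X\<in>LMod R. \<forall>m\<in>carrier (Fob M X). val X m u = a \<odot>\<^bsub>X\<^esub> val X m w"
      using exists_dual_smult a by blast
    have "a \<odot>\<^bsub>N\<^esub> x = val N n u"
      using u N n w by simp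
    moreover have "val N' n' u = a \<odot>\<^bsub>N'\<^esub> val N' n' w"
      using u N' n' by simp
    ultimately show "f (a \<odot>\<^bsub>N\<^esub> x) = a \<odot>\<^bsub>N'\<^esub> f x"
      by (simp add: f_val u(1) w)
  qed
  have "val N' (Fmap M N N' (\<lambda>x\<in>carrier N. f x) n) = val N' n'"
  proof (rule extensionalityI[of _ D])
    show "val N' (Fmap M N N' (\<lambda>x\<in>carrier N. f x) n) w = val N' n' w" if w: "w \<in> D" for w
      unfolding val_Fmap[OF N N' f n w] using val_closed[OF N n w] by (simp add: f_val w)
  qed (simp_all add: eval_map_def)
  then have "Fmap M N N' (\<lambda>x\<in>carrier N. f x) n = n'"
    by (rule strict_mittag_lefflerD[OF sml N' Fmap_closed[OF N N' f n] n'])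
  then show ?thesis
    using f by blast
qed

lemma yoneda_image_mono:
  assumes N: "N \<in> LMod R" and n: "n \<in> carrier (Fob M N)" and N': "N' \<in> LMod R" and X: "X \<in> LMod R"
    and f: "f \<in> mod_hom R N N'" and eq: "Fmap M N N' f n = n'"
  shows "yoneda_image N' n' X \<subseteq> yoneda_image N n X"
proof
  fix m assume "m \<in> yoneda_image N' n' X"
  then obtain h where h: "h \<in> mod_hom R N' X" "m = Fmap M N' X h n'"
    by (auto simp: yoneda_image_def)
  have "m = Fmap M N X (compose (carrier N) h f) n"
    unfolding h(2) eq[symmetric] by (rule Fmap_comp[OF N N' X f h(1) n, symmetric])
  then show "m \<in> yoneda_image N n X"
    unfolding yoneda_image_def using mod_hom_compose[OF f h(1) LModD[OF N]] by (rule image_eqI)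
qed

text \<open>
  The dual generator belongs to the element \<open>p\<close> of \<open>M(N1 \<times> N2)\<close> with components \<open>n1\<close> and \<open>n2\<close>, which is
  built with the coordinate inclusions \<open>j1\<close> and \<open>j2\<close>.
\<close>

lemma dual_generator_directed:
  assumes le: "left_exact R M" and sml: "strict_mittag_leffler R M"
    and gen1: "dual_generator N1 n1" and gen2: "dual_generator N2 n2"
  shows "\<exists>N n f1 f2. dual_generator N n \<and> f1 \<in> mod_hom R N N1 \<and> Fmap M N N1 f1 n = n1 \<and>
    f2 \<in> mod_hom R N N2 \<and> Fmap M N N2 f2 n = n2"
proof -
  have N: "N1 \<in> LMod R" "N2 \<in> LMod R" and n: "n1 \<in> carrier (Fob M N1)" "n2 \<in> carrier (Fob M N2)"
    using gen1 gen2 by (auto simp: dual_generator_def)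
  define a :: 'u where "a = undefined"
  obtain b :: 'u where ab: "b \<noteq> a"
    using ex_new_if_finite[OF infinite_universe, of "{a}"] by auto
  define I where "I = {a, b}"
  define F where "F = (\<lambda>i. if i = a then N1 else N2)"
  have F: "F a = N1" "F b = N2" and I: "a \<in> I" "b \<in> I"
    using ab by (simp_all add: F_def I_def)
  have FI: "F i \<in> LMod R" for i
    using N by (simp add: F_def)
  have "I \<prec> (UNIV :: 'u set)"
    by (simp add: I_def finite_lesspoll_infinite infinite_universe)
  then obtain P \<pi> where P: "is_product R I F P \<pi>"
    using product_exists[OF R.ring_axioms, of I F] FI by blast
  have PL: "P \<in> LMod R"
    using P by (simp add: is_product_def)
  have \<pi>1: "\<pi> a \<in> mod_hom R P N1" and \<pi>2: "\<pi> b \<in> mod_hom R P N2"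
    using P F I by (auto simp: is_product_def)
  note m = LModD[OF N(1)] LModD[OF N(2)]
  define t1 where "t1 = (\<lambda>i. if i = a then (\<lambda>x\<in>carrier N1. x) else (\<lambda>x\<in>carrier N1. \<zero>\<^bsub>N2\<^esub>))"
  define t2 where "t2 = (\<lambda>i. if i = a then (\<lambda>x\<in>carrier N2. \<zero>\<^bsub>N1\<^esub>) else (\<lambda>x\<in>carrier N2. x))"
  have t1: "t1 i \<in> mod_hom R N1 (F i)" and t2: "t2 i \<in> mod_hom R N2 (F i)" for i
    using mod_hom_id[OF m(1)] mod_hom_const_zero[OF m] mod_hom_id[OF m(2)] mod_hom_const_zero[OF m(2) m(1)]
    by (simp_all only: t1_def t2_def F_def split: if_split) simp_all
  obtain j1 where j1: "j1 \<in> mod_hom R N1 P" and \<pi>j1: "\<And>i x. \<lbrakk>i \<in> I; x \<in> carrier N1\<rbrakk> \<Longrightarrow> \<pi> i (j1 x) = t1 i x"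
    by (rule product_lift[OF P m(1) t1]) blast
  obtain j2 where j2: "j2 \<in> mod_hom R N2 P" and \<pi>j2: "\<And>i x. \<lbrakk>i \<in> I; x \<in> carrier N2\<rbrakk> \<Longrightarrow> \<pi> i (j2 x) = t2 i x"
    by (rule product_lift[OF P m(2) t2]) blast
  define p where "p = Fmap M N1 P j1 n1 \<otimes>\<^bsub>Fob M P\<^esub> Fmap M N2 P j2 n2"
  interpret FP: comm_group "Fob M P" by (rule Fob_group[OF PL])
  interpret F1: comm_group "Fob M N1" by (rule Fob_group[OF N(1)])
  interpret F2: comm_group "Fob M N2" by (rule Fob_group[OF N(2)])
  note closed = Fmap_closed[OF N(1) PL j1 n(1)] Fmap_closed[OF N(2) PL j2 n(2)]
  have p: "p \<in> carrier (Fob M P)"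
    unfolding p_def by (rule FP.m_closed[OF closed])
  have c11: "compose (carrier N1) (\<pi> a) j1 = (\<lambda>x\<in>carrier N1. x)"
    and c12: "compose (carrier N2) (\<pi> a) j2 = (\<lambda>x\<in>carrier N2. \<zero>\<^bsub>N1\<^esub>)"
    and c21: "compose (carrier N1) (\<pi> b) j1 = (\<lambda>x\<in>carrier N1. \<zero>\<^bsub>N2\<^esub>)"
    and c22: "compose (carrier N2) (\<pi> b) j2 = (\<lambda>x\<in>carrier N2. x)"
    unfolding compose_def by (rule restrict_ext, simp add: \<pi>j1 \<pi>j2 I ab t1_def t2_def)+
  have "Fmap M P N1 (\<pi> a) p = Fmap M P N1 (\<pi> a) (Fmap M N1 P j1 n1) \<otimes>\<^bsub>Fob M N1\<^esub> Fmap M P N1 (\<pi> a) (Fmap M N2 P j2 n2)"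
    unfolding p_def by (rule hom_mult[OF Fmap_hom[OF PL N(1) \<pi>1] closed])
  also have "\<dots> = n1 \<otimes>\<^bsub>Fob M N1\<^esub> \<one>\<^bsub>Fob M N1\<^esub>"
    unfolding Fmap_comp[OF N(1) PL N(1) j1 \<pi>1 n(1), symmetric] Fmap_comp[OF N(2) PL N(1) j2 \<pi>1 n(2), symmetric] c11 c12
      Fmap_id[OF N(1) n(1)] Fmap_const_zero[OF N(2) N(1) n(2)] ..
  finally have p1: "Fmap M P N1 (\<pi> a) p = n1"
    using n by simp
  have "Fmap M P N2 (\<pi> b) p = Fmap M P N2 (\<pi> b) (Fmap M N1 P j1 n1) \<otimes>\<^bsub>Fob M N2\<^esub> Fmap M P N2 (\<pi> b) (Fmap M N2 P j2 n2)"
    unfolding p_def by (rule hom_mult[OF Fmap_hom[OF PL N(2) \<pi>2] closed])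
  also have "\<dots> = \<one>\<^bsub>Fob M N2\<^esub> \<otimes>\<^bsub>Fob M N2\<^esub> n2"
    unfolding Fmap_comp[OF N(1) PL N(2) j1 \<pi>2 n(1), symmetric] Fmap_comp[OF N(2) PL N(2) j2 \<pi>2 n(2), symmetric] c21 c22
      Fmap_id[OF N(2) n(2)] Fmap_const_zero[OF N(1) N(2) n(1)] ..
  finally have p2: "Fmap M P N2 (\<pi> b) p = n2"
    using n by simp
  obtain K k f where gen: "dual_generator K k" and f: "f \<in> mod_hom R K P" and fk: "Fmap M K P f k = p"
    using exists_dual_generator[OF le sml PL p] by blast
  have K: "K \<in> LMod R" and k: "k \<in> carrier (Fob M K)"
    using gen by (auto simp: dual_generator_def)
  have "Fmap M K N1 (compose (carrier K) (\<pi> a) f) k = n1" "Fmap M K N2 (compose (carrier K) (\<pi> b) f) k = n2"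
    using Fmap_comp[OF K PL N(1) f \<pi>1 k] Fmap_comp[OF K PL N(2) f \<pi>2 k] fk p1 p2 by simp_all
  then show ?thesis
    using gen mod_hom_compose[OF f \<pi>1 LModD[OF K]] mod_hom_compose[OF f \<pi>2 LModD[OF K]] by blast
qed

lemma dual_generator_exists: "\<exists>N n. dual_generator N n"
proof -
  have "({} :: 'u set) \<prec> (UNIV :: 'u set)"
    by (simp add: finite_lesspoll_infinite infinite_universe)
  then obtain P \<pi> where P: "is_product R {} (\<lambda>_. undefined) P \<pi>"
    using product_exists[OF R.ring_axioms, of "{}" "\<lambda>_. undefined"] by auto
  have PL: "P \<in> LMod R"
    using P by (simp add: is_product_def)
  interpret P: left_module R P by (rule LModD[OF PL])
  interpret FP: comm_group "Fob M P" by (rule Fob_group[OF PL])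
  have "carrier P = {\<zero>\<^bsub>P\<^esub>}"
    using product_ext[OF P, of _ "\<zero>\<^bsub>P\<^esub>"] P.M.zero_closed by blast
  moreover have "\<zero>\<^bsub>P\<^esub> \<in> val P \<one>\<^bsub>Fob M P\<^esub> ` D"
    using val_range_submodule[OF PL FP.one_closed] by (simp add: left_submodule_def)
  moreover have "val P \<one>\<^bsub>Fob M P\<^esub> ` D \<subseteq> carrier P"
    using val_closed[OF PL FP.one_closed] by blast
  ultimately have "dual_generator P \<one>\<^bsub>Fob M P\<^esub>"
    using PL by (auto simp: dual_generator_def)
  then show ?thesis
    by blast
qed

text \<open>
  Dual generators may form a proper class, but those with equal kernel in \<open>D\<close> give the same submodule scheme.
  One of them is chosen for each kernel that occurs, and kernels are encoded in \<open>'u\<close> by \<open>e\<close>.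
\<close>

lemma direct_limit_exists:
  assumes le: "left_exact R M" and sml: "strict_mittag_leffler R M" and D_small: "D \<prec> (UNIV :: 'u set)"
  shows "\<exists>I S N \<theta>. direct_limit_of_submodule_schemes R M I S N \<theta> \<and> (\<forall>i\<in>I. dual_morphism_epi R M (N i) (\<theta> i))"
proof -
  define G where "G = {(N, n). dual_generator N n}"
  have Pow_small: "Pow D \<prec> (UNIV :: 'u set)"
    by (rule small_Pow[OF D_small])
  then obtain e :: "_ \<Rightarrow> 'u" where e: "inj_on e (Pow D)"
    by (auto simp: lesspoll_def lepoll_def)
  define code where "code = (\<lambda>(N, n). e (dual_kernel N n))"
  define I where "I = code ` G"
  have I_sub: "I \<subseteq> e ` Pow D"
    by (auto simp: I_def code_def dual_kernel_def)
  have I_small: "I \<prec> (UNIV :: 'u set)"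
    using lesspoll_trans1[OF lepoll_trans[OF subset_imp_lepoll[OF I_sub] image_lepoll] Pow_small] .
  have "\<forall>i\<in>I. \<exists>p. p \<in> G \<and> code p = i"
    by (auto simp: I_def)
  then obtain rep where "\<forall>i\<in>I. rep i \<in> G \<and> code (rep i) = i"
    by (rule bchoice[THEN exE])
  then have rep: "rep i \<in> G \<and> code (rep i) = i" if "i \<in> I" for i
    using that by blast
  define N where "N i = fst (rep i)" for i
  define n where "n i = snd (rep i)" for i
  have gen: "dual_generator (N i) (n i)" if "i \<in> I" for i
    using rep[OF that] by (auto simp: G_def N_def n_def split: prod.splits)
  have Nn: "N i \<in> LMod R" "n i \<in> carrier (Fob M (N i))" if "i \<in> I" for i
    using gen[OF that] by (auto simp: dual_generator_def)
  have rep_image: "\<exists>i\<in>I. \<forall>X\<in>LMod R. yoneda_image K k X \<subseteq> yoneda_image (N i) (n i) X" if K: "dual_generator K k" for K k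
  proof
    define i where "i = code (K, k)"
    show i: "i \<in> I"
      using K by (auto simp: I_def i_def G_def)
    have "e (dual_kernel (N i) (n i)) = e (dual_kernel K k)"
      using rep[OF i] by (simp add: i_def code_def N_def n_def split_beta)
    then have ker: "dual_kernel (N i) (n i) = dual_kernel K k"
      by (rule inj_onD[OF e]) (auto simp: dual_kernel_def)
    have Kk: "K \<in> LMod R" "k \<in> carrier (Fob M K)"
      using K by (auto simp: dual_generator_def)
    obtain f where f: "f \<in> mod_hom R (N i) K" "Fmap M (N i) K f (n i) = k"
      using dual_generator_factor[OF sml gen[OF i] Kk] ker by blast
    show "\<forall>X\<in>LMod R. yoneda_image K k X \<subseteq> yoneda_image (N i) (n i) X"
      using yoneda_image_mono[OF Nn[OF i] Kk(1) _ f] by blast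
  qed
  have scheme: "submodule_scheme R M (yoneda_image (N i) (n i)) (N i) (yoneda (N i) (n i))" if "i \<in> I" for i
    by (rule yoneda_submodule_scheme[OF dual_generator_faithful[OF gen[OF that]]])
  have "I \<noteq> {}"
    using dual_generator_exists by (auto simp: I_def G_def)
  moreover have "\<exists>k\<in>I. \<forall>X\<in>LMod R. yoneda_image (N i) (n i) X \<subseteq> yoneda_image (N k) (n k) X \<and>
      yoneda_image (N j) (n j) X \<subseteq> yoneda_image (N k) (n k) X" if i: "i \<in> I" and j: "j \<in> I" for i j
  proof -
    obtain K k f1 f2 where K: "dual_generator K k"
      and f1: "f1 \<in> mod_hom R K (N i)" "Fmap M K (N i) f1 k = n i"
      and f2: "f2 \<in> mod_hom R K (N j)" "Fmap M K (N j) f2 k = n j"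
      using dual_generator_directed[OF le sml gen[OF i] gen[OF j]] by blast
    have Kk: "K \<in> LMod R" "k \<in> carrier (Fob M K)"
      using K by (auto simp: dual_generator_def)
    obtain l where l: "l \<in> I" "\<forall>X\<in>LMod R. yoneda_image K k X \<subseteq> yoneda_image (N l) (n l) X"
      using rep_image[OF K] by blast
    then show ?thesis
      using yoneda_image_mono[OF Kk Nn(1)[OF i] _ f1] yoneda_image_mono[OF Kk Nn(1)[OF j] _ f2]
      by (intro bexI[of _ l] ballI) blast+
  qed
  moreover have "carrier (Fob M X) = (\<Union>i\<in>I. yoneda_image (N i) (n i) X)" if X: "X \<in> LMod R" for X
  proof
    show "carrier (Fob M X) \<subseteq> (\<Union>i\<in>I. yoneda_image (N i) (n i) X)"
    proof
      fix m assume "m \<in> carrier (Fob M X)"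
      then obtain K k f where K: "dual_generator K k" and f: "f \<in> mod_hom R K X" "Fmap M K X f k = m"
        using exists_dual_generator[OF le sml X] by blast
      then have "m \<in> yoneda_image K k X"
        by (auto simp: yoneda_image_def)
      then show "m \<in> (\<Union>i\<in>I. yoneda_image (N i) (n i) X)"
        using rep_image[OF K] X by blast
    qed
    show "(\<Union>i\<in>I. yoneda_image (N i) (n i) X) \<subseteq> carrier (Fob M X)"
      using Fmap_closed[OF Nn(1) X _ Nn(2)] by (auto simp: yoneda_image_def)
  qed
  ultimately have "direct_limit_of_submodule_schemes R M I (\<lambda>i. yoneda_image (N i) (n i)) N (\<lambda>i. yoneda (N i) (n i))"
    using I_small scheme by (simp add: direct_limit_of_submodule_schemes_def)
  moreover have "dual_morphism_epi R M (N i) (yoneda (N i) (n i))" if "i \<in> I" for i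
    using dual_morphism_epi_iff[OF scheme[OF that]] yoneda_id[OF Nn[OF that]] gen[OF that] by simp
  ultimately show ?thesis
    by blast
qed

text \<open>
  Elements of \<open>M(A)\<close> and \<open>M(B)\<close> are represented by linear maps from some \<open>N\<close>, where exactness is clear,
  and faithfulness turns equations between images of \<open>n\<close> into equations between maps.
\<close>

lemma left_exact_if_covered_by_schemes:
  assumes cover: "\<And>X m. \<lbrakk>X \<in> LMod R; m \<in> carrier (Fob M X)\<rbrakk> \<Longrightarrow>
      \<exists>N n h. faithful_element N n \<and> h \<in> mod_hom R N X \<and> Fmap M N X h n = m"
  shows "left_exact R M"
  unfolding left_exact_def
proof (intro ballI impI)
  fix A B C f g
  assume A: "A \<in> LMod R" and B: "B \<in> LMod R" and C: "C \<in> LMod R"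
    and f: "f \<in> mod_hom R A B" and g: "g \<in> mod_hom R B C"
    and exact: "inj_on f (carrier A) \<and> f ` carrier A = a_kernel B C g"
  interpret A: left_module R A by (rule LModD[OF A])
  interpret B: left_module R B by (rule LModD[OF B])
  interpret FA: comm_group "Fob M A" by (rule Fob_group[OF A])
  interpret Ff: group_hom "Fob M A" "Fob M B" "Fmap M A B f" by (rule Fmap_group_hom[OF A B f])
  have inj: "inj_on f (carrier A)" and im: "f ` carrier A = a_kernel B C g"
    using exact by auto
  \<comment> \<open>The composite of f and h kills n, hence is zero, and f is injective.\<close>
  have trivial: "d = \<one>\<^bsub>Fob M A\<^esub>" if d: "d \<in> carrier (Fob M A)" and fd: "Fmap M A B f d = \<one>\<^bsub>Fob M B\<^esub>" for d
  proof -
    obtain N n h where n: "faithful_element N n" and h: "h \<in> mod_hom R N A" and hd: "Fmap M N A h n = d"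
      using cover[OF A d] by blast
    have N: "N \<in> LMod R" and nN: "n \<in> carrier (Fob M N)"
      using n by (auto simp: faithful_element_def)
    have fh: "compose (carrier N) f h = (\<lambda>x\<in>carrier N. \<zero>\<^bsub>B\<^esub>)"
      by (rule faithful_element_eq_zero[OF n B mod_hom_compose[OF h f LModD[OF N]]])
        (simp add: Fmap_comp[OF N A B h f nN] hd fd)
    have "h = (\<lambda>x\<in>carrier N. \<zero>\<^bsub>A\<^esub>)"
    proof (rule mod_hom_eqI[OF h mod_hom_const_zero[OF LModD[OF N] LModD[OF A]]])
      fix x assume x: "x \<in> carrier N"
      have "f (h x) = f \<zero>\<^bsub>A\<^esub>"
        using fun_cong[OF fh, of x] x mod_hom_zero[OF f LModD[OF A] LModD[OF B]] by (simp add: compose_eq)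
      then show "h x = (\<lambda>x\<in>carrier N. \<zero>\<^bsub>A\<^esub>) x"
        using inj_onD[OF inj, of "h x" "\<zero>\<^bsub>A\<^esub>"] mod_homD(1)[OF h x] x by simp
    qed
    then show ?thesis
      using Fmap_const_zero[OF N A nN] hd by simp
  qed
  have "inj_on (Fmap M A B f) (carrier (Fob M A))"
    using trivial by (simp add: Ff.inj_on_one_iff)
  moreover have "Fmap M A B f ` carrier (Fob M A) = kernel (Fob M B) (Fob M C) (Fmap M B C g)"
  proof
    have gf: "compose (carrier A) g f = (\<lambda>x\<in>carrier A. \<zero>\<^bsub>C\<^esub>)"
      unfolding compose_def
    proof (rule restrict_ext)
      fix x assume "x \<in> carrier A"
      then have "f x \<in> a_kernel B C g"
        using im by blast
      then show "g (f x) = \<zero>\<^bsub>C\<^esub>"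
        by (simp add: a_kernel_iff)
    qed
    show "Fmap M A B f ` carrier (Fob M A) \<subseteq> kernel (Fob M B) (Fob M C) (Fmap M B C g)"
    proof (rule image_subsetI)
      fix k assume k: "k \<in> carrier (Fob M A)"
      have "Fmap M B C g (Fmap M A B f k) = \<one>\<^bsub>Fob M C\<^esub>"
        using Fmap_comp[OF A B C f g k] Fmap_const_zero[OF A C k] gf by simp
      then show "Fmap M A B f k \<in> kernel (Fob M B) (Fob M C) (Fmap M B C g)"
        using Fmap_closed[OF A B f k] by (simp add: kernel_def)
    qed
    show "kernel (Fob M B) (Fob M C) (Fmap M B C g) \<subseteq> Fmap M A B f ` carrier (Fob M A)"
    proof
      fix m assume "m \<in> kernel (Fob M B) (Fob M C) (Fmap M B C g)"
      then have m: "m \<in> carrier (Fob M B)" and gm: "Fmap M B C g m = \<one>\<^bsub>Fob M C\<^esub>"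
        by (auto simp: kernel_def)
      obtain N n h where n: "faithful_element N n" and h: "h \<in> mod_hom R N B" and hm: "Fmap M N B h n = m"
        using cover[OF B m] by blast
      have N: "N \<in> LMod R" and nN: "n \<in> carrier (Fob M N)"
        using n by (auto simp: faithful_element_def)
      have gh: "compose (carrier N) g h = (\<lambda>x\<in>carrier N. \<zero>\<^bsub>C\<^esub>)"
        by (rule faithful_element_eq_zero[OF n C mod_hom_compose[OF h g LModD[OF N]]])
          (simp add: Fmap_comp[OF N B C h g nN] hm gm)
      \<comment> \<open>The map h lands in the kernel of g, so it factors through f.\<close>
      define k where "k x = the_inv_into (carrier A) f (h x)" for x
      have h_im: "h x \<in> f ` carrier A" if "x \<in> carrier N" for x
        unfolding im using fun_cong[OF gh, of x] that mod_homD(1)[OF h that] by (simp add: a_kernel_iff compose_eq)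
      have kA: "k x \<in> carrier A" and fk: "f (k x) = h x" if "x \<in> carrier N" for x
        unfolding k_def
        by (rule the_inv_into_into[OF inj h_im[OF that] subset_refl], rule f_the_inv_into_f[OF inj h_im[OF that]])
      interpret N: left_module R N by (rule LModD[OF N])
      have k: "(\<lambda>x\<in>carrier N. k x) \<in> mod_hom R N A"
      proof (rule mod_homI[OF kA _ _ N.left_module_axioms])
        show "k (x \<oplus>\<^bsub>N\<^esub> y) = k x \<oplus>\<^bsub>A\<^esub> k y" if "x \<in> carrier N" "y \<in> carrier N" for x y
          by (rule inj_onD[OF inj]) (use that in \<open>simp_all add: fk kA mod_homD(2)[OF f] mod_homD(2)[OF h]\<close>)
        show "k (a \<odot>\<^bsub>N\<^esub> x) = a \<odot>\<^bsub>A\<^esub> k x" if "a \<in> carrier R" "x \<in> carrier N" for a x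
          by (rule inj_onD[OF inj])
            (use that in \<open>simp_all add: fk kA mod_homD(3)[OF f] mod_homD(3)[OF h] A.smult_closed N.smult_closed\<close>)
      qed
      have "compose (carrier N) f (\<lambda>x\<in>carrier N. k x) = h"
        by (rule mod_hom_eqI[OF mod_hom_compose[OF k f LModD[OF N]] h]) (simp add: compose_eq fk)
      then have "m = Fmap M A B f (Fmap M N A (\<lambda>x\<in>carrier N. k x) n)"
        using Fmap_comp[OF N A B k f nN] hm by simp
      then show "m \<in> Fmap M A B f ` carrier (Fob M A)"
        using Fmap_closed[OF N A k nN] by (rule image_eqI)
    qed
  qed
  ultimately show "inj_on (Fmap M A B f) (carrier (Fob M A)) \<and>
      Fmap M A B f ` carrier (Fob M A) = kernel (Fob M B) (Fob M C) (Fmap M B C g)"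
    by blast
qed

text \<open>
  If \<open>m = h\<^sub>* n\<close>, then \<open>h\<close> vanishes at every \<open>val N n w\<close>, since its value there is \<open>val X m w\<close>.
\<close>

lemma strict_mittag_leffler_if_covered_by_dual_generators:
  assumes cover: "\<And>X m. \<lbrakk>X \<in> LMod R; m \<in> carrier (Fob M X)\<rbrakk> \<Longrightarrow>
      \<exists>N n h. dual_generator N n \<and> h \<in> mod_hom R N X \<and> Fmap M N X h n = m"
  shows "strict_mittag_leffler R M"
  unfolding strict_mittag_leffler_iff
proof (intro ballI impI)
  fix X m assume X: "X \<in> LMod R" and m: "m \<in> carrier (Fob M X)" and zero: "\<forall>w\<in>D. val X m w = \<zero>\<^bsub>X\<^esub>"
  obtain N n h where gen: "dual_generator N n" and h: "h \<in> mod_hom R N X" and hm: "Fmap M N X h n = m"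
    using cover[OF X m] by blast
  have N: "N \<in> LMod R" and n: "n \<in> carrier (Fob M N)" and surj: "val N n ` D = carrier N"
    using gen by (auto simp: dual_generator_def)
  have "h = (\<lambda>x\<in>carrier N. \<zero>\<^bsub>X\<^esub>)"
  proof (rule mod_hom_eqI[OF h mod_hom_const_zero[OF LModD[OF N] LModD[OF X]]])
    fix x assume x: "x \<in> carrier N"
    then obtain w where w: "w \<in> D" "x = val N n w"
      using surj by blast
    have "h x = val X m w"
      unfolding w(2) val_Fmap[OF N X h n w(1), symmetric] hm ..
    then show "h x = (\<lambda>x\<in>carrier N. \<zero>\<^bsub>X\<^esub>) x"
      using zero w(1) x by simp
  qed
  then show "m = \<one>\<^bsub>Fob M X\<^esub>"
    using Fmap_const_zero[OF N X n] hm by simp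
qed

lemma direct_limit_imp_left_exact_strict_mittag_leffler:
  assumes lim: "direct_limit_of_submodule_schemes R M I S N \<theta>"
    and epi: "\<forall>i\<in>I. dual_morphism_epi R M (N i) (\<theta> i)"
  shows "left_exact R M \<and> strict_mittag_leffler R M"
proof -
  have cover: "\<exists>N n h. dual_generator N n \<and> h \<in> mod_hom R N X \<and> Fmap M N X h n = m"
    if X: "X \<in> LMod R" and m: "m \<in> carrier (Fob M X)" for X m
  proof -
    obtain i where i: "i \<in> I" "m \<in> S i X"
      using lim X m by (auto simp: direct_limit_of_submodule_schemes_def)
    then have sub: "submodule_scheme R M (S i) (N i) (\<theta> i)"
      using lim by (simp add: direct_limit_of_submodule_schemes_def)
    have "dual_generator (N i) (\<theta> i (N i) (\<lambda>x\<in>carrier (N i). x))"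
      using epi i(1) dual_morphism_epi_iff[OF sub] by blast
    moreover have "m \<in> yoneda_image (N i) (\<theta> i (N i) (\<lambda>x\<in>carrier (N i). x)) X"
      using submodule_schemeD(2)[OF sub X] i(2) by blast
    ultimately show ?thesis
      unfolding yoneda_image_def by blast
  qed
  then have "left_exact R M"
    using left_exact_if_covered_by_schemes dual_generator_faithful by meson
  then show ?thesis
    using strict_mittag_leffler_if_covered_by_dual_generators[OF cover] by blast
qed

section \<open>Comparison with the Mittag-Leffler condition\<close>

lemma strict_mittag_leffler_imp_mittag_leffler:
  assumes sml: "strict_mittag_leffler R M"
  shows "mittag_leffler R M"
  unfolding mittag_leffler_def
proof (intro allI impI inj_onI)
  fix I N P \<pi> m m'
  assume "I \<prec> (UNIV :: 'u set) \<and> (\<forall>i\<in>I. N i \<in> LMod R) \<and> is_product R I N P \<pi>"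
    and m: "m \<in> carrier (Fob M P)" and m': "m' \<in> carrier (Fob M P)"
    and eq: "(\<lambda>i\<in>I. Fmap M P (N i) (\<pi> i) m) = (\<lambda>i\<in>I. Fmap M P (N i) (\<pi> i) m')"
  then have N: "\<And>i. i \<in> I \<Longrightarrow> N i \<in> LMod R" and P: "is_product R I N P \<pi>"
    by auto
  have PL: "P \<in> LMod R" and \<pi>: "\<And>i. i \<in> I \<Longrightarrow> \<pi> i \<in> mod_hom R P (N i)"
    using P by (auto simp: is_product_def)
  have "val P m = val P m'"
  proof (rule extensionalityI[of _ D])
    fix w assume w: "w \<in> D"
    show "val P m w = val P m' w"
    proof (rule product_ext[OF P val_closed[OF PL m w] val_closed[OF PL m' w]])
      fix i assume i: "i \<in> I"
      have "Fmap M P (N i) (\<pi> i) m = Fmap M P (N i) (\<pi> i) m'"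
        using fun_cong[OF eq, of i] i by simp
      then show "\<pi> i (val P m w) = \<pi> i (val P m' w)"
        using val_Fmap[OF PL N[OF i] \<pi>[OF i] m w] val_Fmap[OF PL N[OF i] \<pi>[OF i] m' w] by simp
    qed
  qed (simp_all add: eval_map_def)
  then show "m = m'"
    by (rule strict_mittag_lefflerD[OF sml PL m m'])
qed

text \<open>
  \<open>N\<close> is the intersection of all submodules \<open>K\<close> from which \<open>m\<close> comes, realised as the kernel of the map
  \<open>h\<close> from \<open>X\<close> to the product of the quotients \<open>X/K\<close>. As \<open>m\<close> vanishes in each factor, it vanishes in the
  product and lifts to \<open>n \<in> M(N)\<close>. If \<open>k\<^sub>* n = 0\<close>, then \<open>n\<close> comes from the kernel of \<open>k\<close>, which by minimality
  is all of \<open>N\<close>.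
\<close>

lemma exists_faithful_element:
  assumes le: "left_exact R M" and ml: "mittag_leffler R M"
    and X: "X \<in> LMod R" and m: "m \<in> carrier (Fob M X)"
  shows "\<exists>N n. left_submodule R X N \<and> faithful_element (X\<lparr>carrier := N\<rparr>) n \<and>
    Fmap M (X\<lparr>carrier := N\<rparr>) X (\<lambda>x\<in>N. x) n = m"
proof -
  define supports where "supports K \<longleftrightarrow> left_submodule R X K \<and>
    (\<exists>n\<in>carrier (Fob M (X\<lparr>carrier := K\<rparr>)). Fmap M (X\<lparr>carrier := K\<rparr>) X (\<lambda>x\<in>K. x) n = m)" for K
  have "Pow (carrier X) \<prec> (UNIV :: 'u set)"
    using X by (intro small_Pow) (simp add: LMod_def)
  then obtain e :: "'u set \<Rightarrow> 'u" where e: "inj_on e (Pow (carrier X))" and e_small: "e ` Pow (carrier X) \<prec> (UNIV :: 'u set)"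
    by (metis inj_on_image_lesspoll_1 lepoll_def lesspoll_imp_lepoll)
  define I where "I = e ` Collect supports"
  have supp_sub: "Collect supports \<subseteq> Pow (carrier X)"
    by (auto simp: supports_def left_submodule_def)
  have I_small: "I \<prec> (UNIV :: 'u set)"
    unfolding I_def by (rule lesspoll_trans1[OF subset_imp_lepoll[OF image_mono[OF supp_sub]] e_small])
  define d where "d = the_inv_into (Collect supports) e"
  have de: "d (e K) = K" if "supports K" for K
    unfolding d_def by (rule the_inv_into_f_f[OF inj_on_subset[OF e supp_sub]]) (simp add: that)
  have d: "supports (d i)" if "i \<in> I" for i
    using that de by (auto simp: I_def)
  have "\<exists>C g. C \<in> LMod R \<and> g \<in> mod_hom R X C \<and> a_kernel X C g = d i" if "i \<in> I" for i
    using quotient_exists[OF X, of "d i"] d[OF that] by (auto simp: supports_def)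
  then obtain C g where C: "\<And>i. i \<in> I \<Longrightarrow> C i \<in> LMod R" and g: "\<And>i. i \<in> I \<Longrightarrow> g i \<in> mod_hom R X (C i)"
    and ker: "\<And>i. i \<in> I \<Longrightarrow> a_kernel X (C i) (g i) = d i"
    by metis
  obtain P \<pi> where P: "is_product R I C P \<pi>"
    using product_exists[OF R.ring_axioms I_small, of C] C by blast
  have PL: "P \<in> LMod R" and \<pi>: "\<And>i. i \<in> I \<Longrightarrow> \<pi> i \<in> mod_hom R P (C i)"
    using P by (auto simp: is_product_def)
  obtain h where h: "h \<in> mod_hom R X P" and \<pi>h: "\<And>i x. \<lbrakk>i \<in> I; x \<in> carrier X\<rbrakk> \<Longrightarrow> \<pi> i (h x) = g i x"
    using product_lift[OF P LModD[OF X] g] by blast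
  interpret P: left_module R P by (rule LModD[OF PL])
  interpret FP: group "Fob M P" by (rule Fob_is_group[OF PL])
  define N where "N = a_kernel X P h"
  have N_sub: "left_submodule R X N"
    unfolding N_def by (rule left_submodule_kernel[OF h LModD[OF X] LModD[OF PL]])
  have N_least: "N \<subseteq> K" if K: "supports K" for K
  proof
    fix x assume "x \<in> N"
    then have x: "x \<in> carrier X" and hx: "h x = \<zero>\<^bsub>P\<^esub>"
      by (auto simp: N_def a_kernel_iff)
    have i: "e K \<in> I"
      using K by (simp add: I_def)
    have "g (e K) x = \<zero>\<^bsub>C (e K)\<^esub>"
      using \<pi>h[OF i x] hx mod_hom_zero[OF \<pi>[OF i] LModD[OF PL] LModD[OF C[OF i]]] by simp
    then have "x \<in> a_kernel X (C (e K)) (g (e K))"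
      using x by (simp add: a_kernel_iff)
    then show "x \<in> K"
      using ker[OF i] de[OF K] by simp
  qed
  have hm: "Fmap M X P h m = \<one>\<^bsub>Fob M P\<^esub>"
  proof -
    have "Fmap M P (C i) (\<pi> i) (Fmap M X P h m) = Fmap M P (C i) (\<pi> i) \<one>\<^bsub>Fob M P\<^esub>" if i: "i \<in> I" for i
    proof -
      let ?K = "X\<lparr>carrier := d i\<rparr>"
      have K_sub: "left_submodule R X (d i)"
        using d[OF i] by (simp add: supports_def)
      obtain n where n: "n \<in> carrier (Fob M ?K)" and inc_n: "Fmap M ?K X (\<lambda>x\<in>d i. x) n = m"
        using d[OF i] by (auto simp: supports_def)
      note K = left_submodule_LMod[OF X K_sub] and inc = left_submodule_inclusion[OF X K_sub]
      have "compose (carrier X) (\<pi> i) h = g i"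
        by (rule mod_hom_eqI[OF mod_hom_compose[OF h \<pi>[OF i] LModD[OF X]] g[OF i]]) (simp add: compose_eq \<pi>h i)
      then have "Fmap M P (C i) (\<pi> i) (Fmap M X P h m) = Fmap M X (C i) (g i) m"
        using Fmap_comp[OF X PL C[OF i] h \<pi>[OF i] m] by simp
      also have "\<dots> = Fmap M ?K (C i) (compose (carrier ?K) (g i) (\<lambda>x\<in>d i. x)) n"
        using Fmap_comp[OF K X C[OF i] inc g[OF i] n] inc_n by simp
      also have "compose (carrier ?K) (g i) (\<lambda>x\<in>d i. x) = (\<lambda>x\<in>carrier ?K. \<zero>\<^bsub>C i\<^esub>)"
        unfolding compose_def
      proof (rule restrict_ext)
        fix x assume "x \<in> carrier ?K"
        then have "x \<in> a_kernel X (C i) (g i)" and x: "x \<in> d i"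
          using ker[OF i] by auto
        then show "g i ((\<lambda>x\<in>d i. x) x) = \<zero>\<^bsub>C i\<^esub>"
          by (simp add: a_kernel_iff)
      qed
      also have "Fmap M ?K (C i) (\<lambda>x\<in>carrier ?K. \<zero>\<^bsub>C i\<^esub>) n = \<one>\<^bsub>Fob M (C i)\<^esub>"
        by (rule Fmap_const_zero[OF K C[OF i] n])
      finally show ?thesis
        using Fmap_one[OF PL C[OF i] \<pi>[OF i]] by simp
    qed
    then have "(\<lambda>i\<in>I. Fmap M P (C i) (\<pi> i) (Fmap M X P h m)) = (\<lambda>i\<in>I. Fmap M P (C i) (\<pi> i) \<one>\<^bsub>Fob M P\<^esub>)"
      by (rule restrict_ext)
    moreover have "inj_on (\<lambda>m. \<lambda>i\<in>I. Fmap M P (C i) (\<pi> i) m) (carrier (Fob M P))"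
      using ml I_small C P unfolding mittag_leffler_def by blast
    ultimately show ?thesis
      using Fmap_closed[OF X PL h m] FP.one_closed by (simp add: inj_on_def)
  qed
  let ?N = "X\<lparr>carrier := N\<rparr>"
  note NL = left_submodule_LMod[OF X N_sub] and incN = left_submodule_inclusion[OF X N_sub]
  obtain n where n: "n \<in> carrier (Fob M ?N)" and inc_n: "Fmap M ?N X (\<lambda>x\<in>N. x) n = m"
    using left_exact_lift[OF le X PL h m hm] unfolding N_def by blast
  have zero: "k = (\<lambda>x\<in>N. \<zero>\<^bsub>Z\<^esub>)" if Z: "Z \<in> LMod R" and k: "k \<in> mod_hom R ?N Z" and kn: "Fmap M ?N Z k n = \<one>\<^bsub>Fob M Z\<^esub>" for Z k
  proof -
    define K where "K = a_kernel ?N Z k"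
    let ?K = "X\<lparr>carrier := K\<rparr>"
    have KN: "K \<subseteq> N"
      by (auto simp: K_def a_kernel_iff)
    have K_sub_N: "left_submodule R ?N K"
      unfolding K_def by (rule left_submodule_kernel[OF k LModD[OF NL] LModD[OF Z]])
    then have K_sub: "left_submodule R X K"
      using N_sub by (auto simp: left_submodule_def)
    obtain l where l: "l \<in> carrier (Fob M ?K)" and inc_l: "Fmap M ?K ?N (\<lambda>x\<in>K. x) l = n"
      using left_exact_lift[OF le NL Z k n kn] unfolding K_def by auto
    have incKN: "(\<lambda>x\<in>K. x) \<in> mod_hom R ?K ?N"
      using left_submodule_inclusion[OF NL K_sub_N] by simp
    have "compose (carrier ?K) (\<lambda>x\<in>N. x) (\<lambda>x\<in>K. x) = (\<lambda>x\<in>K. x)"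
      unfolding compose_def by (simp, rule restrict_ext) (use KN in auto)
    then have "Fmap M ?K X (\<lambda>x\<in>K. x) l = m"
      using Fmap_comp[OF left_submodule_LMod[OF X K_sub] NL X incKN incN l] inc_l inc_n by simp
    then have "supports K"
      using K_sub l by (auto simp: supports_def)
    then have "N \<subseteq> K"
      by (rule N_least)
    show ?thesis
    proof (rule extensionalityI[of _ N])
      show "k \<in> extensional N"
        using mod_homD(4)[OF k] by simp
      show "k x = (\<lambda>x\<in>N. \<zero>\<^bsub>Z\<^esub>) x" if "x \<in> N" for x
        using that \<open>N \<subseteq> K\<close> by (auto simp: K_def a_kernel_iff)
    qed simp
  qed
  have "inj_on (\<lambda>f. Fmap M ?N Z f n) (mod_hom R ?N Z)" if Z: "Z \<in> LMod R" for Z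
  proof (rule inj_onI)
    fix p q assume p: "p \<in> mod_hom R ?N Z" and q: "q \<in> mod_hom R ?N Z"
      and eq: "Fmap M ?N Z p n = Fmap M ?N Z q n"
    interpret Z: left_module R Z by (rule LModD[OF Z])
    interpret FZ: group "Fob M Z" by (rule Fob_is_group[OF Z])
    note nq = mod_hom_minus[OF q LModD[OF NL] LModD[OF Z]]
    \<comment> \<open>Injectivity follows from the case of the difference of the two maps.\<close>
    let ?k = "\<lambda>x\<in>carrier ?N. p x \<oplus>\<^bsub>Z\<^esub> (\<lambda>x\<in>carrier ?N. \<ominus>\<^bsub>Z\<^esub> q x) x"
    have "Fmap M ?N Z ?k n = \<one>\<^bsub>Fob M Z\<^esub>"
      using Fmap_add[OF NL Z p nq n] Fmap_minus[OF NL Z q n] eq Fmap_closed[OF NL Z q n] by simp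
    then have k: "?k = (\<lambda>x\<in>N. \<zero>\<^bsub>Z\<^esub>)"
      by (rule zero[OF Z mod_hom_add[OF p nq LModD[OF NL] LModD[OF Z]]])
    show "p = q"
    proof (rule mod_hom_eqI[OF p q])
      fix x assume x: "x \<in> carrier ?N"
      have "p x \<oplus>\<^bsub>Z\<^esub> \<ominus>\<^bsub>Z\<^esub> q x = \<zero>\<^bsub>Z\<^esub>"
        using fun_cong[OF k, of x] x by simp
      then show "p x = q x"
        using Z.M.minus_equality[of "p x" "\<ominus>\<^bsub>Z\<^esub> q x"] mod_homD(1)[OF p x] mod_homD(1)[OF q x] by simp
    qed
  qed
  then have "faithful_element ?N n"
    using NL n by (simp add: faithful_element_def)
  then show ?thesis
    using N_sub inc_n by blast
qed

lemma strict_mittag_leffler_if_mittag_leffler_epi: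
  assumes le: "left_exact R M" and ml: "mittag_leffler R M"
    and epi: "\<And>S N \<theta>. submodule_scheme R M S N \<theta> \<Longrightarrow> dual_morphism_epi R M N \<theta>"
  shows "strict_mittag_leffler R M"
proof (rule strict_mittag_leffler_if_covered_by_dual_generators)
  fix X m assume X: "X \<in> LMod R" and m: "m \<in> carrier (Fob M X)"
  obtain N n where N: "left_submodule R X N" and n: "faithful_element (X\<lparr>carrier := N\<rparr>) n"
    and inc_n: "Fmap M (X\<lparr>carrier := N\<rparr>) X (\<lambda>x\<in>N. x) n = m"
    using exists_faithful_element[OF le ml X m] by blast
  note sub = yoneda_submodule_scheme[OF n]
  have "yoneda (X\<lparr>carrier := N\<rparr>) n (X\<lparr>carrier := N\<rparr>) (\<lambda>x\<in>carrier (X\<lparr>carrier := N\<rparr>). x) = n"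
    by (rule yoneda_id) (use n in \<open>auto simp: faithful_element_def\<close>)
  then have "dual_generator (X\<lparr>carrier := N\<rparr>) n"
    using epi[OF sub] dual_morphism_epi_iff[OF sub] by simp
  then show "\<exists>N n h. dual_generator N n \<and> h \<in> mod_hom R N X \<and> Fmap M N X h n = m"
    using left_submodule_inclusion[OF X N] inc_n by blast
qed

lemma strict_mittag_leffler_imp_epi:
  assumes sml: "strict_mittag_leffler R M" and sub: "submodule_scheme R M S N \<theta>"
  shows "dual_morphism_epi R M N \<theta>"
  using dual_morphism_epi_iff[OF sub] faithful_element_dual_generator[OF sml submodule_schemeD(1)[OF sub]] by blast

end

section \<open>The two characterisations of left exact strict Mittag-Leffler modules\<close>

theorem theorem5p7:
  fixes R :: "('u::set_universe) ring" and M :: "('u, 'v) module_functor"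
  assumes "ring R" and "carrier R \<prec> (UNIV :: 'u set)"
    and "functorial_module R M"
    and "\<forall>Y\<in>RMod R. dual R M Y \<prec> (UNIV :: 'u set)"
  shows "(left_exact R M \<and> strict_mittag_leffler R M \<longleftrightarrow>
            (\<exists>I S N \<theta>. direct_limit_of_submodule_schemes R M I S N \<theta> \<and>
               (\<forall>i\<in>I. dual_morphism_epi R M (N i) (\<theta> i)))) \<and>
         (left_exact R M \<and> strict_mittag_leffler R M \<longleftrightarrow>
            left_exact R M \<and> mittag_leffler R M \<and>
            (\<forall>S N \<theta>. submodule_scheme R M S N \<theta> \<longrightarrow> dual_morphism_epi R M N \<theta>))"
proof -
  interpret functor_over_ring R M
    using assms(1-3) by (simp add: functor_over_ring_def functor_over_ring_axioms_def)
  have D_small: "dual R M (regular_right R) \<prec> (UNIV :: 'u set)"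
    using assms(4) regular_right_in_RMod by blast
  show ?thesis
  proof (intro conjI iffI)
    assume "left_exact R M \<and> strict_mittag_leffler R M"
    then show "\<exists>I S N \<theta>. direct_limit_of_submodule_schemes R M I S N \<theta> \<and>
               (\<forall>i\<in>I. dual_morphism_epi R M (N i) (\<theta> i))"
      using direct_limit_exists D_small by blast
  qed (use direct_limit_imp_left_exact_strict_mittag_leffler strict_mittag_leffler_imp_mittag_leffler
      strict_mittag_leffler_imp_epi strict_mittag_leffler_if_mittag_leffler_epi in blast)+
qed

end
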